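(* Let $L$ be an involutive link such that the fixed point set $\mathbf a$ of $\tau$ meets at least one component of $L$. Then for all $i,j\in\mathbb{Z}$ and $k\in\frac12\mathbb{Z}$ there is a splitting $$\operatorname{Kh}_\tau^{i,j,k}(L)\cong\widetilde{\operatorname{Kh}}{}_\tau^{\,i,j+1,k}(L)\oplus\widetilde{\operatorname{Kh}}{}_\tau^{\,i,j-1,k}(L).$$ In particular, such a splitting always exists for strongly invertible links.
   Context: Involutive links. Let $R\colon S^2\to S^2$ be reflection in a great circle $\mathbf a\subset S^2$, and let $\tau\colon S^3\to S^3$ be the orientation-preserving involution obtained from $(p,q)\mapsto(R(p),-q)$ on $S^2\times(-\infty,\infty)$ by adding two points $\pm\infty$ (which $\tau$ exchanges). Its fixed point set is the axis $\mathbf a$. An involutive link is an (oriented) link $L\subset S^3$ with $\tau(L)=L$ as a set and $\mathbf a\not\subset L$, up to isotopy through involutive links. It is strongly invertible if $\tau$ reverses any choice of orientation on $L$ (equivalently, every component meets $\mathbf a$ in exactly two points). An involutive diagram is the projection to $S^2$, with over/under information, of a generic involutive link missing $\pm\infty$; it is symmetric under $R$. A crossing is on-axis if it lies on $\mathbf a$ and off-axis otherwise. Khovanov complex. $\mathbb{F}=\mathbb{Z}/2\mathbb{Z}$. For a diagram $D$ with $n_+$ positive and $n_-$ negative crossings, $\operatorname{CKh}^{i,j}(D)$ has basis the decorations by $v_+$ or $v_-$ of the components of smoothings $s$ of $D$ with $i=\#\{1\text{-smoothings}\}-n_-$ and $j=\#v_+-\#v_-+\#\{1\text{-smoothings}\}+n_+-2n_-$;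 $d\colon \operatorname{CKh}^{i,j}\to\operatorname{CKh}^{i+1,j}$ is the Khovanov differential. Perturbed complex. If $D$ is an involutive diagram, reflection in $\mathbf a$ gives an involution on smoothings and bijections between components of a smoothing and of its image, inducing an involution $\tau$ on $\operatorname{CKh}(D)$ commuting with $d$. Put $d_\tau=\mathrm{id}+\tau$, $\partial=d+d_\tau$. $\operatorname{CKh}_\tau^j(D)$ is $\bigoplus_i\operatorname{CKh}^{i,j}(D)$ with differential $\partial$, and $\mathbf{H}_\tau^j(D)$ is its cohomology. Filtrations. $\mathcal F^i\operatorname{CKh}_\tau^j(D)=\bigoplus_{l\le i}\operatorname{CKh}^{l,j}(D)$. Each smoothing $s$ has a weight $w(s)\in\frac12\mathbb{Z}$, the sum over crossings $c$ of local contributions, where $o(c)$ is the oriented smoothing and $u(c)$ the other smoothing of $c$: (1) $c$ off-axis: $o(c)$ contributes $0$, and $u(c)$ contributes $\frac12$ (resp. $-\frac12$) if $c$ is positive (resp. negative); (2) $c$ on-axis and the involution reverses the orientations of $c$: $o(c)$ contributes $0$, and $u(c)$ contributes $1$ (resp. $-1$) if $c$ is positive (resp. negative); (3) $c$ on-axis and the involution preserves the orientations of $c$: if $c$ is positive, $o(c)$ contributes $-\frac12$ and $u(c)$ contributes $\frac12$; if $c$ is negative, $o(c)$ contributes $\frac12$ and $u(c)$ contributes $-\frac12$. Decorations of $s$ have $k$-grading $w(s)$, and $\mathcal G^k\operatorname{CKh}_\tau^j(D)$ is the span of those with $w(s)\ge k$. Triple grading. For a bifiltered space $V$ put $V^{i,k}=(\mathcal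 F^iV\cap\mathcal G^kV)/\big((\mathcal F^iV\cap\mathcal G^{k+\frac12}V)+(\mathcal F^{i-1}V\cap\mathcal G^kV)\big)$. $\operatorname{Kh}_\tau^{i,j,k}(L)$ is $V^{i,k}$ for $V=\mathbf{H}_\tau^j(D)$ with the filtrations induced by $\mathcal F,\mathcal G$. Reduced version. If $L$ has a component meeting $\mathbf a$, choose a point of $L\cap\mathbf a$ as basepoint. Let $\widetilde{\operatorname{CKh}}{}_\tau^{\,j}(D)$ be the subcomplex of $\operatorname{CKh}_\tau^{j-1}(D)$ spanned by decorated smoothings whose basepointed component is decorated with $v_-$, with differential $\partial$ and the restricted filtrations $\mathcal F,\mathcal G$ (so the quantum degree is shifted by one). Its cohomology is $\widetilde{\mathbf H}{}_\tau^j(D)$, and $\widetilde{\operatorname{Kh}}{}_\tau^{\,i,j,k}(L)$ is $V^{i,k}$ for $V=\widetilde{\mathbf H}{}_\tau^j(D)$. *)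

theory Defs
  imports "HOL-Analysis.Analysis" "HOL-Algebra.Module" "HOL-Algebra.AbelCoset" "HOL-Library.Z2"
begin

section \<open>Involutive links\<close>

text \<open>
  The three-sphere is \<open>S\<^sup>2 \<times> \<real>\<close> with two points \<open>\<plusminus>\<infinity>\<close> added.  An involutive diagram comes from a link
  missing \<open>\<plusminus>\<infinity>\<close>, so links live in \<^term>\<open>sphere 0 1 \<times> UNIV\<close>; the projection to \<open>S\<^sup>2\<close> is \<^const>\<open>fst\<close>
  and the height of a point is its second component.  The great circle is given by a unit
  normal vector \<open>n\<close>.
\<close>

type_synonym point = "(real^3) \<times> real"
type_synonym curve = "real \<Rightarrow> point"

definition reflection :: "real^3 \<Rightarrow> real^3 \<Rightarrow> real^3" where
  "reflection n p = p - (2 * (p \<bullet> n)) *\<^sub>R n"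

definition great_circle :: "real^3 \<Rightarrow> (real^3) set" where
  "great_circle n = {p \<in> sphere 0 1. p \<bullet> n = 0}"

definition tau :: "real^3 \<Rightarrow> point \<Rightarrow> point" where
  "tau n x = (reflection n (fst x), - snd x)"

definition fixed_axis :: "real^3 \<Rightarrow> point set" where
  "fixed_axis n = great_circle n \<times> {0}"

text \<open>
  A component of an oriented link is an embedded circle, parametrized with period 1 by a
  regular \<open>C\<^sup>1\<close> map and oriented by that parametrization.
\<close>

definition closed_curve :: "curve \<Rightarrow> bool" where
  "closed_curve \<gamma> \<longleftrightarrow>
     \<gamma> C1_differentiable_on UNIV \<and>
     range \<gamma> \<subseteq> sphere 0 1 \<times> UNIV \<and>
     (\<forall>t. vector_derivative \<gamma> (at t) \<noteq> 0) \<and>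
     (\<forall>s t. \<gamma> s = \<gamma> t \<longleftrightarrow> s - t \<in> \<int>)"

definition oriented_link :: "curve set \<Rightarrow> bool" where
  "oriented_link \<Gamma> \<longleftrightarrow>
     finite \<Gamma> \<and> (\<forall>\<gamma>\<in>\<Gamma>. closed_curve \<gamma>) \<and>
     (\<forall>\<gamma>\<in>\<Gamma>. \<forall>\<delta>\<in>\<Gamma>. \<gamma> \<noteq> \<delta> \<longrightarrow> range \<gamma> \<inter> range \<delta> = {})"

definition link_set :: "curve set \<Rightarrow> point set" where
  "link_set \<Gamma> = (\<Union>\<gamma>\<in>\<Gamma>. range \<gamma>)"

definition involutive_link :: "real^3 \<Rightarrow> curve set \<Rightarrow> bool" where
  "involutive_link n \<Gamma> \<longleftrightarrow>
     oriented_link \<Gamma> \<and> tau n ` link_set \<Gamma> = link_set \<Gamma> \<and> \<not> fixed_axis n \<subseteq> link_set \<Gamma>"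

definition tau_reverses :: "real^3 \<Rightarrow> curve set \<Rightarrow> bool" where
  "tau_reverses n \<Gamma> \<longleftrightarrow>
     (\<forall>\<gamma>\<in>\<Gamma>. \<exists>\<delta>\<in>\<Gamma>. \<exists>h. continuous_on UNIV h \<and> (\<forall>s t. s < t \<longrightarrow> h t < h s) \<and>
        (\<forall>t. tau n (\<gamma> t) = \<delta> (h t)))"

text \<open>
  Here \<open>\<Gamma>'\<close> ranges over all choices of orientation on the components of \<open>\<Gamma>\<close> (and over
  all parametrizations).
\<close>

definition strongly_invertible :: "real^3 \<Rightarrow> curve set \<Rightarrow> bool" where
  "strongly_invertible n \<Gamma> \<longleftrightarrow>
     involutive_link n \<Gamma> \<and>
     (\<forall>\<Gamma>'. oriented_link \<Gamma>' \<and> link_set \<Gamma>' = link_set \<Gamma> \<longrightarrow> tau_reverses n \<Gamma>')"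

section \<open>Diagrams\<close>

definition shadow :: "curve set \<Rightarrow> (real^3) set" where
  "shadow \<Gamma> = fst ` link_set \<Gamma>"

definition crossings :: "curve set \<Rightarrow> (real^3) set" where
  "crossings \<Gamma> = {p. \<exists>x\<in>link_set \<Gamma>. \<exists>y\<in>link_set \<Gamma>. x \<noteq> y \<and> fst x = p \<and> fst y = p}"

definition upper_point :: "curve set \<Rightarrow> real^3 \<Rightarrow> point" where
  "upper_point \<Gamma> p = (p, Max {q. (p, q) \<in> link_set \<Gamma>})"

definition lower_point :: "curve set \<Rightarrow> real^3 \<Rightarrow> point" where
  "lower_point \<Gamma> p = (p, Min {q. (p, q) \<in> link_set \<Gamma>})"

definition tangent :: "curve set \<Rightarrow> point \<Rightarrow> point" where
  "tangent \<Gamma> x = (THE v. \<exists>\<gamma>\<in>\<Gamma>. \<exists>t. \<gamma> t = x \<and> v = vector_derivative \<gamma> (at t))"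

text \<open>
  The determinant of the projected directions of the over- and the understrand, in \<open>S\<^sup>2\<close>
  oriented by the outward normal (the diagram is viewed from \<open>+\<infinity>\<close>).  It is nonzero iff
  the strands cross transversally, and positive iff turning counterclockwise by less
  than a half turn takes the direction of the overstrand to that of the understrand.
\<close>

definition crossing_det :: "curve set \<Rightarrow> real^3 \<Rightarrow> real" where
  "crossing_det \<Gamma> p =
     det (vector [p, fst (tangent \<Gamma> (upper_point \<Gamma> p)),
                     fst (tangent \<Gamma> (lower_point \<Gamma> p))] :: real^3^3)"

definition generic_projection :: "curve set \<Rightarrow> bool" where
  "generic_projection \<Gamma> \<longleftrightarrow>
     (\<forall>\<gamma>\<in>\<Gamma>. \<forall>t. fst (vector_derivative \<gamma> (at t)) \<noteq> 0) \<and>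
     finite (crossings \<Gamma>) \<and>
     (\<forall>p\<in>crossings \<Gamma>. card {x \<in> link_set \<Gamma>. fst x = p} = 2 \<and> crossing_det \<Gamma> p \<noteq> 0)"

definition positive_crossing :: "curve set \<Rightarrow> real^3 \<Rightarrow> bool" where
  "positive_crossing \<Gamma> p \<longleftrightarrow> crossing_det \<Gamma> p > 0"

definition n_plus :: "curve set \<Rightarrow> nat" where
  "n_plus \<Gamma> = card {p \<in> crossings \<Gamma>. positive_crossing \<Gamma> p}"

definition n_minus :: "curve set \<Rightarrow> nat" where
  "n_minus \<Gamma> = card {p \<in> crossings \<Gamma>. \<not> positive_crossing \<Gamma> p}"

section \<open>Smoothings\<close>

text \<open>
  A smoothing is the set \<open>s\<close> of those crossings that receive the 1-smoothing.  The crossings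
  cut the shadow into arcs (a crossingless component is an arc by itself), and
  smoothing a crossing joins the ends of arcs there in pairs.  A component of a
  smoothing is represented by the set of the arcs it contains.
\<close>

type_synonym arc = "(real^3) set"
type_synonym circle = "arc set"
type_synonym smoothing = "(real^3) set"

definition arcs :: "curve set \<Rightarrow> arc set" where
  "arcs \<Gamma> = components (shadow \<Gamma> - crossings \<Gamma>)"

definition arc_in :: "curve set \<Rightarrow> point \<Rightarrow> arc" where
  "arc_in \<Gamma> x = (THE A. A \<in> arcs \<Gamma> \<and>
     (\<exists>\<gamma>\<in>\<Gamma>. \<exists>t. \<gamma> t = x \<and> (\<forall>\<^sub>F s in at_left t. fst (\<gamma> s) \<in> A)))"

definition arc_out :: "curve set \<Rightarrow> point \<Rightarrow> arc" where
  "arc_out \<Gamma> x = (THE A. A \<in> arcs \<Gamma> \<and>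
     (\<exists>\<gamma>\<in>\<Gamma>. \<exists>t. \<gamma> t = x \<and> (\<forall>\<^sub>F s in at_right t. fst (\<gamma> s) \<in> A)))"

text \<open>
  The usual convention: the 0-smoothing merges the two regions swept when the overstrand
  is turned counterclockwise towards the understrand.  It is the oriented smoothing at
  a positive crossing, and the other one at a negative crossing.
\<close>

definition oriented_at :: "curve set \<Rightarrow> smoothing \<Rightarrow> real^3 \<Rightarrow> bool" where
  "oriented_at \<Gamma> s p \<longleftrightarrow> (if positive_crossing \<Gamma> p then p \<notin> s else p \<in> s)"

definition joins :: "curve set \<Rightarrow> smoothing \<Rightarrow> real^3 \<Rightarrow> (arc \<times> arc) set" where
  "joins \<Gamma> s p =
     (let x = upper_point \<Gamma> p; y = lower_point \<Gamma> p in
      if oriented_at \<Gamma> s p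
      then {(arc_in \<Gamma> x, arc_out \<Gamma> y), (arc_in \<Gamma> y, arc_out \<Gamma> x)}
      else {(arc_in \<Gamma> x, arc_in \<Gamma> y), (arc_out \<Gamma> x, arc_out \<Gamma> y)})"

definition circles :: "curve set \<Rightarrow> smoothing \<Rightarrow> circle set" where
  "circles \<Gamma> s =
     arcs \<Gamma> // ((\<Union>p\<in>crossings \<Gamma>. joins \<Gamma> s p \<union> (joins \<Gamma> s p)\<inverse>)\<^sup>*)"

section \<open>Decorated smoothings and their gradings\<close>

text \<open>
  A decorated smoothing is a pair \<open>(s, Q)\<close>, where \<open>Q\<close> is the set of those components of \<open>s\<close>
  that are decorated by \<open>v\<^sub>+\<close>; the other components are decorated by \<open>v\<^sub>-\<close>.
\<close>

type_synonym decorated = "smoothing \<times> circle set"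

definition decorated_smoothings :: "curve set \<Rightarrow> decorated set" where
  "decorated_smoothings \<Gamma> = {(s, Q). s \<subseteq> crossings \<Gamma> \<and> Q \<subseteq> circles \<Gamma> s}"

definition h_grading :: "curve set \<Rightarrow> decorated \<Rightarrow> int" where
  "h_grading \<Gamma> = (\<lambda>(s, Q). int (card s) - int (n_minus \<Gamma>))"

definition q_grading :: "curve set \<Rightarrow> decorated \<Rightarrow> int" where
  "q_grading \<Gamma> = (\<lambda>(s, Q). int (card Q) - int (card (circles \<Gamma> s - Q))
     + int (card s) + int (n_plus \<Gamma>) - 2 * int (n_minus \<Gamma>))"

text \<open>
  \<^const>\<open>tau\<close> is the restriction of a linear map, hence is its own derivative, and it
  exchanges the two strands of an on-axis crossing.
\<close>

definition orientation_reversed :: "real^3 \<Rightarrow> curve set \<Rightarrow> real^3 \<Rightarrow> bool" where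
  "orientation_reversed n \<Gamma> p \<longleftrightarrow>
     (\<exists>r<0. tau n (tangent \<Gamma> (upper_point \<Gamma> p)) = r *\<^sub>R tangent \<Gamma> (lower_point \<Gamma> p))"

definition local_weight :: "real^3 \<Rightarrow> curve set \<Rightarrow> smoothing \<Rightarrow> real^3 \<Rightarrow> rat" where
  "local_weight n \<Gamma> s p =
     (let \<epsilon> = (if positive_crossing \<Gamma> p then 1 else -1) in
      if p \<notin> great_circle n then (if oriented_at \<Gamma> s p then 0 else \<epsilon> / 2)
      else if orientation_reversed n \<Gamma> p then (if oriented_at \<Gamma> s p then 0 else \<epsilon>)
      else (if oriented_at \<Gamma> s p then - \<epsilon> / 2 else \<epsilon> / 2))"

definition weight :: "real^3 \<Rightarrow> curve set \<Rightarrow> smoothing \<Rightarrow> rat" where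
  "weight n \<Gamma> s = (\<Sum>p\<in>crossings \<Gamma>. local_weight n \<Gamma> s p)"

section \<open>The perturbed Khovanov complex\<close>

text \<open>
  Vector spaces over the field \<^typ>\<open>bit\<close> of two elements are \<^type>\<open>module\<close> records, of which the
  ring fields \<open>mult\<close> and \<open>one\<close> play no role.
\<close>

definition free_space :: "'a set \<Rightarrow> (bit, 'a \<Rightarrow> bit) module" where
  "free_space S =
     \<lparr>carrier = {f. finite {x. f x \<noteq> 0} \<and> {x. f x \<noteq> 0} \<subseteq> S},
      mult = undefined, one = undefined,
      zero = (\<lambda>x. 0), add = (\<lambda>f g x. f x + g x), smult = (\<lambda>a f x. a * f x)\<rparr>"

text \<open>
  The linear map with matrix entry 1 from the basis vector \<open>x \<in> S\<close> to the basis vector \<open>y\<close>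
  iff \<open>c x y\<close>.
\<close>

definition matrix_map :: "'a set \<Rightarrow> ('a \<Rightarrow> 'a \<Rightarrow> bool) \<Rightarrow> ('a \<Rightarrow> bit) \<Rightarrow> 'a \<Rightarrow> bit" where
  "matrix_map S c f = (\<lambda>y. \<Sum>x\<in>S. of_bool (c x y) * f x)"

text \<open>
  The matrix entries of the merge map \<open>m(v\<^sub>+ v\<^sub>+) = v\<^sub>+\<close>, \<open>m(v\<^sub>+ v\<^sub>-) = m(v\<^sub>- v\<^sub>+) = v\<^sub>-\<close>,
  \<open>m(v\<^sub>- v\<^sub>-) = 0\<close>, and of the split map \<open>\<Delta>(v\<^sub>+) = v\<^sub>+ v\<^sub>- + v\<^sub>- v\<^sub>+\<close>, \<open>\<Delta>(v\<^sub>-) = v\<^sub>- v\<^sub>-\<close>,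
  where \<^const>\<open>True\<close> stands for \<open>v\<^sub>+\<close> and \<^const>\<open>False\<close> for \<open>v\<^sub>-\<close>.
\<close>

definition merge_entry :: "bool \<Rightarrow> bool \<Rightarrow> bool \<Rightarrow> bool" where
  "merge_entry a b c \<longleftrightarrow> (a \<and> b \<and> c) \<or> (a \<noteq> b \<and> \<not> c)"

definition split_entry :: "bool \<Rightarrow> bool \<Rightarrow> bool \<Rightarrow> bool" where
  "split_entry c a b \<longleftrightarrow> (c \<and> a \<noteq> b) \<or> (\<not> c \<and> \<not> a \<and> \<not> b)"

definition khovanov_entry :: "curve set \<Rightarrow> decorated \<Rightarrow> decorated \<Rightarrow> bool" where
  "khovanov_entry \<Gamma> = (\<lambda>(s, Q) (s', Q').
     Q' \<subseteq> circles \<Gamma> s' \<and>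
     (\<exists>p \<in> crossings \<Gamma> - s. s' = insert p s) \<and>
     Q \<inter> (circles \<Gamma> s \<inter> circles \<Gamma> s') = Q' \<inter> (circles \<Gamma> s \<inter> circles \<Gamma> s') \<and>
     (\<exists>C1 C2 C. C1 \<noteq> C2 \<and>
        ((circles \<Gamma> s - circles \<Gamma> s' = {C1, C2} \<and> circles \<Gamma> s' - circles \<Gamma> s = {C} \<and>
          merge_entry (C1 \<in> Q) (C2 \<in> Q) (C \<in> Q')) \<or>
         (circles \<Gamma> s - circles \<Gamma> s' = {C} \<and> circles \<Gamma> s' - circles \<Gamma> s = {C1, C2} \<and>
          split_entry (C \<in> Q) (C1 \<in> Q') (C2 \<in> Q')))))"

definition tau_decorated :: "real^3 \<Rightarrow> decorated \<Rightarrow> decorated" where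
  "tau_decorated n =
     (\<lambda>(s, Q). (reflection n ` s, (\<lambda>C. (\<lambda>A. reflection n ` A) ` C) ` Q))"

definition khovanov_d :: "curve set \<Rightarrow> (decorated \<Rightarrow> bit) \<Rightarrow> decorated \<Rightarrow> bit" where
  "khovanov_d \<Gamma> = matrix_map (decorated_smoothings \<Gamma>) (khovanov_entry \<Gamma>)"

definition tau_chain :: "real^3 \<Rightarrow> curve set \<Rightarrow> (decorated \<Rightarrow> bit) \<Rightarrow> decorated \<Rightarrow> bit" where
  "tau_chain n \<Gamma> = matrix_map (decorated_smoothings \<Gamma>) (\<lambda>x y. y = tau_decorated n x)"

definition perturbed_d :: "real^3 \<Rightarrow> curve set \<Rightarrow> (decorated \<Rightarrow> bit) \<Rightarrow> decorated \<Rightarrow> bit" where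
  "perturbed_d n \<Gamma> f = (\<lambda>x. khovanov_d \<Gamma> f x + (f x + tau_chain n \<Gamma> f x))"

definition CKh :: "curve set \<Rightarrow> int \<Rightarrow> (bit, decorated \<Rightarrow> bit) module" where
  "CKh \<Gamma> j = free_space {x \<in> decorated_smoothings \<Gamma>. q_grading \<Gamma> x = j}"

definition reduced_CKh :: "curve set \<Rightarrow> point \<Rightarrow> int \<Rightarrow> (bit, decorated \<Rightarrow> bit) module" where
  "reduced_CKh \<Gamma> b j =
     free_space {(s, Q) \<in> decorated_smoothings \<Gamma>. q_grading \<Gamma> (s, Q) = j - 1 \<and>
       (\<forall>C\<in>circles \<Gamma> s. fst b \<in> \<Union>C \<longrightarrow> C \<notin> Q)}"

definition F_filtration ::
  "curve set \<Rightarrow> (bit, decorated \<Rightarrow> bit) module \<Rightarrow> int \<Rightarrow> (decorated \<Rightarrow> bit) set" where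
  "F_filtration \<Gamma> M i = {f \<in> carrier M. \<forall>x. f x \<noteq> 0 \<longrightarrow> h_grading \<Gamma> x \<le> i}"

definition G_filtration ::
  "real^3 \<Rightarrow> curve set \<Rightarrow> (bit, decorated \<Rightarrow> bit) module \<Rightarrow> rat \<Rightarrow> (decorated \<Rightarrow> bit) set" where
  "G_filtration n \<Gamma> M k = {f \<in> carrier M. \<forall>x. f x \<noteq> 0 \<longrightarrow> weight n \<Gamma> (fst x) \<ge> k}"

section \<open>Cohomology and the triple grading\<close>

definition quotient_space :: "(bit, 'a) module \<Rightarrow> 'a set \<Rightarrow> (bit, 'a set) module" where
  "quotient_space M N =
     \<lparr>carrier = a_rcosets\<^bsub>M\<^esub> N, mult = undefined, one = undefined,
      zero = N, add = (\<lambda>X Y. X <+>\<^bsub>M\<^esub> Y),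
      smult = (\<lambda>a X. \<Union>x\<in>X. N +>\<^bsub>M\<^esub> (a \<odot>\<^bsub>M\<^esub> x))\<rparr>"

definition direct_sum :: "(bit, 'a) module \<Rightarrow> (bit, 'b) module \<Rightarrow> (bit, 'a \<times> 'b) module" where
  "direct_sum M N =
     \<lparr>carrier = carrier M \<times> carrier N, mult = undefined, one = undefined,
      zero = (\<zero>\<^bsub>M\<^esub>, \<zero>\<^bsub>N\<^esub>),
      add = (\<lambda>(x, y) (x', y'). (x \<oplus>\<^bsub>M\<^esub> x', y \<oplus>\<^bsub>N\<^esub> y')),
      smult = (\<lambda>a (x, y). (a \<odot>\<^bsub>M\<^esub> x, a \<odot>\<^bsub>N\<^esub> y))\<rparr>"

definition linear_iso :: "(bit, 'a) module \<Rightarrow> (bit, 'b) module \<Rightarrow> bool" where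
  "linear_iso M N \<longleftrightarrow>
     (\<exists>h. bij_betw h (carrier M) (carrier N) \<and>
        (\<forall>x\<in>carrier M. \<forall>y\<in>carrier M. h (x \<oplus>\<^bsub>M\<^esub> y) = h x \<oplus>\<^bsub>N\<^esub> h y) \<and>
        (\<forall>a. \<forall>x\<in>carrier M. h (a \<odot>\<^bsub>M\<^esub> x) = a \<odot>\<^bsub>N\<^esub> h x))"

definition cocycles :: "(bit, 'a) module \<Rightarrow> ('a \<Rightarrow> 'a) \<Rightarrow> 'a set" where
  "cocycles M D = {z \<in> carrier M. D z = \<zero>\<^bsub>M\<^esub>}"

definition coboundaries :: "(bit, 'a) module \<Rightarrow> ('a \<Rightarrow> 'a) \<Rightarrow> 'a set" where
  "coboundaries M D = D ` carrier M"

definition cohomology :: "(bit, 'a) module \<Rightarrow> ('a \<Rightarrow> 'a) \<Rightarrow> (bit, 'a set) module" where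
  "cohomology M D = quotient_space (M\<lparr>carrier := cocycles M D\<rparr>) (coboundaries M D)"

text \<open>
  The subspace of the cohomology induced by a subspace \<open>S\<close> of the complex (\<open>S\<close> need not be
  preserved by \<open>D\<close>): the classes that have a representative in \<open>S\<close>.
\<close>

definition induced :: "(bit, 'a) module \<Rightarrow> ('a \<Rightarrow> 'a) \<Rightarrow> 'a set \<Rightarrow> 'a set set" where
  "induced M D S = (\<lambda>z. coboundaries M D +>\<^bsub>M\<^esub> z) ` (cocycles M D \<inter> S)"

text \<open>\<open>F\<close> is an increasing filtration and \<open>G\<close> is a decreasing one, with half-integer steps.\<close>

definition graded_piece ::
  "(bit, 'a) module \<Rightarrow> (int \<Rightarrow> 'a set) \<Rightarrow> (rat \<Rightarrow> 'a set) \<Rightarrow> int \<Rightarrow> rat \<Rightarrow> (bit, 'a set) module" where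
  "graded_piece V F G i k =
     quotient_space (V\<lparr>carrier := F i \<inter> G k\<rparr>)
       ((F i \<inter> G (k + 1/2)) <+>\<^bsub>V\<^esub> (F (i - 1) \<inter> G k))"

definition triple_graded ::
  "real^3 \<Rightarrow> curve set \<Rightarrow> (bit, decorated \<Rightarrow> bit) module \<Rightarrow> int \<Rightarrow> rat \<Rightarrow>
     (bit, (decorated \<Rightarrow> bit) set set) module" where
  "triple_graded n \<Gamma> M i k =
     graded_piece (cohomology M (perturbed_d n \<Gamma>))
       (\<lambda>i. induced M (perturbed_d n \<Gamma>) (F_filtration \<Gamma> M i))
       (\<lambda>k. induced M (perturbed_d n \<Gamma>) (G_filtration n \<Gamma> M k)) i k"

definition Kh_tau ::
  "real^3 \<Rightarrow> curve set \<Rightarrow> int \<Rightarrow> int \<Rightarrow> rat \<Rightarrow> (bit, (decorated \<Rightarrow> bit) set set) module" where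
  "Kh_tau n \<Gamma> i j k = triple_graded n \<Gamma> (CKh \<Gamma> j) i k"

definition reduced_Kh_tau ::
  "real^3 \<Rightarrow> curve set \<Rightarrow> point \<Rightarrow> int \<Rightarrow> int \<Rightarrow> rat \<Rightarrow>
     (bit, (decorated \<Rightarrow> bit) set set) module" where
  "reduced_Kh_tau n \<Gamma> b i j k = triple_graded n \<Gamma> (reduced_CKh \<Gamma> b j) i k"

end

theory Submission
  imports Defs "HOL-Library.Function_Algebras" "HOL-Library.Set_Algebras"
begin

text \<open>
  Let \<open>\<nu>\<close> be the map on decorated smoothings that replaces one \<open>v\<^sub>-\<close> by \<open>v\<^sub>+\<close>, summed over all circles
  carrying \<open>v\<^sub>-\<close>.  Over the field of two elements it commutes with the merge map and with the split
  map, hence with the Khovanov differential (\<open>edge_map_raise_one\<close>, \<open>khovanov_d_raise\<close>); this is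
  Shumakovitch's operator.  Let \<open>K\<close> be the subcomplex on which the
  circle through the basepoint carries \<open>v\<^sub>-\<close>.  Then every chain is \<open>a + \<nu> c\<close> for unique \<open>a\<close> and \<open>c\<close>
  in \<open>K\<close>: the coefficient of \<open>c\<close> at a decoration is the coefficient of the chain after the basepointed
  circle has been turned into \<open>v\<^sub>+\<close>.  So the Khovanov complex consists of two copies of the reduced complex.

  What makes this work for the perturbed differential and both filtrations is that nothing has been
  chosen apart from the basepoint.  As \<open>\<nu>\<close> treats all circles alike, it commutes with the involution;
  as the basepoint is on the axis, \<open>K\<close> is preserved by the involution; and as \<open>\<nu>\<close> does not change the
  smoothing, it respects the homological degree and the weight, while it raises the quantum degree
  by 2.  The two copies therefore occur in the reduced complexes of quantum degrees \<open>j + 1\<close> and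
  \<open>j - 1\<close>, and \<open>(a, c) \<mapsto> a + \<nu> c\<close> identifies their direct sum, differential and filtrations included,
  with the complex of degree \<open>j\<close> (\<open>supported_eq_copies\<close>).  Each graded piece of the cohomology is a
  quotient of chain-level subspaces that are built from cocycles, coboundaries and the filtrations by
  intersections and sums (\<open>graded_piece_presentation\<close>).  These operations commute with forming
  \<open>A + \<nu> B\<close> for \<open>A, B \<subseteq> K\<close>, and the splitting follows (\<open>linear_iso_graded_piece\<close>).

  It remains to see that the diagram of an involutive link has the combinatorial structure used
  above.  There are finitely many arcs, and an end of a strand at a crossing lies in exactly one of
  them.  The involution carries a strand to a strand and multiplies its tangent by a nonzero
  number, whose sign decides whether incoming and outgoing ends are exchanged (\<open>tau_ends\<close>).  At a
  crossing this happens with the signs of the two strands, the over- and the understrand are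
  exchanged, and the sign of the crossing is multiplied by the product of these signs; hence
  0-smoothings are carried to 0-smoothings in all cases (\<open>joins_reflection\<close>).  A point of the link on
  the axis is not over a crossing, since a second point of the link above it would have a mirror
  image, which is a third one.

  Finally, a component that the involution carries to itself reversing the orientation contains a
  fixed point.  In a strongly invertible link every component is of this kind: for two components
  that are exchanged, reversing the orientation of only one of them gives an orientation which is
  not reversed (\<open>strongly_invertible_meets_axis\<close>).
\<close>

section \<open>Graded pieces as quotients of chain-level subspaces\<close>

text \<open>
  These two rules would rewrite sums of coefficients into bit operations, to which the lemmas on finite
  sums do not apply.
\<close>

declare add_bit_eq_xor [simp del] mult_bit_eq_and [simp del]

lemma bit_add_self [simp]: "x + x = 0" for x :: bit
  by (cases x) auto

lemma bit_fun_add_self [simp]: "f + f = 0" for f :: "'a \<Rightarrow> bit"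
  by (rule ext) simp

lemma bit_fun_add_self_right [simp]: "(f + g) + g = f" for f :: "'a \<Rightarrow> bit"
  by (simp only: add.assoc bit_fun_add_self add_0_right)

lemma bit_fun_add_self_left [simp]: "f + (f + g) = g" for f :: "'a \<Rightarrow> bit"
  by (simp flip: add.assoc)

text \<open>
  Over the field of two elements a nonempty set closed under addition is a subspace: the only scalars are
  0 and 1, and every vector is its own negative.
\<close>

definition bit_subspace :: "('a \<Rightarrow> bit) set \<Rightarrow> bool" where
  "bit_subspace A \<longleftrightarrow> 0 \<in> A \<and> (\<forall>x\<in>A. \<forall>y\<in>A. x + y \<in> A)"

lemma bit_subspace_zero: "bit_subspace A \<Longrightarrow> 0 \<in> A"
  and bit_subspace_add: "bit_subspace A \<Longrightarrow> x \<in> A \<Longrightarrow> y \<in> A \<Longrightarrow> x + y \<in> A"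
  by (auto simp: bit_subspace_def)

lemma bit_subspace_Int: "bit_subspace A \<Longrightarrow> bit_subspace B \<Longrightarrow> bit_subspace (A \<inter> B)"
  by (auto simp: bit_subspace_def)

lemma bit_subspace_sum:
  assumes "bit_subspace A" "bit_subspace B"
  shows "bit_subspace (A + B)"
  unfolding bit_subspace_def
proof (intro conjI ballI)
  show "0 \<in> A + B"
    using set_plus_intro[OF bit_subspace_zero bit_subspace_zero, OF assms] by simp
next
  fix x y assume "x \<in> A + B" "y \<in> A + B"
  then obtain a b c d where "x = a + b" "y = c + d" "a \<in> A" "b \<in> B" "c \<in> A" "d \<in> B"
    by (auto elim!: set_plus_elim)
  then have "x + y = (a + c) + (b + d)" by (simp add: ac_simps)
  then show "x + y \<in> A + B"
    using \<open>a \<in> A\<close> \<open>b \<in> B\<close> \<open>c \<in> A\<close> \<open>d \<in> B\<close> assms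
    by (simp add: bit_subspace_add set_plus_intro)
qed

lemma bit_subspace_absorb:
  assumes "bit_subspace A" "x \<in> A"
  shows "x + y \<in> A \<longleftrightarrow> y \<in> A"
  using bit_subspace_add[OF assms, of y] bit_subspace_add[OF assms, of "x + y"] by auto

definition coset :: "('a \<Rightarrow> bit) set \<Rightarrow> ('a \<Rightarrow> bit) \<Rightarrow> ('a \<Rightarrow> bit) set" where
  "coset N z = (\<lambda>h. h + z) ` N"

lemma mem_coset_iff: "x \<in> coset N z \<longleftrightarrow> x + z \<in> N"
proof
  assume "x + z \<in> N"
  then have "(x + z) + z \<in> coset N z" unfolding coset_def by (rule imageI)
  then show "x \<in> coset N z" by simp
qed (auto simp: coset_def)

lemma coset_eq_iff:
  assumes "bit_subspace N"
  shows "coset N x = coset N y \<longleftrightarrow> x + y \<in> N"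
proof
  assume "coset N x = coset N y"
  moreover have "x \<in> coset N x" using assms by (simp add: mem_coset_iff bit_subspace_zero)
  ultimately show "x + y \<in> N" by (simp add: mem_coset_iff)
next
  assume *: "x + y \<in> N"
  have "z + x \<in> N \<longleftrightarrow> z + y \<in> N" for z
  proof -
    have "z + y = (x + y) + (z + x)" by (simp add: ac_simps)
    then show ?thesis using bit_subspace_absorb[OF assms *, of "z + x"] by (simp only:)
  qed
  then show "coset N x = coset N y" by (auto simp: mem_coset_iff)
qed

lemma coset_add:
  assumes "bit_subspace N"
  shows "coset N x + coset N y = coset N (x + y)"
proof (intro equalityI subsetI)
  fix z assume "z \<in> coset N x + coset N y"
  then obtain a b where "z = (a + x) + (b + y)" "a \<in> N" "b \<in> N"
    by (auto simp: coset_def elim!: set_plus_elim)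
  then have "z = (a + b) + (x + y)" "a + b \<in> N"
    using assms by (auto simp: bit_subspace_add ac_simps)
  then show "z \<in> coset N (x + y)" by (auto simp: coset_def)
next
  fix z assume "z \<in> coset N (x + y)"
  then obtain a where "a \<in> N" "z = (a + x) + (0 + y)" by (auto simp: coset_def add.assoc)
  moreover have "0 \<in> N" using assms by (rule bit_subspace_zero)
  ultimately show "z \<in> coset N x + coset N y"
    by (auto simp only: coset_def intro!: set_plus_intro imageI)
qed

text \<open>
  For cocycles \<open>Z\<close> and coboundaries \<open>N\<close>, a class lies in the intersection of the subspaces induced by
  \<open>F\<close> and \<open>G\<close> iff it has one representative in \<open>F\<close> and another one, in general different, in \<open>G\<close>.
  These are the cocycles that represent such classes.
\<close>

definition cohomologous_part ::
  "('a \<Rightarrow> bit) set \<Rightarrow> ('a \<Rightarrow> bit) set \<Rightarrow> ('a \<Rightarrow> bit) set \<Rightarrow> ('a \<Rightarrow> bit) set \<Rightarrow> ('a \<Rightarrow> bit) set" where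
  "cohomologous_part Z N F G = Z \<inter> ((N + (Z \<inter> F)) \<inter> (N + (Z \<inter> G)))"

text \<open>
  The map \<open>\<rho>\<close> identifies \<open>T\<close> with the quotient of \<open>P\<close> by \<open>P \<inter> R\<close>.
\<close>

definition presents ::
  "(bit, 'b) module \<Rightarrow> ('a \<Rightarrow> bit) set \<Rightarrow> ('a \<Rightarrow> bit) set \<Rightarrow> (('a \<Rightarrow> bit) \<Rightarrow> 'b) \<Rightarrow> bool" where
  "presents T P R \<rho> \<longleftrightarrow>
     bit_subspace P \<and> carrier T = \<rho> ` P \<and>
     (\<forall>x\<in>P. \<forall>y\<in>P. \<rho> x \<oplus>\<^bsub>T\<^esub> \<rho> y = \<rho> (x + y)) \<and>
     (\<forall>x\<in>P. \<forall>y\<in>P. \<rho> x = \<rho> y \<longleftrightarrow> x + y \<in> R) \<and>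
     (\<forall>x\<in>P. 0 \<odot>\<^bsub>T\<^esub> \<rho> x = \<rho> 0 \<and> 1 \<odot>\<^bsub>T\<^esub> \<rho> x = \<rho> x)"

lemma add_free_space: "add (free_space S) = (+)"
  and zero_free_space: "zero (free_space S) = 0"
  and smult_free_space: "smult (free_space S) a f = (\<lambda>x. a * f x)"
  by (simp_all add: free_space_def fun_eq_iff)

lemma r_coset_free_space: "N +>\<^bsub>free_space S\<^esub> z = coset N z"
  by (auto simp: a_r_coset_def' coset_def add_free_space)

lemma add_cohomology: "add (cohomology (free_space S) D) = (+)"
  by (intro ext) (force simp: cohomology_def quotient_space_def set_add_def' add_free_space
      set_plus_def)

text \<open>
  Multiplication by 0 sends each coset to the coset of 0, since a coset is not empty, and multiplication
  by 1 is the union of the cosets of the elements of a coset, which are all equal.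
\<close>

lemma smult_cohomology:
  assumes "bit_subspace (coboundaries (free_space S) D)"
  defines "N \<equiv> coboundaries (free_space S) D"
  shows "0 \<odot>\<^bsub>cohomology (free_space S) D\<^esub> coset N z = coset N 0"
    and "1 \<odot>\<^bsub>cohomology (free_space S) D\<^esub> coset N z = coset N z"
proof -
  let ?H = "cohomology (free_space S) D"
  have N: "bit_subspace N" using assms by simp
  have smult: "a \<odot>\<^bsub>?H\<^esub> X = (\<Union>x\<in>X. coset N (\<lambda>y. a * x y))" for a X
    unfolding cohomology_def N_def
    by (auto simp: quotient_space_def a_r_coset_def' coset_def add_free_space smult_free_space)
  have *: "z \<in> coset N z" using N by (simp add: mem_coset_iff bit_subspace_zero)
  show "0 \<odot>\<^bsub>?H\<^esub> coset N z = coset N 0"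
    using * by (auto simp: smult zero_fun_def)
  have "coset N x = coset N z" if "x \<in> coset N z" for x
    using that N by (simp add: mem_coset_iff coset_eq_iff)
  then show "1 \<odot>\<^bsub>?H\<^esub> coset N z = coset N z"
    using * unfolding smult mult_1 by blast
qed

lemma induced_free_space:
  "induced (free_space S) D X =
     coset (coboundaries (free_space S) D) ` (cocycles (free_space S) D \<inter> X)"
  by (simp add: induced_def r_coset_free_space)

lemma induced_Int:
  assumes N: "bit_subspace N"
  shows "coset N ` (Z \<inter> F) \<inter> coset N ` (Z \<inter> G) = coset N ` cohomologous_part Z N F G"
proof (intro equalityI subsetI)
  fix X assume "X \<in> coset N ` (Z \<inter> F) \<inter> coset N ` (Z \<inter> G)"
  then obtain f g where fg: "X = coset N f" "X = coset N g" "f \<in> Z \<inter> F" "g \<in> Z \<inter> G" by auto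
  then have "f + g \<in> N" using N by (simp flip: coset_eq_iff)
  then have "(f + g) + g \<in> N + (Z \<inter> G)" "0 + f \<in> N + (Z \<inter> F)"
    using fg bit_subspace_zero[OF N] by (auto simp only: intro!: set_plus_intro)
  then have "f \<in> N + (Z \<inter> G)" "f \<in> N + (Z \<inter> F)" by simp_all
  then show "X \<in> coset N ` cohomologous_part Z N F G"
    using fg by (auto simp: cohomologous_part_def)
next
  fix X assume "X \<in> coset N ` cohomologous_part Z N F G"
  then obtain z where z: "X = coset N z" "z \<in> N + (Z \<inter> F)" "z \<in> N + (Z \<inter> G)"
    by (auto simp: cohomologous_part_def)
  have *: "coset N z \<in> coset N ` A" if zA: "z \<in> N + A" for A
  proof -
    obtain m a where "z = m + a" "m \<in> N" "a \<in> A" using zA by (elim set_plus_elim)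
    moreover from this have "coset N z = coset N a" using N by (simp add: coset_eq_iff add.assoc)
    ultimately show ?thesis by blast
  qed
  show "X \<in> coset N ` (Z \<inter> F) \<inter> coset N ` (Z \<inter> G)"
    using * z by blast
qed

lemma bit_subspace_cohomologous_part:
  assumes "bit_subspace Z" "bit_subspace N" "bit_subspace F" "bit_subspace G"
  shows "bit_subspace (cohomologous_part Z N F G)"
  unfolding cohomologous_part_def
  by (intro bit_subspace_Int bit_subspace_sum assms)

text \<open>
  A graded piece consists of cosets of cosets of chains.  Both steps are undone at once: a cocycle
  \<open>z\<close> represents the set of the classes of \<open>y + z\<close>, where \<open>y\<close> runs over the cocycles that
  represent the subspace divided out in the second step.
\<close>

lemma graded_piece_presentation:
  fixes S :: "'a set" and D :: "('a \<Rightarrow> bit) \<Rightarrow> ('a \<Rightarrow> bit)"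
  defines "M \<equiv> free_space S"
  defines "Z \<equiv> cocycles M D" and "N \<equiv> coboundaries M D"
  assumes Z: "bit_subspace Z" and N: "bit_subspace N"
    and F: "\<And>i. bit_subspace (F i)" and G: "\<And>k. bit_subspace (G k)"
  shows "\<exists>\<rho>. presents
     (graded_piece (cohomology M D) (\<lambda>i. induced M D (F i)) (\<lambda>k. induced M D (G k)) i k)
     (cohomologous_part Z N (F i) (G k))
     (cohomologous_part Z N (F i) (G (k + 1/2)) + cohomologous_part Z N (F (i - 1)) (G k) + N) \<rho>"
proof -
  define T where "T = graded_piece (cohomology M D)
    (\<lambda>i. induced M D (F i)) (\<lambda>k. induced M D (G k)) i k"
  define P where "P = cohomologous_part Z N (F i) (G k)"
  define Y where
    "Y = cohomologous_part Z N (F i) (G (k + 1/2)) + cohomologous_part Z N (F (i - 1)) (G k)"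
  define \<rho> where "\<rho> z = (\<lambda>y. coset N (y + z)) ` Y" for z
  have P: "bit_subspace P" and Y: "bit_subspace Y"
    unfolding P_def Y_def
    by (intro bit_subspace_sum bit_subspace_cohomologous_part Z N F G)+
  have H_add: "add (cohomology M D) = (+)" by (simp add: M_def add_cohomology)
  have ind: "induced M D (F i) \<inter> induced M D (G k) = coset N ` cohomologous_part Z N (F i) (G k)"
    for i k
    unfolding M_def induced_free_space
    unfolding M_def[symmetric] Z_def[symmetric] N_def[symmetric] by (rule induced_Int[OF N])
  define W where "W = coset N ` Y"
  have set_add: "A <+>\<^bsub>cohomology M D\<^esub> B = {a + b | a b. a \<in> A \<and> b \<in> B}" for A B
    by (auto simp: set_add_def' H_add)
  have W: "(induced M D (F i) \<inter> induced M D (G (k + 1/2)))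
      <+>\<^bsub>cohomology M D\<^esub> (induced M D (F (i - 1)) \<inter> induced M D (G k)) = W"
  proof -
    have "{a + b | a b. a \<in> coset N ` A \<and> b \<in> coset N ` B} = coset N ` (A + B)" for A B
    proof (intro equalityI subsetI)
      fix X assume "X \<in> {a + b | a b. a \<in> coset N ` A \<and> b \<in> coset N ` B}"
      then obtain x y where "X = coset N x + coset N y" "x \<in> A" "y \<in> B" by blast
      then show "X \<in> coset N ` (A + B)" by (simp add: coset_add[OF N] set_plus_intro)
    next
      fix X assume "X \<in> coset N ` (A + B)"
      then obtain x y where "X = coset N (x + y)" "x \<in> A" "y \<in> B"
        by (auto elim!: set_plus_elim)
      then show "X \<in> {a + b | a b. a \<in> coset N ` A \<and> b \<in> coset N ` B}"
        unfolding coset_add[OF N, symmetric] by blast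
    qed
    then show ?thesis unfolding set_add ind W_def Y_def .
  qed
  have W_coset: "(\<lambda>X. X + coset N z) ` W = \<rho> z" for z
    by (simp add: W_def \<rho>_def image_image coset_add[OF N])
  have carrier_T: "carrier T = \<rho> ` P"
    unfolding T_def graded_piece_def ind W[unfolded ind] P_def[symmetric]
    by (auto simp: quotient_space_def A_RCOSETS_def' a_r_coset_def' H_add W_coset[symmetric])
  have \<rho>_eq: "\<rho> x = \<rho> y \<longleftrightarrow> x + y \<in> Y + N" for x y
  proof
    assume "\<rho> x = \<rho> y"
    moreover have "coset N x \<in> \<rho> x"
      using imageI[OF bit_subspace_zero[OF Y], of "\<lambda>y. coset N (y + x)"] by (simp add: \<rho>_def)
    ultimately obtain v where "v \<in> Y" "coset N x = coset N (v + y)" by (auto simp: \<rho>_def)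
    then have "v + (x + y) \<in> N" using N by (simp add: coset_eq_iff ac_simps)
    then show "x + y \<in> Y + N" using set_plus_intro[OF \<open>v \<in> Y\<close>] by fastforce
  next
    have sub: "\<rho> x \<subseteq> \<rho> y" if xy: "x + y \<in> Y + N" for x y
    proof
      fix X assume "X \<in> \<rho> x"
      then obtain u where u: "u \<in> Y" "X = coset N (u + x)" by (auto simp: \<rho>_def)
      from xy obtain v m where vm: "x + y = v + m" "v \<in> Y" "m \<in> N" by (elim set_plus_elim)
      have "(u + x) + ((u + v) + y) = v + (x + y) + (u + u)" by (simp only: ac_simps)
      also have "\<dots> = m" by (simp add: vm(1))
      finally have "X = coset N ((u + v) + y)" using u vm N by (simp add: coset_eq_iff)
      then show "X \<in> \<rho> y" using u vm Y by (auto simp: \<rho>_def bit_subspace_add)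
    qed
    assume "x + y \<in> Y + N"
    then show "\<rho> x = \<rho> y" using sub[of x y] sub[of y x] by (simp add: add.commute)
  qed
  have "\<rho> x \<oplus>\<^bsub>T\<^esub> \<rho> y = \<rho> (x + y)" for x y
  proof -
    have "\<rho> x \<oplus>\<^bsub>T\<^esub> \<rho> y = {a + b | a b. a \<in> \<rho> x \<and> b \<in> \<rho> y}"
      by (auto simp: T_def graded_piece_def quotient_space_def set_add_def' H_add)
    also have "\<dots> = {coset N (u + v + (x + y)) | u v. u \<in> Y \<and> v \<in> Y}"
    proof -
      have "{a + b | a b. a \<in> \<rho> x \<and> b \<in> \<rho> y} =
          {coset N (u + x) + coset N (v + y) | u v. u \<in> Y \<and> v \<in> Y}"
        unfolding \<rho>_def by blast
      then show ?thesis by (simp add: coset_add[OF N] ac_simps)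
    qed
    also have "\<dots> = \<rho> (x + y)"
    proof (intro equalityI subsetI)
      fix X assume "X \<in> \<rho> (x + y)"
      then obtain u where "u \<in> Y" "X = coset N ((u + 0) + (x + y))" by (auto simp: \<rho>_def)
      then show "X \<in> {coset N (u + v + (x + y)) | u v. u \<in> Y \<and> v \<in> Y}"
        using bit_subspace_zero[OF Y] by blast
    qed (use Y in \<open>auto simp: \<rho>_def bit_subspace_add\<close>)
    finally show ?thesis .
  qed
  moreover have "0 \<odot>\<^bsub>T\<^esub> \<rho> z = \<rho> 0" "1 \<odot>\<^bsub>T\<^esub> \<rho> z = \<rho> z" for z
  proof -
    have smult: "a \<odot>\<^bsub>T\<^esub> X = (\<Union>x\<in>X. (\<lambda>A. A + (a \<odot>\<^bsub>cohomology M D\<^esub> x)) ` W)" for a X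
      unfolding T_def graded_piece_def ind W[unfolded ind]
      by (auto simp: quotient_space_def a_r_coset_def' H_add)
    have N': "bit_subspace (coboundaries (free_space S) D)" using N by (simp add: N_def M_def)
    note smult_H = smult_cohomology[OF N', folded M_def, folded N_def]
    have "Y \<noteq> {}" using bit_subspace_zero[OF Y] by auto
    then show "0 \<odot>\<^bsub>T\<^esub> \<rho> z = \<rho> 0"
      by (simp add: smult \<rho>_def[of z] image_image smult_H W_coset)
    have "\<rho> (y + z) = \<rho> z" if "y \<in> Y" for y
    proof -
      have "(y + z) + z \<in> Y + N"
        using set_plus_intro[OF that bit_subspace_zero[OF N]] by (simp add: add.assoc)
      then show ?thesis by (simp add: \<rho>_eq)
    qed
    then show "1 \<odot>\<^bsub>T\<^esub> \<rho> z = \<rho> z"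
      using \<open>Y \<noteq> {}\<close> by (simp add: smult \<rho>_def[of z] image_image smult_H W_coset)
  qed
  ultimately have "presents T P (Y + N) \<rho>"
    unfolding presents_def using P carrier_T \<rho>_eq by blast
  then show ?thesis unfolding T_def P_def Y_def by blast
qed

section \<open>Two complementary copies of a subspace\<close>

text \<open>
  The sets \<open>A + \<nu> B\<close> with \<open>A, B \<subseteq> K\<close> are the subspaces compatible with a decomposition \<open>K \<oplus> \<nu> K\<close>.
  Because the summands of an element are unique, they can be intersected and added componentwise.
\<close>

locale complementary_copies =
  fixes K :: "('a \<Rightarrow> bit) set" and \<nu> :: "('a \<Rightarrow> bit) \<Rightarrow> ('a \<Rightarrow> bit)"
  assumes subspace_K: "bit_subspace K"
    and \<nu>_add: "\<nu> (x + y) = \<nu> x + \<nu> y"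
    and independent: "a \<in> K \<Longrightarrow> c \<in> K \<Longrightarrow> a + \<nu> c = 0 \<Longrightarrow> a = 0 \<and> c = 0"
begin

definition copies :: "('a \<Rightarrow> bit) set \<Rightarrow> ('a \<Rightarrow> bit) set \<Rightarrow> ('a \<Rightarrow> bit) set" where
  "copies A B = A + \<nu> ` B"

lemma copiesI: "a \<in> A \<Longrightarrow> b \<in> B \<Longrightarrow> a + \<nu> b \<in> copies A B"
  by (auto simp: copies_def)

lemma copiesE:
  assumes "x \<in> copies A B"
  obtains a b where "x = a + \<nu> b" "a \<in> A" "b \<in> B"
  using assms by (auto simp: copies_def elim!: set_plus_elim)

lemma \<nu>_zero: "\<nu> 0 = 0"
  using \<nu>_add[of 0 0] by simp

lemma add_eq_zero_iff: "x + y = 0 \<longleftrightarrow> x = y" for x y :: "'a \<Rightarrow> bit"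
  by (metis add.right_neutral bit_fun_add_self bit_fun_add_self_left)

lemma decomposition_unique:
  assumes "a \<in> K" "c \<in> K" "a' \<in> K" "c' \<in> K" "a + \<nu> c = a' + \<nu> c'"
  shows "a = a'" "c = c'"
proof -
  have "(a + a') + \<nu> (c + c') = (a + \<nu> c) + (a' + \<nu> c')" by (simp add: \<nu>_add ac_simps)
  also have "\<dots> = 0" using assms(5) by simp
  finally have "a + a' = 0 \<and> c + c' = 0"
    using assms subspace_K by (intro independent bit_subspace_add)
  then show "a = a'" "c = c'" by (simp_all only: add_eq_zero_iff)
qed

lemma mem_copies_iff:
  assumes "a \<in> K" "b \<in> K" "A \<subseteq> K" "B \<subseteq> K"
  shows "a + \<nu> b \<in> copies A B \<longleftrightarrow> a \<in> A \<and> b \<in> B"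
proof
  assume "a + \<nu> b \<in> copies A B"
  then obtain a' b' where "a + \<nu> b = a' + \<nu> b'" "a' \<in> A" "b' \<in> B" by (rule copiesE)
  moreover from this have "a' \<in> K" "b' \<in> K" using assms by auto
  ultimately show "a \<in> A \<and> b \<in> B" using decomposition_unique[of a b a' b'] assms by metis
qed (simp add: copiesI)

lemma copies_Int:
  assumes "A \<subseteq> K" "B \<subseteq> K" "A' \<subseteq> K" "B' \<subseteq> K"
  shows "copies A B \<inter> copies A' B' = copies (A \<inter> A') (B \<inter> B')"
proof (intro equalityI subsetI)
  fix x assume x: "x \<in> copies A B \<inter> copies A' B'"
  then obtain a b where ab: "x = a + \<nu> b" "a \<in> A" "b \<in> B" by (auto elim: copiesE)
  then have "a \<in> A' \<and> b \<in> B'" using x mem_copies_iff[of a b A' B'] assms by auto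
  then show "x \<in> copies (A \<inter> A') (B \<inter> B')" using ab by (auto intro: copiesI)
qed (auto elim!: copiesE intro: copiesI)

lemma copies_sum: "copies A B + copies A' B' = copies (A + A') (B + B')"
proof -
  have "\<nu> ` (B + B') = \<nu> ` B + \<nu> ` B'"
  proof (intro equalityI subsetI)
    fix x assume "x \<in> \<nu> ` (B + B')"
    then obtain b b' where "x = \<nu> b + \<nu> b'" "b \<in> B" "b' \<in> B'"
      by (auto simp: \<nu>_add elim!: set_plus_elim)
    then show "x \<in> \<nu> ` B + \<nu> ` B'" by (simp only: set_plus_intro imageI)
  next
    fix x assume "x \<in> \<nu> ` B + \<nu> ` B'"
    then obtain b b' where "x = \<nu> (b + b')" "b \<in> B" "b' \<in> B'"
      by (auto simp: \<nu>_add elim!: set_plus_elim)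
    then show "x \<in> \<nu> ` (B + B')" by auto
  qed
  then show ?thesis by (simp add: copies_def ac_simps)
qed

lemma sum_subset_K: "A \<subseteq> K \<Longrightarrow> B \<subseteq> K \<Longrightarrow> A + B \<subseteq> K"
  by (auto elim!: set_plus_elim intro!: bit_subspace_add[OF subspace_K])

lemma cohomologous_part_copies:
  assumes "Z \<subseteq> K" "Z' \<subseteq> K" "N \<subseteq> K" "N' \<subseteq> K" "F \<subseteq> K" "F' \<subseteq> K" "G \<subseteq> K" "G' \<subseteq> K"
  shows "cohomologous_part (copies Z Z') (copies N N') (copies F F') (copies G G') =
    copies (cohomologous_part Z N F G) (cohomologous_part Z' N' F' G')"
proof -
  have "N + (Z \<inter> F) \<subseteq> K" "N' + (Z' \<inter> F') \<subseteq> K" "N + (Z \<inter> G) \<subseteq> K" "N' + (Z' \<inter> G') \<subseteq> K"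
    using assms by (simp_all add: sum_subset_K le_infI1)
  then show ?thesis
    unfolding cohomologous_part_def using assms by (simp add: copies_Int copies_sum le_infI1)
qed

text \<open>
  The isomorphism sends the class of \<open>a + \<nu> c\<close> to the pair of the classes of \<open>a\<close> and \<open>c\<close>.  That this
  is well defined and injective is the equivalence of \<open>a + \<nu> c \<in> R + \<nu> R'\<close> with \<open>a \<in> R\<close> and
  \<open>c \<in> R'\<close>.
\<close>

lemma linear_iso_of_presentations:
  assumes T: "presents T (copies P P') (copies R R') \<rho>"
    and T1: "presents T1 P R \<rho>1" and T2: "presents T2 P' R' \<rho>2"
    and K: "P \<subseteq> K" "P' \<subseteq> K" "R \<subseteq> K" "R' \<subseteq> K"
  shows "linear_iso T (direct_sum T1 T2)"
proof -
  define rep where "rep X = (SOME ac. fst ac \<in> P \<and> snd ac \<in> P' \<and> \<rho> (fst ac + \<nu> (snd ac)) = X)" for X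
  define h where "h X = (\<rho>1 (fst (rep X)), \<rho>2 (snd (rep X)))" for X
  have same_image: "\<rho> (a + \<nu> c) = \<rho> (a' + \<nu> c') \<longleftrightarrow> \<rho>1 a = \<rho>1 a' \<and> \<rho>2 c = \<rho>2 c'"
    if "a \<in> P" "c \<in> P'" "a' \<in> P" "c' \<in> P'" for a c a' c'
  proof -
    have "\<rho> (a + \<nu> c) = \<rho> (a' + \<nu> c') \<longleftrightarrow> (a + \<nu> c) + (a' + \<nu> c') \<in> copies R R'"
      using T that by (simp add: presents_def copiesI)
    also have "(a + \<nu> c) + (a' + \<nu> c') = (a + a') + \<nu> (c + c')" by (simp add: \<nu>_add ac_simps)
    also have "\<dots> \<in> copies R R' \<longleftrightarrow> a + a' \<in> R \<and> c + c' \<in> R'"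
    proof (rule mem_copies_iff)
      show "a + a' \<in> K" "c + c' \<in> K" using that K subspace_K by (auto intro!: bit_subspace_add)
    qed (use K in auto)
    also have "\<dots> \<longleftrightarrow> \<rho>1 a = \<rho>1 a' \<and> \<rho>2 c = \<rho>2 c'"
      using T1 T2 that by (simp add: presents_def)
    finally show ?thesis .
  qed
  have h: "h (\<rho> (a + \<nu> c)) = (\<rho>1 a, \<rho>2 c)" if ac: "a \<in> P" "c \<in> P'" for a c
  proof -
    let ?r = "rep (\<rho> (a + \<nu> c))"
    have "fst ?r \<in> P \<and> snd ?r \<in> P' \<and> \<rho> (fst ?r + \<nu> (snd ?r)) = \<rho> (a + \<nu> c)"
      unfolding rep_def
      by (rule someI[where P = "\<lambda>r. fst r \<in> P \<and> snd r \<in> P' \<and> \<rho> (fst r + \<nu> (snd r)) = \<rho> (a + \<nu> c)"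
            and x = "(a, c)"]) (use ac in simp)
    then show ?thesis using same_image[of "fst ?r" "snd ?r" a c] ac by (simp add: h_def)
  qed
  have rep: "\<exists>a\<in>P. \<exists>c\<in>P'. X = \<rho> (a + \<nu> c)" if X: "X \<in> carrier T" for X
  proof -
    from X obtain x where "X = \<rho> x" "x \<in> copies P P'" using T by (auto simp: presents_def)
    then show ?thesis by (blast elim: copiesE)
  qed
  have zero: "0 \<in> P" "0 \<in> P'" using T1 T2 by (auto simp: presents_def bit_subspace_zero)
  have closed: "a + a' \<in> P" "c + c' \<in> P'" if "a \<in> P" "c \<in> P'" "a' \<in> P" "c' \<in> P'" for a c a' c'
    using T1 T2 that by (auto simp: presents_def bit_subspace_add)
  have "bij_betw h (carrier T) (carrier T1 \<times> carrier T2)"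
  proof (rule bij_betw_imageI)
    show "inj_on h (carrier T)"
    proof (rule inj_onI)
      fix X Y assume "X \<in> carrier T" "Y \<in> carrier T" "h X = h Y"
      moreover obtain a c where "a \<in> P" "c \<in> P'" "X = \<rho> (a + \<nu> c)"
        using rep[OF \<open>X \<in> carrier T\<close>] by blast
      moreover obtain a' c' where "a' \<in> P" "c' \<in> P'" "Y = \<rho> (a' + \<nu> c')"
        using rep[OF \<open>Y \<in> carrier T\<close>] by blast
      ultimately show "X = Y" by (simp add: h same_image)
    qed
    show "h ` carrier T = carrier T1 \<times> carrier T2"
    proof (intro equalityI subsetI)
      fix Y assume "Y \<in> h ` carrier T"
      then obtain X where "X \<in> carrier T" "Y = h X" by blast
      moreover from this obtain a c where "a \<in> P" "c \<in> P'" "X = \<rho> (a + \<nu> c)"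
        using rep by blast
      ultimately show "Y \<in> carrier T1 \<times> carrier T2"
        using T1 T2 by (simp add: h presents_def)
    next
      fix Y assume "Y \<in> carrier T1 \<times> carrier T2"
      then obtain a c where ac: "a \<in> P" "c \<in> P'" "Y = (\<rho>1 a, \<rho>2 c)"
        using T1 T2 by (auto simp: presents_def)
      have "\<rho> (a + \<nu> c) \<in> carrier T" using T ac by (simp add: presents_def copiesI)
      then have "h (\<rho> (a + \<nu> c)) \<in> h ` carrier T" by (rule imageI)
      then show "Y \<in> h ` carrier T" by (simp add: h ac)
    qed
  qed
  moreover have "h (X \<oplus>\<^bsub>T\<^esub> Y) = h X \<oplus>\<^bsub>direct_sum T1 T2\<^esub> h Y"
    if XY: "X \<in> carrier T" "Y \<in> carrier T" for X Y
  proof -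
    obtain a c where ac: "a \<in> P" "c \<in> P'" "X = \<rho> (a + \<nu> c)" using rep[OF XY(1)] by blast
    obtain a' c' where ac': "a' \<in> P" "c' \<in> P'" "Y = \<rho> (a' + \<nu> c')" using rep[OF XY(2)] by blast
    have "X \<oplus>\<^bsub>T\<^esub> Y = \<rho> ((a + \<nu> c) + (a' + \<nu> c'))"
      using T ac ac' by (simp add: presents_def copiesI)
    also have "\<dots> = \<rho> ((a + a') + \<nu> (c + c'))" by (simp add: \<nu>_add ac_simps)
    finally have "h (X \<oplus>\<^bsub>T\<^esub> Y) = (\<rho>1 (a + a'), \<rho>2 (c + c'))"
      using closed ac ac' by (simp add: h)
    then show ?thesis using T1 T2 ac ac' by (simp add: h direct_sum_def presents_def)
  qed
  moreover have "h (e \<odot>\<^bsub>T\<^esub> X) = e \<odot>\<^bsub>direct_sum T1 T2\<^esub> h X" if X: "X \<in> carrier T" for e X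
  proof -
    obtain a c where ac: "a \<in> P" "c \<in> P'" "X = \<rho> (a + \<nu> c)" using rep[OF X] by blast
    then have in_copies: "a + \<nu> c \<in> copies P P'" by (simp add: copiesI)
    show ?thesis
    proof (cases "e = 0")
      case 0: True
      have "e \<odot>\<^bsub>T\<^esub> X = \<rho> (0 + \<nu> 0)" using T in_copies ac 0 by (simp add: presents_def \<nu>_zero)
      then have "h (e \<odot>\<^bsub>T\<^esub> X) = (\<rho>1 0, \<rho>2 0)" using h[OF zero] by simp
      then show ?thesis using T1 T2 ac 0 by (simp add: h direct_sum_def presents_def)
    next
      case False
      then have 1: "e = 1" by simp
      have "e \<odot>\<^bsub>T\<^esub> X = X" using T in_copies ac 1 by (simp add: presents_def)
      then show ?thesis using T1 T2 ac 1 by (simp add: h direct_sum_def presents_def)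
    qed
  qed
  ultimately show ?thesis unfolding linear_iso_def by (auto simp: direct_sum_def)
qed

end

locale complementary_subcomplex = complementary_copies +
  fixes D :: "('a \<Rightarrow> bit) \<Rightarrow> ('a \<Rightarrow> bit)"
  assumes D_add: "D (x + y) = D x + D y"
    and D_K: "a \<in> K \<Longrightarrow> D a \<in> K"
    and D_\<nu>: "a \<in> K \<Longrightarrow> D (\<nu> a) = \<nu> (D a)"
begin

lemma D_zero: "D 0 = 0"
  using D_add[of 0 0] by simp

lemma bit_subspace_cocycles:
  "bit_subspace (carrier (free_space S)) \<Longrightarrow> bit_subspace (cocycles (free_space S) D)"
  by (auto simp: bit_subspace_def cocycles_def zero_free_space D_add D_zero)

lemma bit_subspace_coboundaries:
  assumes "bit_subspace (carrier (free_space S))"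
  shows "bit_subspace (coboundaries (free_space S) D)"
  unfolding bit_subspace_def coboundaries_def
proof (intro conjI ballI)
  show "0 \<in> D ` carrier (free_space S)"
    using imageI[OF bit_subspace_zero[OF assms], of D] by (simp add: D_zero)
next
  fix x y assume "x \<in> D ` carrier (free_space S)" "y \<in> D ` carrier (free_space S)"
  then obtain u v where "x + y = D (u + v)" "u \<in> carrier (free_space S)" "v \<in> carrier (free_space S)"
    by (auto simp: D_add)
  then show "x + y \<in> D ` carrier (free_space S)" using assms by (simp add: bit_subspace_add)
qed

text \<open>
  As \<open>D (a + \<nu> c) = D a + \<nu> (D c)\<close>, cocycles and coboundaries decompose like the chains.  The numerator
  and the denominator of the graded piece are made from these and from the filtrations by
  intersections and sums, so they decompose as well.
\<close>

lemma linear_iso_graded_piece: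
  fixes S S1 S2 :: "'a set"
  assumes S: "carrier (free_space S) = copies (carrier (free_space S1)) (carrier (free_space S2))"
    and F: "\<And>i. F i = copies (F1 i) (F2 i)" and G: "\<And>k. G k = copies (G1 k) (G2 k)"
    and subspace: "\<And>T. bit_subspace (carrier (free_space T :: (bit, 'a \<Rightarrow> bit) module))"
      "\<And>i. bit_subspace (F i)" "\<And>i. bit_subspace (F1 i)" "\<And>i. bit_subspace (F2 i)"
      "\<And>k. bit_subspace (G k)" "\<And>k. bit_subspace (G1 k)" "\<And>k. bit_subspace (G2 k)"
    and sub_K: "carrier (free_space S1) \<subseteq> K" "carrier (free_space S2) \<subseteq> K"
      "\<And>i. F1 i \<subseteq> K" "\<And>i. F2 i \<subseteq> K" "\<And>k. G1 k \<subseteq> K" "\<And>k. G2 k \<subseteq> K"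
  shows "linear_iso
    (graded_piece (cohomology (free_space S) D) (\<lambda>i. induced (free_space S) D (F i))
       (\<lambda>k. induced (free_space S) D (G k)) i k)
    (direct_sum
      (graded_piece (cohomology (free_space S1) D) (\<lambda>i. induced (free_space S1) D (F1 i))
         (\<lambda>k. induced (free_space S1) D (G1 k)) i k)
      (graded_piece (cohomology (free_space S2) D) (\<lambda>i. induced (free_space S2) D (F2 i))
         (\<lambda>k. induced (free_space S2) D (G2 k)) i k))"
proof -
  let ?Z = "\<lambda>S. cocycles (free_space S) D" and ?N = "\<lambda>S. coboundaries (free_space S) D"
  have D_copies: "D (a + \<nu> c) = D a + \<nu> (D c)" if "c \<in> K" for a c
    using that by (simp add: D_add D_\<nu>)
  have Z: "?Z S = copies (?Z S1) (?Z S2)"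
  proof (intro equalityI subsetI)
    fix z assume "z \<in> ?Z S"
    then obtain a c where "z = a + \<nu> c" "a \<in> carrier (free_space S1)" "c \<in> carrier (free_space S2)"
      "D z = 0" using S by (auto simp: cocycles_def zero_free_space elim: copiesE)
    moreover from this have "D a + \<nu> (D c) = 0" "D a \<in> K" "D c \<in> K"
      using sub_K D_K by (auto simp: subset_iff simp flip: D_copies)
    then have "D a = 0" "D c = 0" using independent by blast+
    ultimately show "z \<in> copies (?Z S1) (?Z S2)"
      by (auto simp: cocycles_def zero_free_space intro!: copiesI)
  next
    fix z assume "z \<in> copies (?Z S1) (?Z S2)"
    then obtain a c where "z = a + \<nu> c" "a \<in> ?Z S1" "c \<in> ?Z S2" by (rule copiesE)
    then show "z \<in> ?Z S"
      using sub_K by (auto simp: cocycles_def zero_free_space S D_copies \<nu>_zero intro: copiesI)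
  qed
  have N: "?N S = copies (?N S1) (?N S2)"
  proof (intro equalityI subsetI)
    fix z assume "z \<in> ?N S"
    then obtain a c where "z = D (a + \<nu> c)" "a \<in> carrier (free_space S1)" "c \<in> carrier (free_space S2)"
      using S by (auto simp: coboundaries_def elim: copiesE)
    moreover from this have z: "z = D a + \<nu> (D c)" using sub_K D_copies by blast
    ultimately show "z \<in> copies (?N S1) (?N S2)"
      unfolding coboundaries_def z by (intro copiesI[OF imageI imageI]) simp_all
  next
    fix z assume "z \<in> copies (?N S1) (?N S2)"
    then obtain a c where "z = D a + \<nu> (D c)" "a \<in> carrier (free_space S1)" "c \<in> carrier (free_space S2)"
      by (auto simp: coboundaries_def elim!: copiesE)
    moreover from this have "D (a + \<nu> c) \<in> ?N S"
      unfolding coboundaries_def S by (intro imageI copiesI)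
    ultimately show "z \<in> ?N S" using sub_K D_copies[of c a] by auto
  qed
  have ZN_K: "?Z S1 \<subseteq> K" "?Z S2 \<subseteq> K" "?N S1 \<subseteq> K" "?N S2 \<subseteq> K"
    using sub_K D_K by (auto simp: cocycles_def coboundaries_def)
  note subspaces = subspace bit_subspace_cocycles[OF subspace(1)] bit_subspace_coboundaries[OF subspace(1)]
  let ?P = "\<lambda>S F G i k. cohomologous_part (?Z S) (?N S) (F i) (G k)"
  let ?R = "\<lambda>S F G i k. ?P S F G i (k + 1/2) + ?P S F G (i - 1) k + ?N S"
  have P: "?P S F G i k = copies (?P S1 F1 G1 i k) (?P S2 F2 G2 i k)" for i k
    unfolding Z N F G by (intro cohomologous_part_copies ZN_K sub_K)
  have P_K: "?P S1 F1 G1 i k \<subseteq> K" "?P S2 F2 G2 i k \<subseteq> K" for i k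
    using ZN_K by (auto simp: cohomologous_part_def)
  have R: "?R S F G i k = copies (?R S1 F1 G1 i k) (?R S2 F2 G2 i k)"
    unfolding P copies_sum unfolding N copies_sum by (rule refl)
  have R_K: "?R S1 F1 G1 i k \<subseteq> K" "?R S2 F2 G2 i k \<subseteq> K"
    by (intro sum_subset_K P_K ZN_K)+
  obtain \<rho> where \<rho>: "presents
     (graded_piece (cohomology (free_space S) D) (\<lambda>i. induced (free_space S) D (F i))
       (\<lambda>k. induced (free_space S) D (G k)) i k) (?P S F G i k) (?R S F G i k) \<rho>"
    using graded_piece_presentation[of S D F G i k] subspaces by auto
  obtain \<rho>1 where \<rho>1: "presents
     (graded_piece (cohomology (free_space S1) D) (\<lambda>i. induced (free_space S1) D (F1 i))
       (\<lambda>k. induced (free_space S1) D (G1 k)) i k) (?P S1 F1 G1 i k) (?R S1 F1 G1 i k) \<rho>1"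
    using graded_piece_presentation[of S1 D F1 G1 i k] subspaces by auto
  obtain \<rho>2 where \<rho>2: "presents
     (graded_piece (cohomology (free_space S2) D) (\<lambda>i. induced (free_space S2) D (F2 i))
       (\<lambda>k. induced (free_space S2) D (G2 k)) i k) (?P S2 F2 G2 i k) (?R S2 F2 G2 i k) \<rho>2"
    using graded_piece_presentation[of S2 D F2 G2 i k] subspaces by auto
  show ?thesis
    by (rule linear_iso_of_presentations[OF \<rho>[unfolded R, unfolded P] \<rho>1 \<rho>2 P_K R_K])
qed

end

section \<open>Raising one circle along an edge of the cube\<close>

text \<open>
  The part of the Khovanov differential that belongs to a single edge of the cube of smoothings, where
  \<open>K\<close> and \<open>K'\<close> are the sets of circles at its two ends.
\<close>

definition edge_entry :: "'c set \<Rightarrow> 'c set \<Rightarrow> 'c set \<Rightarrow> 'c set \<Rightarrow> bool" where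
  "edge_entry K K' Q Q' \<longleftrightarrow>
     Q \<inter> (K \<inter> K') = Q' \<inter> (K \<inter> K') \<and>
     (\<exists>C1 C2 C. C1 \<noteq> C2 \<and>
        ((K - K' = {C1, C2} \<and> K' - K = {C} \<and> merge_entry (C1 \<in> Q) (C2 \<in> Q) (C \<in> Q')) \<or>
         (K - K' = {C} \<and> K' - K = {C1, C2} \<and> split_entry (C \<in> Q) (C1 \<in> Q') (C2 \<in> Q'))))"

definition edge_map :: "'c set \<Rightarrow> 'c set \<Rightarrow> ('c set \<Rightarrow> bit) \<Rightarrow> 'c set \<Rightarrow> bit" where
  "edge_map K K' g Q' = (\<Sum>Q\<in>Pow K. of_bool (edge_entry K K' Q Q') * g Q)"

text \<open>
  Written in coefficients, the map that turns one \<open>v\<^sub>-\<close> into \<open>v\<^sub>+\<close> in all possible ways: the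
  coefficient at the set \<open>Q\<close> of circles with \<open>v\<^sub>+\<close> is the sum of the coefficients at the sets
  from which \<open>Q\<close> arises by turning one more circle into \<open>v\<^sub>+\<close>.
\<close>

definition raise_one :: "('c set \<Rightarrow> bit) \<Rightarrow> 'c set \<Rightarrow> bit" where
  "raise_one g Q = (\<Sum>C\<in>Q. g (Q - {C}))"

lemma raise_one_insert:
  assumes "finite A" "C \<notin> A"
  shows "raise_one g (insert C A) = g A + raise_one (\<lambda>Q. g (insert C Q)) A"
proof -
  have "(\<Sum>D\<in>A. g (insert C A - {D})) = (\<Sum>D\<in>A. g (insert C (A - {D})))"
    using assms by (intro sum.cong refl arg_cong[of _ _ g]) auto
  then show ?thesis using assms by (simp add: raise_one_def)
qed

lemma raise_one_cong:
  assumes "\<And>P. P \<subseteq> Q \<Longrightarrow> g P = h P"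
  shows "raise_one g Q = raise_one h Q"
  unfolding raise_one_def by (intro sum.cong refl assms) auto

lemma edge_entry_merge:
  assumes "C1 \<noteq> C2" "K - K' = {C1, C2}" "K' - K = {C}"
  shows "edge_entry K K' Q Q' \<longleftrightarrow>
    Q \<inter> (K \<inter> K') = Q' \<inter> (K \<inter> K') \<and> merge_entry (C1 \<in> Q) (C2 \<in> Q) (C \<in> Q')"
  using assms unfolding edge_entry_def merge_entry_def by (auto simp: doubleton_eq_iff)

lemma edge_entry_split:
  assumes "C1 \<noteq> C2" "K - K' = {C}" "K' - K = {C1, C2}"
  shows "edge_entry K K' Q Q' \<longleftrightarrow>
    Q \<inter> (K \<inter> K') = Q' \<inter> (K \<inter> K') \<and> split_entry (C \<in> Q) (C1 \<in> Q') (C2 \<in> Q')"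
  using assms unfolding edge_entry_def split_entry_def by (auto simp: doubleton_eq_iff)

lemma edge_map_eq:
  assumes "finite K"
  shows "edge_map K K' g Q' = sum g {Q. Q \<subseteq> K \<and> edge_entry K K' Q Q'}"
proof -
  have "Pow K \<inter> {Q. edge_entry K K' Q Q'} = {Q. Q \<subseteq> K \<and> edge_entry K K' Q Q'}" by auto
  then show ?thesis
    unfolding edge_map_def using assms by (subst sum_of_bool_mult_eq) auto
qed

lemma edge_map_merge:
  assumes K: "C1 \<noteq> C2" "K - K' = {C1, C2}" "K' - K = {C}" and "finite K" "Q' \<subseteq> K'"
  shows "edge_map K K' g Q' =
    (if C \<in> Q' then g (insert C1 (insert C2 (Q' \<inter> K)))
     else g (insert C1 (Q' \<inter> K)) + g (insert C2 (Q' \<inter> K)))"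
proof -
  have on_K: "Q \<subseteq> K \<and> Q \<inter> (K \<inter> K') = Q' \<inter> (K \<inter> K') \<longleftrightarrow> Q = (Q' \<inter> K) \<union> (Q \<inter> {C1, C2})" for Q
    using assms by blast
  have entry: "Q \<subseteq> K \<and> edge_entry K K' Q Q' \<longleftrightarrow>
      Q = (Q' \<inter> K) \<union> (Q \<inter> {C1, C2}) \<and> merge_entry (C1 \<in> Q) (C2 \<in> Q) (C \<in> Q')" for Q
    unfolding edge_entry_merge[OF K] using on_K[of Q] by blast
  have notin: "C1 \<notin> Q'" "C2 \<notin> Q'" using assms by auto
  show ?thesis
  proof (cases "C \<in> Q'")
    case True
    have "{Q. Q \<subseteq> K \<and> edge_entry K K' Q Q'} = {insert C1 (insert C2 (Q' \<inter> K))}"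
      unfolding entry merge_entry_def using True notin by blast
    then show ?thesis using True assms(4) by (simp add: edge_map_eq)
  next
    case False
    have "{Q. Q \<subseteq> K \<and> edge_entry K K' Q Q'} = {insert C1 (Q' \<inter> K), insert C2 (Q' \<inter> K)}"
      unfolding entry merge_entry_def using False notin K(1) by blast
    moreover have "insert C1 (Q' \<inter> K) \<noteq> insert C2 (Q' \<inter> K)" using assms by auto
    ultimately show ?thesis using False assms(4) by (simp add: edge_map_eq)
  qed
qed

lemma edge_map_split:
  assumes K: "C1 \<noteq> C2" "K - K' = {C}" "K' - K = {C1, C2}" and "finite K" "Q' \<subseteq> K'"
  shows "edge_map K K' g Q' =
    (if C1 \<in> Q' \<and> C2 \<in> Q' then 0
     else if C1 \<in> Q' \<or> C2 \<in> Q' then g (insert C (Q' \<inter> K)) else g (Q' \<inter> K))"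
proof -
  have on_K: "Q \<subseteq> K \<and> Q \<inter> (K \<inter> K') = Q' \<inter> (K \<inter> K') \<longleftrightarrow> Q = (Q' \<inter> K) \<union> (Q \<inter> {C})" for Q
    using assms by blast
  have entry: "Q \<subseteq> K \<and> edge_entry K K' Q Q' \<longleftrightarrow>
      Q = (Q' \<inter> K) \<union> (Q \<inter> {C}) \<and> split_entry (C \<in> Q) (C1 \<in> Q') (C2 \<in> Q')" for Q
    unfolding edge_entry_split[OF K] using on_K[of Q] by blast
  have "C \<notin> Q'" using assms by auto
  then have "{Q. Q \<subseteq> K \<and> edge_entry K K' Q Q'} =
    (if C1 \<in> Q' \<and> C2 \<in> Q' then {}
     else if C1 \<in> Q' \<or> C2 \<in> Q' then {insert C (Q' \<inter> K)} else {Q' \<inter> K})"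
    unfolding entry split_entry_def
    by (cases "C1 \<in> Q'"; cases "C2 \<in> Q'"; simp only: if_True if_False simp_thms; blast)
  then show ?thesis using assms(4) by (simp add: edge_map_eq)
qed

lemma edge_map_degenerate:
  assumes "\<And>C1 C2 C. C1 \<noteq> C2 \<Longrightarrow>
    \<not> (K - K' = {C1, C2} \<and> K' - K = {C}) \<and> \<not> (K - K' = {C} \<and> K' - K = {C1, C2})"
  shows "edge_map K K' g Q' = 0"
proof -
  have "\<not> edge_entry K K' Q Q'" for Q using assms unfolding edge_entry_def by blast
  then show ?thesis by (simp add: edge_map_def)
qed

text \<open>
  Let \<open>\<nu>\<close> take \<open>v\<^sub>-\<close> to \<open>v\<^sub>+\<close> and \<open>v\<^sub>+\<close> to 0.  The circles on which the two smoothings agree are raised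
  in the same way on both sides, so only the circles that are merged or split matter.  There
  \<open>\<nu> \<otimes> 1 + 1 \<otimes> \<nu>\<close> corresponds to \<open>\<nu>\<close> under merging and splitting; the two terms that are left over
  in \<open>m (v\<^sub>+ v\<^sub>-) + m (v\<^sub>- v\<^sub>+)\<close> and in \<open>(\<nu> \<otimes> 1 + 1 \<otimes> \<nu>) (v\<^sub>+ v\<^sub>- + v\<^sub>- v\<^sub>+)\<close> are equal and cancel modulo 2.
\<close>

lemma edge_map_raise_one:
  assumes fin: "finite K" "finite K'" and Q': "Q' \<subseteq> K'"
  shows "edge_map K K' (raise_one g) Q' = raise_one (edge_map K K' g) Q'"
proof -
  define J where "J = Q' \<inter> K"
  have J: "finite J" "J \<subseteq> K" "J \<subseteq> K'" using fin Q' by (auto simp: J_def finite_subset)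
  consider (merge) C1 C2 C where "C1 \<noteq> C2" "K - K' = {C1, C2}" "K' - K = {C}"
    | (split) C1 C2 C where "C1 \<noteq> C2" "K - K' = {C}" "K' - K = {C1, C2}"
    | (degenerate) "\<And>C1 C2 C. C1 \<noteq> C2 \<Longrightarrow>
        \<not> (K - K' = {C1, C2} \<and> K' - K = {C}) \<and> \<not> (K - K' = {C} \<and> K' - K = {C1, C2})"
    by metis
  then show ?thesis
  proof cases
    case merge
    note E = edge_map_merge[OF merge fin(1)]
    have notin: "C1 \<notin> J" "C2 \<notin> J" "C1 \<notin> insert C2 J" "C \<notin> J"
      using merge J by auto
    have sub: "P \<inter> K = P" "insert C P \<inter> K = P" "P \<subseteq> K'" "insert C P \<subseteq> K'" if "P \<subseteq> J" for P
      using merge J that by auto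
    have mem: "C \<in> K'" "C \<notin> K" using merge by auto
    note E = E sub mem
    have C_P: "C \<notin> P" if "P \<subseteq> J" for P using notin that by auto
    show ?thesis
    proof (cases "C \<in> Q'")
      case True
      then have Q'_eq: "Q' = insert C J" using merge Q' by (auto simp: J_def)
      have "raise_one (edge_map K K' g) Q' =
          edge_map K K' g J + raise_one (\<lambda>P. edge_map K K' g (insert C P)) J"
        unfolding Q'_eq using J notin by (intro raise_one_insert)
      also have "raise_one (\<lambda>P. edge_map K K' g (insert C P)) J =
          raise_one (\<lambda>P. g (insert C1 (insert C2 P))) J"
        by (rule raise_one_cong) (simp add: E)
      also have "edge_map K K' g J = g (insert C1 J) + g (insert C2 J)"
        using C_P[of J] by (simp add: E)
      finally have "raise_one (edge_map K K' g) Q' =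
        g (insert C1 J) + g (insert C2 J) + raise_one (\<lambda>P. g (insert C1 (insert C2 P))) J" .
      moreover have "edge_map K K' (raise_one g) Q' = raise_one g (insert C1 (insert C2 J))"
        using True Q' by (simp add: E J_def)
      ultimately show ?thesis
        using J notin by (simp add: raise_one_insert ac_simps)
    next
      case False
      then have Q'_eq: "Q' = J" using merge Q' by (auto simp: J_def)
      have "raise_one (edge_map K K' g) J = raise_one (\<lambda>P. g (insert C1 P) + g (insert C2 P)) J"
        by (rule raise_one_cong) (use C_P in \<open>simp add: E\<close>)
      also have "\<dots> = raise_one (\<lambda>P. g (insert C1 P)) J + raise_one (\<lambda>P. g (insert C2 P)) J"
        by (simp add: raise_one_def sum.distrib)
      \<comment> \<open>One of these two equal terms comes from raising \<open>C1\<close>, the other one from raising \<open>C2\<close>.\<close>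
      also have "\<dots> = (g J + g J) +
          (raise_one (\<lambda>P. g (insert C1 P)) J + raise_one (\<lambda>P. g (insert C2 P)) J)"
        by (simp only: bit_add_self add_0_left)
      also have "\<dots> = raise_one g (insert C1 J) + raise_one g (insert C2 J)"
        using J notin by (simp add: raise_one_insert ac_simps)
      also have "\<dots> = edge_map K K' (raise_one g) J" using C_P[of J] by (simp add: E)
      finally show ?thesis unfolding Q'_eq by simp
    qed
  next
    case split
    note E = edge_map_split[OF split fin(1)]
    have notin: "C1 \<notin> J" "C2 \<notin> J" "C1 \<notin> insert C2 J" "C \<notin> J"
      using split J by auto
    have sub: "P \<inter> K = P" "insert C1 P \<inter> K = P" "insert C2 P \<inter> K = P"
      "insert C1 (insert C2 P) \<inter> K = P" "P \<subseteq> K'" "insert C1 P \<subseteq> K'" "insert C2 P \<subseteq> K'"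
      "insert C1 (insert C2 P) \<subseteq> K'" if "P \<subseteq> J" for P
      using split J that by auto
    have mem: "C1 \<in> K'" "C2 \<in> K'" "C1 \<notin> K" "C2 \<notin> K" using split by auto
    note E = E sub mem
    have C_P: "C1 \<notin> P" "C2 \<notin> P" if "P \<subseteq> J" for P using notin that by auto
    have one: ?thesis if "Q' = insert C' J" "C' = C1 \<or> C' = C2" for C'
    proof -
      have C': "C' \<notin> J" using that notin by auto
      have val: "edge_map K K' h (insert C' P) = h (insert C P)" if "P \<subseteq> J" for P h
        using \<open>C' = C1 \<or> C' = C2\<close> split(1) C_P[OF that] that by (auto simp: E)
      have "raise_one (edge_map K K' g) Q' =
          edge_map K K' g J + raise_one (\<lambda>P. edge_map K K' g (insert C' P)) J"
        unfolding that(1) using J C' by (intro raise_one_insert)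
      also have "raise_one (\<lambda>P. edge_map K K' g (insert C' P)) J = raise_one (\<lambda>P. g (insert C P)) J"
        by (rule raise_one_cong) (rule val)
      also have "edge_map K K' g J = g J" using C_P[of J] by (simp add: E)
      also have "g J + raise_one (\<lambda>P. g (insert C P)) J = raise_one g (insert C J)"
        using J notin by (simp add: raise_one_insert)
      also have "\<dots> = edge_map K K' (raise_one g) Q'" unfolding that(1) by (simp add: val)
      finally show ?thesis by simp
    qed
    consider "Q' = insert C1 (insert C2 J)" | "Q' = insert C1 J" | "Q' = insert C2 J" | "Q' = J"
    proof -
      have "Q' = J \<union> (Q' \<inter> {C1, C2})" using Q' split by (auto simp: J_def)
      then show ?thesis using that by (cases "C1 \<in> Q'"; cases "C2 \<in> Q'") auto
    qed
    then show ?thesis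
    proof cases
      case 1
      have both: "edge_map K K' h (insert C1 (insert C2 P)) = 0" if "P \<subseteq> J" for P h
        using that by (simp add: E)
      have "raise_one (edge_map K K' g) Q' = edge_map K K' g (insert C2 J) +
          (edge_map K K' g (insert C1 J) + raise_one (\<lambda>P. edge_map K K' g (insert C1 (insert C2 P))) J)"
        unfolding 1 using J notin by (simp add: raise_one_insert)
      also have "raise_one (\<lambda>P. edge_map K K' g (insert C1 (insert C2 P))) J = raise_one (\<lambda>P. 0) J"
        by (rule raise_one_cong) (rule both)
      also have "\<dots> = 0" by (simp add: raise_one_def)
      also have "edge_map K K' g (insert C1 J) = g (insert C J)"
        using split(1) C_P[of J] by (simp add: E)
      also have "edge_map K K' g (insert C2 J) = g (insert C J)"
        using split(1) C_P[of J] by (simp add: E)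
      finally show ?thesis unfolding 1 by (simp add: both)
    next
      case 4
      have "raise_one (edge_map K K' g) J = raise_one g J"
        by (rule raise_one_cong) (use C_P in \<open>simp add: E\<close>)
      then show ?thesis unfolding 4 using C_P[of J] by (simp add: E)
    qed (use one in auto)
  next
    case degenerate
    then have zero: "edge_map K K' h P = 0" for h P by (rule edge_map_degenerate)
    show ?thesis by (simp add: raise_one_def zero)
  qed
qed

section \<open>The Khovanov complex as two copies of the reduced complex\<close>

lemma bit_subspace_free_space: "bit_subspace (carrier (free_space T :: (bit, 'a \<Rightarrow> bit) module))"
proof -
  have "finite {x. f x + g x \<noteq> 0} \<and> {x. f x + g x \<noteq> 0} \<subseteq> T"
    if "finite {x. f x \<noteq> 0}" "{x. f x \<noteq> 0} \<subseteq> T" "finite {x. g x \<noteq> 0}" "{x. g x \<noteq> 0} \<subseteq> T"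
    for f g :: "'a \<Rightarrow> bit"
  proof -
    have "{x. f x + g x \<noteq> 0} \<subseteq> {x. f x \<noteq> 0} \<union> {x. g x \<noteq> 0}" by auto
    then show ?thesis using that by (meson finite_UnI finite_subset sup.boundedI order_trans)
  qed
  then show ?thesis by (simp add: bit_subspace_def free_space_def del: bit_not_zero_iff)
qed

text \<open>
  What the diagram has to provide: in every smoothing \<open>s\<close> a single circle \<open>B s\<close> passes through the
  basepoint, the involution acts on the decorated smoothings, and the reflection fixes the
  projection of the basepoint.
\<close>

locale based_symmetric_cube =
  fixes n :: "real^3" and \<Gamma> :: "curve set" and b :: point and B :: "smoothing \<Rightarrow> circle"
  assumes finite_crossings: "finite (crossings \<Gamma>)"
    and finite_circles: "s \<subseteq> crossings \<Gamma> \<Longrightarrow> finite (circles \<Gamma> s)"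
    and base_circle: "s \<subseteq> crossings \<Gamma> \<Longrightarrow> B s \<in> circles \<Gamma> s"
    and base_iff: "s \<subseteq> crossings \<Gamma> \<Longrightarrow> C \<in> circles \<Gamma> s \<Longrightarrow> fst b \<in> \<Union>C \<longleftrightarrow> C = B s"
    and reflection_base: "reflection n (fst b) = fst b"
    and tau_decorated_mem: "x \<in> decorated_smoothings \<Gamma> \<Longrightarrow> tau_decorated n x \<in> decorated_smoothings \<Gamma>"
    and tau_decorated_invol: "tau_decorated n (tau_decorated n x) = x"
begin

lemma base_unique:
  assumes "s \<subseteq> crossings \<Gamma>" "s' \<subseteq> crossings \<Gamma>" "B s \<in> circles \<Gamma> s'"
  shows "B s' = B s"
  using base_iff[of s "B s"] base_iff[of s' "B s"] base_circle[of s] assms by simp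

text \<open>
  The image of \<open>B s\<close> is a circle of the reflected smoothing, and it passes through the image of the
  basepoint, which is the basepoint.
\<close>

lemma tau_base:
  assumes s: "s \<subseteq> crossings \<Gamma>"
  shows "B (reflection n ` s) = (\<lambda>A. reflection n ` A) ` B s"
proof -
  have "(s, {B s}) \<in> decorated_smoothings \<Gamma>"
    using s base_circle by (simp add: decorated_smoothings_def)
  from tau_decorated_mem[OF this]
  have mem: "reflection n ` s \<subseteq> crossings \<Gamma>"
      "(\<lambda>A. reflection n ` A) ` B s \<in> circles \<Gamma> (reflection n ` s)"
    by (auto simp: decorated_smoothings_def tau_decorated_def)
  obtain A where "A \<in> B s" "fst b \<in> A" using base_iff[OF s base_circle[OF s]] by blast
  then have "reflection n (fst b) \<in> \<Union>((\<lambda>A. reflection n ` A) ` B s)" by blast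
  then show ?thesis using base_iff[OF mem] by (simp add: reflection_base)
qed

lemma decorated_smoothings_Sigma:
  "decorated_smoothings \<Gamma> = (SIGMA s:Pow (crossings \<Gamma>). Pow (circles \<Gamma> s))"
  by (auto simp: decorated_smoothings_def)

lemma finite_decorated_smoothings: "finite (decorated_smoothings \<Gamma>)"
  unfolding decorated_smoothings_Sigma using finite_crossings finite_circles by auto

definition raise :: "(decorated \<Rightarrow> bit) \<Rightarrow> decorated \<Rightarrow> bit" where
  "raise f = (\<lambda>(s, Q). if (s, Q) \<in> decorated_smoothings \<Gamma> then raise_one (\<lambda>P. f (s, P)) Q else 0)"

text \<open>
  The basis of the reduced complex, in all quantum degrees together.
\<close>

definition base_minus :: "decorated set" where
  "base_minus = {(s, Q) \<in> decorated_smoothings \<Gamma>. B s \<notin> Q}"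

definition supported :: "decorated set \<Rightarrow> (decorated \<Rightarrow> bit) set" where
  "supported T = {f. \<forall>x. x \<notin> T \<longrightarrow> f x = 0}"

lemma supportedI:
  assumes "\<And>s Q. f (s, Q) \<noteq> 0 \<Longrightarrow> (s, Q) \<in> T"
  shows "f \<in> supported T"
proof -
  have "f x = 0" if "x \<notin> T" for x
    using assms[of "fst x" "snd x"] that by (cases "f x = 0") auto
  then show ?thesis by (simp add: supported_def)
qed

lemma supportedD: "f \<in> supported T \<Longrightarrow> x \<notin> T \<Longrightarrow> f x = 0"
  unfolding supported_def by blast

lemma supported_mono: "f \<in> supported T \<Longrightarrow> T \<subseteq> T' \<Longrightarrow> f \<in> supported T'"
  unfolding supported_def by blast

lemma bit_subspace_supported: "bit_subspace (supported T)"
  by (auto simp: bit_subspace_def supported_def)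

lemma raise_one_eq_0: "(\<And>C. C \<in> Q \<Longrightarrow> g (Q - {C}) = 0) \<Longrightarrow> raise_one g Q = 0"
  by (simp add: raise_one_def)

text \<open>
  If all terms of \<open>c\<close> have \<open>v\<^sub>-\<close> at the basepoint, then a term of \<open>raise c\<close> with \<open>v\<^sub>+\<close> there can only
  come from raising the circle \<open>B s\<close>.  So \<open>c\<close> can be recovered from \<open>raise c\<close>.
\<close>

lemma raise_at_base:
  assumes c: "c \<in> supported base_minus" and sQ: "(s, Q) \<in> decorated_smoothings \<Gamma>" "B s \<in> Q"
  shows "raise c (s, Q) = c (s, Q - {B s})"
proof -
  have fin: "finite Q" using sQ finite_circles by (auto simp: decorated_smoothings_def finite_subset)
  have "raise_one (\<lambda>P. c (s, P)) Q =
      c (s, Q - {B s}) + raise_one (\<lambda>P. c (s, insert (B s) P)) (Q - {B s})"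
    using raise_one_insert[of "Q - {B s}" "B s"] fin sQ by (simp add: insert_absorb)
  also have "raise_one (\<lambda>P. c (s, insert (B s) P)) (Q - {B s}) = 0"
    by (intro raise_one_eq_0 supportedD[OF c]) (simp add: base_minus_def)
  finally show ?thesis using sQ by (simp add: raise_def)
qed

lemma raise_add: "raise (f + g) = raise f + raise g"
  by (auto simp: raise_def raise_one_def fun_eq_iff sum.distrib)

lemma matrix_map_add: "matrix_map S c (f + g) = matrix_map S c f + matrix_map S c g"
  by (simp add: matrix_map_def fun_eq_iff sum.distrib distrib_left)

lemma matrix_map_nonzeroE:
  assumes "matrix_map S c f y \<noteq> 0"
  obtains x where "x \<in> S" "c x y" "f x \<noteq> 0"
proof -
  have "\<exists>x\<in>S. of_bool (c x y) * f x \<noteq> 0"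
    using assms unfolding matrix_map_def by (rule contrapos_np) (auto intro: sum.neutral)
  then show ?thesis using that by auto
qed

lemma khovanov_entry_iff:
  "khovanov_entry \<Gamma> (s, Q) (s', Q') \<longleftrightarrow>
     Q' \<subseteq> circles \<Gamma> s' \<and> (\<exists>p \<in> crossings \<Gamma> - s. s' = insert p s) \<and>
     edge_entry (circles \<Gamma> s) (circles \<Gamma> s') Q Q'"
  by (simp add: khovanov_entry_def edge_entry_def)

lemma khovanov_d_eq:
  "khovanov_d \<Gamma> f (s', Q') =
    (\<Sum>s\<in>Pow (crossings \<Gamma>). of_bool (Q' \<subseteq> circles \<Gamma> s' \<and> (\<exists>p \<in> crossings \<Gamma> - s. s' = insert p s)) *
       edge_map (circles \<Gamma> s) (circles \<Gamma> s') (\<lambda>Q. f (s, Q)) Q')"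
proof -
  have "khovanov_d \<Gamma> f (s', Q') =
      (\<Sum>(s, Q)\<in>(SIGMA s:Pow (crossings \<Gamma>). Pow (circles \<Gamma> s)).
         of_bool (khovanov_entry \<Gamma> (s, Q) (s', Q')) * f (s, Q))"
    unfolding khovanov_d_def matrix_map_def decorated_smoothings_Sigma
    by (intro sum.cong) auto
  also have "\<dots> = (\<Sum>s\<in>Pow (crossings \<Gamma>). \<Sum>Q\<in>Pow (circles \<Gamma> s).
      of_bool (khovanov_entry \<Gamma> (s, Q) (s', Q')) * f (s, Q))"
    using finite_crossings finite_circles by (subst sum.Sigma) auto
  also have "\<dots> = (\<Sum>s\<in>Pow (crossings \<Gamma>).
      of_bool (Q' \<subseteq> circles \<Gamma> s' \<and> (\<exists>p \<in> crossings \<Gamma> - s. s' = insert p s)) *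
       edge_map (circles \<Gamma> s) (circles \<Gamma> s') (\<lambda>Q. f (s, Q)) Q')"
    unfolding edge_map_def khovanov_entry_iff sum_distrib_left
    by (intro sum.cong refl) (auto simp: mult.assoc)
  finally show ?thesis .
qed

lemma khovanov_d_supported: "khovanov_d \<Gamma> f \<in> supported (decorated_smoothings \<Gamma>)"
proof -
  have *: "y \<in> decorated_smoothings \<Gamma>" if nz: "khovanov_d \<Gamma> f y \<noteq> 0" for y
  proof -
    obtain x where "x \<in> decorated_smoothings \<Gamma>" "khovanov_entry \<Gamma> x y"
      using nz unfolding khovanov_d_def by (rule matrix_map_nonzeroE)
    then show ?thesis
      by (cases x; cases y) (auto simp: khovanov_entry_iff decorated_smoothings_def)
  qed
  show ?thesis by (rule supportedI) (rule *)
qed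

lemma khovanov_d_raise: "khovanov_d \<Gamma> (raise f) = raise (khovanov_d \<Gamma> f)"
proof (rule ext)
  fix y :: decorated
  obtain s' Q' where y: "y = (s', Q')" by (cases y)
  show "khovanov_d \<Gamma> (raise f) y = raise (khovanov_d \<Gamma> f) y"
  proof (cases "(s', Q') \<in> decorated_smoothings \<Gamma>")
    case False
    then show ?thesis
      using supportedD[OF khovanov_d_supported[of "raise f"]] by (simp add: y raise_def[of "khovanov_d \<Gamma> f"])
  next
    case True
    then have s': "s' \<subseteq> crossings \<Gamma>" and Q': "Q' \<subseteq> circles \<Gamma> s'"
      by (auto simp: decorated_smoothings_def)
    let ?e = "\<lambda>s Q'. of_bool (Q' \<subseteq> circles \<Gamma> s' \<and> (\<exists>p \<in> crossings \<Gamma> - s. s' = insert p s)) :: bit"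
    have on_edge: "edge_map (circles \<Gamma> s) (circles \<Gamma> s') (\<lambda>Q. raise f (s, Q)) Q' =
        raise_one (edge_map (circles \<Gamma> s) (circles \<Gamma> s') (\<lambda>Q. f (s, Q))) Q'"
      if s: "s \<in> Pow (crossings \<Gamma>)" for s
    proof -
      have "edge_map (circles \<Gamma> s) (circles \<Gamma> s') (\<lambda>Q. raise f (s, Q)) Q' =
          edge_map (circles \<Gamma> s) (circles \<Gamma> s') (raise_one (\<lambda>Q. f (s, Q))) Q'"
        unfolding edge_map_def
        by (intro sum.cong refl) (use s in \<open>auto simp: raise_def decorated_smoothings_def\<close>)
      also have "\<dots> = raise_one (edge_map (circles \<Gamma> s) (circles \<Gamma> s') (\<lambda>Q. f (s, Q))) Q'"
        using s s' Q' by (intro edge_map_raise_one finite_circles) auto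
      finally show ?thesis .
    qed
    have "khovanov_d \<Gamma> (raise f) y = (\<Sum>s\<in>Pow (crossings \<Gamma>). ?e s Q' *
        raise_one (edge_map (circles \<Gamma> s) (circles \<Gamma> s') (\<lambda>Q. f (s, Q))) Q')"
      unfolding y khovanov_d_eq by (intro sum.cong refl) (simp only: on_edge)
    also have "\<dots> = (\<Sum>s\<in>Pow (crossings \<Gamma>). \<Sum>C\<in>Q'. ?e s (Q' - {C}) *
        edge_map (circles \<Gamma> s) (circles \<Gamma> s') (\<lambda>Q. f (s, Q)) (Q' - {C}))"
      unfolding raise_one_def sum_distrib_left using Q' by (intro sum.cong refl) auto
    also have "\<dots> = (\<Sum>C\<in>Q'. khovanov_d \<Gamma> f (s', Q' - {C}))"
      unfolding khovanov_d_eq by (rule sum.swap)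
    also have "\<dots> = raise (khovanov_d \<Gamma> f) y"
      using True by (simp add: y raise_def raise_one_def)
    finally show ?thesis .
  qed
qed

text \<open>
  A circle obtained by merging with a \<open>v\<^sub>-\<close> circle, or by splitting one, carries \<open>v\<^sub>-\<close>.
\<close>

lemma khovanov_d_base_minus:
  assumes f: "f \<in> supported base_minus"
  shows "khovanov_d \<Gamma> f \<in> supported base_minus"
proof -
  have *: "y \<in> base_minus" if nz: "khovanov_d \<Gamma> f y \<noteq> 0" for y
  proof -
    obtain x where x: "x \<in> decorated_smoothings \<Gamma>" "khovanov_entry \<Gamma> x y" "f x \<noteq> 0"
      using nz unfolding khovanov_d_def by (rule matrix_map_nonzeroE)
    obtain s Q s' Q' where xy: "x = (s, Q)" "y = (s', Q')" by (cases x; cases y)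
    have y: "y \<in> decorated_smoothings \<Gamma>"
      using supportedD[OF khovanov_d_supported] nz by blast
    have s: "s \<subseteq> crossings \<Gamma>" "s' \<subseteq> crossings \<Gamma>" "Q \<subseteq> circles \<Gamma> s" "Q' \<subseteq> circles \<Gamma> s'"
      using x y by (auto simp: xy decorated_smoothings_def)
    have "B s \<notin> Q" using supportedD[OF f, of x] x by (auto simp: base_minus_def xy)
    have e: "edge_entry (circles \<Gamma> s) (circles \<Gamma> s') Q Q'"
      using x by (simp add: xy khovanov_entry_iff)
    have "B s' \<notin> Q'"
    proof (cases "B s \<in> circles \<Gamma> s'")
      case True
      then have "B s' = B s" using s base_unique by blast
      then show ?thesis
        using e True base_circle[OF s(1)] \<open>B s \<notin> Q\<close> by (auto simp: edge_entry_def)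
    next
      case False
      moreover from this have "B s' \<notin> circles \<Gamma> s"
        using s base_unique[of s' s] base_circle by metis
      ultimately have "B s \<in> circles \<Gamma> s - circles \<Gamma> s'" "B s' \<in> circles \<Gamma> s' - circles \<Gamma> s"
        using s base_circle by auto
      then show ?thesis
        using e \<open>B s \<notin> Q\<close> unfolding edge_entry_def merge_entry_def split_entry_def
        by (elim conjE exE disjE) auto
    qed
    then show ?thesis using y by (simp add: xy base_minus_def)
  qed
  show ?thesis by (rule supportedI) (rule *)
qed

lemma tau_chain_eq:
  "tau_chain n \<Gamma> f y = (if y \<in> decorated_smoothings \<Gamma> then f (tau_decorated n y) else 0)"
proof -
  have "tau_chain n \<Gamma> f y = sum f (decorated_smoothings \<Gamma> \<inter> {x. y = tau_decorated n x})"
    unfolding tau_chain_def matrix_map_def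
    by (rule sum_of_bool_mult_eq) (rule finite_decorated_smoothings)
  also have "decorated_smoothings \<Gamma> \<inter> {x. y = tau_decorated n x} =
      (if y \<in> decorated_smoothings \<Gamma> then {tau_decorated n y} else {})"
  proof -
    have "x \<in> decorated_smoothings \<Gamma> \<and> y = tau_decorated n x \<longleftrightarrow>
        y \<in> decorated_smoothings \<Gamma> \<and> x = tau_decorated n y" for x
      using tau_decorated_mem[of x] tau_decorated_mem[of y]
        tau_decorated_invol[of x] tau_decorated_invol[of y] by metis
    then show ?thesis by (simp add: set_eq_iff del: split_paired_All)
  qed
  finally show ?thesis by simp
qed

lemma tau_chain_raise: "tau_chain n \<Gamma> (raise f) = raise (tau_chain n \<Gamma> f)"
proof (rule ext)
  fix y :: decorated
  obtain s Q where y: "y = (s, Q)" by (cases y)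
  define R where "R = (\<lambda>C :: circle. (\<lambda>A. reflection n ` A) ` C)"
  have "inj (tau_decorated n)" using tau_decorated_invol by (metis injI)
  have tau: "tau_decorated n (s, P) = (reflection n ` s, R ` P)" for P
    by (simp add: tau_decorated_def R_def)
  have "inj R"
  proof (rule injI)
    fix C D assume "R C = R D"
    then have "tau_decorated n (s, {C}) = tau_decorated n (s, {D})" by (simp add: tau)
    then show "C = D" using \<open>inj (tau_decorated n)\<close> by (auto dest: injD)
  qed
  show "tau_chain n \<Gamma> (raise f) y = raise (tau_chain n \<Gamma> f) y"
  proof (cases "y \<in> decorated_smoothings \<Gamma>")
    case True
    have "tau_chain n \<Gamma> (raise f) y = (\<Sum>D\<in>R ` Q. f (reflection n ` s, R ` Q - {D}))"
      using True tau_decorated_mem[OF True]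
      by (simp add: tau_chain_eq raise_def raise_one_def tau y)
    also have "\<dots> = (\<Sum>C\<in>Q. f (reflection n ` s, R ` Q - {R C}))"
      using \<open>inj R\<close> by (subst sum.reindex) (auto intro: inj_on_subset)
    also have "\<dots> = (\<Sum>C\<in>Q. tau_chain n \<Gamma> f (s, Q - {C}))"
      using True \<open>inj R\<close> by (intro sum.cong refl)
        (auto simp: tau_chain_eq tau y decorated_smoothings_def image_set_diff)
    also have "\<dots> = raise (tau_chain n \<Gamma> f) y"
      using True by (simp add: raise_def raise_one_def y)
    finally show ?thesis .
  qed (simp add: tau_chain_eq raise_def y)
qed

lemma tau_chain_base_minus:
  assumes f: "f \<in> supported base_minus"
  shows "tau_chain n \<Gamma> f \<in> supported base_minus"
proof -
  have *: "(s, Q) \<in> base_minus" if nz: "tau_chain n \<Gamma> f (s, Q) \<noteq> 0" for s Q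
  proof -
    have sQ: "(s, Q) \<in> decorated_smoothings \<Gamma>" and "f (tau_decorated n (s, Q)) \<noteq> 0"
      using nz by (auto simp: tau_chain_eq split: if_splits)
    then have "tau_decorated n (s, Q) \<in> base_minus" using supportedD[OF f] by blast
    moreover have "B (reflection n ` s) = (\<lambda>A. reflection n ` A) ` B s"
      using sQ by (intro tau_base) (auto simp: decorated_smoothings_def)
    ultimately show ?thesis
      using sQ by (auto simp: base_minus_def tau_decorated_def)
  qed
  show ?thesis by (rule supportedI) (rule *)
qed

lemma perturbed_d_eq: "perturbed_d n \<Gamma> f = khovanov_d \<Gamma> f + (f + tau_chain n \<Gamma> f)"
  by (simp add: perturbed_d_def fun_eq_iff)

text \<open>
  For the uniqueness of the decomposition, only \<open>raise c\<close> contributes to the coefficients of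
  \<open>a + raise c\<close> at decorations with \<open>v\<^sub>+\<close> at the basepoint.
\<close>

sublocale complementary_subcomplex "supported base_minus" raise "perturbed_d n \<Gamma>"
proof
  show "bit_subspace (supported base_minus)" by (rule bit_subspace_supported)
  show "raise (x + y) = raise x + raise y" for x y by (rule raise_add)
  show "perturbed_d n \<Gamma> (x + y) = perturbed_d n \<Gamma> x + perturbed_d n \<Gamma> y" for x y
    by (simp add: perturbed_d_eq khovanov_d_def tau_chain_def matrix_map_add ac_simps)
  show "perturbed_d n \<Gamma> (raise a) = raise (perturbed_d n \<Gamma> a)" for a
    by (simp add: perturbed_d_eq raise_add khovanov_d_raise tau_chain_raise)
  show "perturbed_d n \<Gamma> a \<in> supported base_minus" if "a \<in> supported base_minus" for a
    unfolding perturbed_d_eq using that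
    by (intro bit_subspace_add[OF bit_subspace_supported] khovanov_d_base_minus tau_chain_base_minus)
  show "a = 0 \<and> c = 0"
    if a: "a \<in> supported base_minus" and c: "c \<in> supported base_minus" and ac: "a + raise c = 0" for a c
  proof -
    have "c (s, Q) = 0" for s Q
    proof (rule ccontr)
      assume nz: "c (s, Q) \<noteq> 0"
      then have sQ: "(s, Q) \<in> decorated_smoothings \<Gamma>" "B s \<notin> Q"
        using supportedD[OF c, of "(s, Q)"] by (auto simp: base_minus_def)
      then have s: "s \<subseteq> crossings \<Gamma>" by (auto simp: decorated_smoothings_def)
      have up: "(s, insert (B s) Q) \<in> decorated_smoothings \<Gamma>"
        using sQ base_circle[OF s] by (auto simp: decorated_smoothings_def)
      have "a (s, insert (B s) Q) = 0" by (rule supportedD[OF a]) (simp add: base_minus_def)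
      moreover have "raise c (s, insert (B s) Q) = c (s, Q)"
        using raise_at_base[OF c up] sQ by simp
      moreover have "a (s, insert (B s) Q) + raise c (s, insert (B s) Q) = 0"
        using fun_cong[OF ac] by simp
      ultimately show False using nz by simp
    qed
    then have "c = 0" by (auto simp: fun_eq_iff)
    moreover have "raise 0 = 0" using raise_add[of 0 0] by simp
    ultimately show ?thesis using ac by simp
  qed
qed

text \<open>
  To decompose \<open>f\<close>, let \<open>c\<close> be the part of \<open>f\<close> with \<open>v\<^sub>+\<close> at the basepoint, with this \<open>v\<^sub>+\<close> replaced
  by \<open>v\<^sub>-\<close>.  Then \<open>f\<close> and \<open>raise c\<close> agree at the decorations with \<open>v\<^sub>+\<close> at the basepoint, so the other
  summand \<open>f + raise c\<close> is reduced.
\<close>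

lemma supported_eq_copies:
  assumes T: "T \<subseteq> decorated_smoothings \<Gamma>"
    and T2: "T2 \<subseteq> base_minus"
    and raise_T2: "\<And>s Q C. (s, Q) \<in> T2 \<Longrightarrow> C \<in> circles \<Gamma> s - Q \<Longrightarrow> (s, insert C Q) \<in> T"
    and lower_T: "\<And>s Q. (s, Q) \<in> T \<Longrightarrow> B s \<in> Q \<Longrightarrow> (s, Q - {B s}) \<in> T2"
  shows "supported T = copies (supported (T \<inter> base_minus)) (supported T2)"
proof -
  have raise_supp: "raise c \<in> supported T" if c: "c \<in> supported T2" for c
  proof -
    have *: "(s, Q) \<in> T" if nz: "raise c (s, Q) \<noteq> 0" for s Q
    proof -
      have sQ: "(s, Q) \<in> decorated_smoothings \<Gamma>" and "raise_one (\<lambda>P. c (s, P)) Q \<noteq> 0"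
        using nz by (auto simp: raise_def split: if_splits)
      then obtain C where C: "C \<in> Q" "c (s, Q - {C}) \<noteq> 0" using raise_one_eq_0 by metis
      then have "(s, Q - {C}) \<in> T2" using supportedD[OF c] by blast
      moreover have "C \<in> circles \<Gamma> s - (Q - {C})"
        using sQ C by (auto simp: decorated_smoothings_def)
      ultimately have "(s, insert C (Q - {C})) \<in> T" by (rule raise_T2)
      then show ?thesis using C by (simp add: insert_absorb)
    qed
    show ?thesis by (rule supportedI) (rule *)
  qed
  show ?thesis
  proof (intro equalityI subsetI)
    fix f assume f: "f \<in> supported T"
    define c where "c = (\<lambda>(s, Q). if s \<subseteq> crossings \<Gamma> \<and> B s \<notin> Q then f (s, insert (B s) Q) else 0)"
    have *: "(s, Q) \<in> T2" if nz: "c (s, Q) \<noteq> 0" for s Q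
    proof -
      have "B s \<notin> Q" "f (s, insert (B s) Q) \<noteq> 0" using nz by (auto simp: c_def split: if_splits)
      moreover from this have "(s, insert (B s) Q) \<in> T" using supportedD[OF f] by blast
      ultimately show ?thesis using lower_T[of s "insert (B s) Q"] by simp
    qed
    have c: "c \<in> supported T2" by (rule supportedI) (rule *)
    then have c': "c \<in> supported base_minus" using T2 by (rule supported_mono)
    have "f + raise c \<in> supported T"
      by (intro bit_subspace_add[OF bit_subspace_supported] f raise_supp c)
    moreover have "(f + raise c) (s, Q) = 0" if sQ: "(s, Q) \<notin> base_minus" "(s, Q) \<in> T" for s Q
    proof -
      have mem: "(s, Q) \<in> decorated_smoothings \<Gamma>" "B s \<in> Q"
        using sQ T by (auto simp: base_minus_def)
      then have "c (s, Q - {B s}) = f (s, Q)"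
        by (auto simp: c_def decorated_smoothings_def insert_absorb)
      then show ?thesis using raise_at_base[OF c' mem] by simp
    qed
    ultimately have "f + raise c \<in> supported (T \<inter> base_minus)"
      by (intro supportedI) (metis IntI supportedD)
    then have "(f + raise c) + raise c \<in> copies (supported (T \<inter> base_minus)) (supported T2)"
      using c by (rule copiesI)
    then show "f \<in> copies (supported (T \<inter> base_minus)) (supported T2)" by simp
  next
    fix f assume "f \<in> copies (supported (T \<inter> base_minus)) (supported T2)"
    then obtain a c where "f = a + raise c" "a \<in> supported (T \<inter> base_minus)" "c \<in> supported T2"
      by (rule copiesE)
    moreover from this have "a \<in> supported T" by (auto intro: supported_mono)
    ultimately show "f \<in> supported T"
      using bit_subspace_add[OF bit_subspace_supported] raise_supp by blast
  qed
qed

lemma carrier_free_space: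
  assumes "T \<subseteq> decorated_smoothings \<Gamma>"
  shows "carrier (free_space T) = supported T"
proof -
  have "finite {x. f x \<noteq> 0} \<and> {x. f x \<noteq> 0} \<subseteq> T \<longleftrightarrow> f \<in> supported T" for f :: "decorated \<Rightarrow> bit"
    unfolding supported_def using finite_subset[of "{x. f x \<noteq> 0}" T]
      finite_subset[OF assms finite_decorated_smoothings] by blast
  then show ?thesis by (simp add: free_space_def)
qed

lemma F_filtration_free_space:
  assumes "T \<subseteq> decorated_smoothings \<Gamma>"
  shows "F_filtration \<Gamma> (free_space T) i = supported {x \<in> T. h_grading \<Gamma> x \<le> i}"
  unfolding F_filtration_def carrier_free_space[OF assms] supported_def by blast

lemma G_filtration_free_space:
  assumes "T \<subseteq> decorated_smoothings \<Gamma>"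
  shows "G_filtration n \<Gamma> (free_space T) k = supported {x \<in> T. weight n \<Gamma> (fst x) \<ge> k}"
  unfolding G_filtration_def carrier_free_space[OF assms] supported_def by blast

lemma q_grading_insert:
  assumes "(s, Q) \<in> decorated_smoothings \<Gamma>" "C \<in> circles \<Gamma> s - Q"
  shows "q_grading \<Gamma> (s, insert C Q) = q_grading \<Gamma> (s, Q) + 2"
proof -
  have fin: "finite (circles \<Gamma> s)" "finite Q"
    using assms finite_circles by (auto simp: decorated_smoothings_def finite_subset)
  have "circles \<Gamma> s - Q = insert C (circles \<Gamma> s - insert C Q)" using assms by auto
  then have "card (circles \<Gamma> s - Q) = Suc (card (circles \<Gamma> s - insert C Q))"
    using fin by (metis DiffD2 card_insert_disjoint finite_Diff insertI1)
  then show ?thesis using fin assms by (simp add: q_grading_def)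
qed

text \<open>
  The complexes and the steps of both filtrations are spanned by decorated smoothings that are singled out
  by the quantum degree and by a condition on the underlying smoothing.  Raising does not affect the
  latter, which is why all of them decompose by the same argument.
\<close>

lemma linear_iso_Kh_tau:
  "linear_iso (Kh_tau n \<Gamma> i j k)
     (direct_sum (reduced_Kh_tau n \<Gamma> b i (j + 1) k) (reduced_Kh_tau n \<Gamma> b i (j - 1) k))"
proof -
  define T where "T = {x \<in> decorated_smoothings \<Gamma>. q_grading \<Gamma> x = j}"
  \<comment> \<open>Raising from degree \<open>j - 2\<close> gives degree \<open>j\<close>; the reduced complex is shifted by one.\<close>
  define T2 where "T2 = {x \<in> base_minus. q_grading \<Gamma> x = j - 2}"
  have base: "(\<forall>C\<in>circles \<Gamma> s. fst b \<in> \<Union>C \<longrightarrow> C \<notin> Q) \<longleftrightarrow> B s \<notin> Q"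
    if "(s, Q) \<in> decorated_smoothings \<Gamma>" for s Q
    using that base_iff[of s] base_circle[of s] by (auto simp: decorated_smoothings_def)
  have CKh: "CKh \<Gamma> j = free_space T" by (simp add: CKh_def T_def)
  have red1: "reduced_CKh \<Gamma> b (j + 1) = free_space (T \<inter> base_minus)"
    unfolding reduced_CKh_def T_def base_minus_def
    by (rule arg_cong[where f = free_space]) (use base in auto)
  have red2: "reduced_CKh \<Gamma> b (j - 1) = free_space T2"
    unfolding reduced_CKh_def T2_def base_minus_def
    by (rule arg_cong[where f = free_space]) (use base in auto)
  have sub: "T \<subseteq> decorated_smoothings \<Gamma>" "T \<inter> base_minus \<subseteq> decorated_smoothings \<Gamma>"
      "T2 \<subseteq> decorated_smoothings \<Gamma>"
    by (auto simp: T_def T2_def base_minus_def)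
  have split: "supported {x \<in> T. P (fst x)} =
      copies (supported {x \<in> T \<inter> base_minus. P (fst x)}) (supported {x \<in> T2. P (fst x)})"
    for P :: "smoothing \<Rightarrow> bool"
  proof -
    have "supported {x \<in> T. P (fst x)} =
        copies (supported ({x \<in> T. P (fst x)} \<inter> base_minus)) (supported {x \<in> T2. P (fst x)})"
    proof (rule supported_eq_copies)
      show "(s, insert C Q) \<in> {x \<in> T. P (fst x)}"
        if "(s, Q) \<in> {x \<in> T2. P (fst x)}" "C \<in> circles \<Gamma> s - Q" for s Q C
        using that q_grading_insert[of s Q C]
        by (auto simp: T_def T2_def base_minus_def decorated_smoothings_def)
      show "(s, Q - {B s}) \<in> {x \<in> T2. P (fst x)}"
        if sQ: "(s, Q) \<in> {x \<in> T. P (fst x)}" "B s \<in> Q" for s Q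
      proof -
        have mem: "(s, Q - {B s}) \<in> decorated_smoothings \<Gamma>" "B s \<in> circles \<Gamma> s - (Q - {B s})"
          using sQ by (auto simp: T_def decorated_smoothings_def)
        show ?thesis using sQ mem q_grading_insert[OF mem]
          by (auto simp: T_def T2_def base_minus_def insert_absorb)
      qed
    qed (auto simp: T_def T2_def base_minus_def)
    moreover have "{x \<in> T. P (fst x)} \<inter> base_minus = {x \<in> T \<inter> base_minus. P (fst x)}" by blast
    ultimately show ?thesis by simp
  qed
  have h: "h_grading \<Gamma> x \<le> i \<longleftrightarrow> int (card (fst x)) - int (n_minus \<Gamma>) \<le> i" for x i
    by (simp add: h_grading_def split: prod.split)
  have base_sub: "supported (T \<inter> base_minus) \<subseteq> supported base_minus"
      "supported T2 \<subseteq> supported base_minus"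
    by (auto simp: T2_def intro: supported_mono)
  note filtration = F_filtration_free_space G_filtration_free_space
  show ?thesis
    unfolding Kh_tau_def reduced_Kh_tau_def triple_graded_def CKh red1 red2
  proof (rule linear_iso_graded_piece)
    show "carrier (free_space T) =
        copies (carrier (free_space (T \<inter> base_minus))) (carrier (free_space T2))"
      unfolding carrier_free_space[OF sub(1)] carrier_free_space[OF sub(2)] carrier_free_space[OF sub(3)]
      using split[of "\<lambda>_. True"] by (simp add: Int_def)
    show "F_filtration \<Gamma> (free_space T) i = copies (F_filtration \<Gamma> (free_space (T \<inter> base_minus)) i)
        (F_filtration \<Gamma> (free_space T2) i)" for i
      unfolding filtration[OF sub(1)] filtration[OF sub(2)] filtration[OF sub(3)] h by (rule split)
    show "G_filtration n \<Gamma> (free_space T) k = copies (G_filtration n \<Gamma> (free_space (T \<inter> base_minus)) k)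
        (G_filtration n \<Gamma> (free_space T2) k)" for k
      unfolding filtration[OF sub(1)] filtration[OF sub(2)] filtration[OF sub(3)] by (rule split)
    show "bit_subspace (carrier (free_space T' :: (bit, decorated \<Rightarrow> bit) module))" for T'
      by (rule bit_subspace_free_space)
    show "carrier (free_space (T \<inter> base_minus)) \<subseteq> supported base_minus"
        "carrier (free_space T2) \<subseteq> supported base_minus"
      using base_sub by (simp_all add: carrier_free_space sub)
    show "F_filtration \<Gamma> (free_space (T \<inter> base_minus)) i \<subseteq> supported base_minus"
        "F_filtration \<Gamma> (free_space T2) i \<subseteq> supported base_minus" for i
      using base_sub by (auto simp: F_filtration_def carrier_free_space sub)
    show "G_filtration n \<Gamma> (free_space (T \<inter> base_minus)) k \<subseteq> supported base_minus"
        "G_filtration n \<Gamma> (free_space T2) k \<subseteq> supported base_minus" for k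
      using base_sub by (auto simp: G_filtration_def carrier_free_space sub)
  qed (simp_all only: filtration[OF sub(1)] filtration[OF sub(2)] filtration[OF sub(3)]
      bit_subspace_supported)
qed

end

section \<open>Reflections, intervals and components\<close>

lemma reflection_linear: "linear (reflection n)"
  by (rule linearI) (simp_all add: reflection_def inner_add_left algebra_simps)

lemma reflection_inner: "norm n = 1 \<Longrightarrow> reflection n p \<bullet> n = - (p \<bullet> n)"
  by (simp add: reflection_def inner_diff_left dot_square_norm)

lemma reflection_reflection: "norm n = 1 \<Longrightarrow> reflection n (reflection n p) = p"
  using reflection_inner[of n p]
  by (simp add: reflection_def[of n "reflection n p"]) (simp add: reflection_def)

lemma reflection_fixed: "p \<bullet> n = 0 \<Longrightarrow> reflection n p = p"
  by (simp add: reflection_def)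

lemma tau_linear: "linear (tau n)"
  by (rule linearI)
    (simp_all add: tau_def linear_add[OF reflection_linear] linear_cmul[OF reflection_linear])

lemma tau_tau: "norm n = 1 \<Longrightarrow> tau n (tau n x) = x"
  by (simp add: tau_def reflection_reflection)

lemma fst_tau: "fst (tau n x) = reflection n (fst x)"
  by (simp add: tau_def)

text \<open>
  Expanding in the rows leaves, besides the determinant itself, twice the sum in Cramer's formula for
  \<open>(n \<bullet> n) * det\<close>.
\<close>

lemma det_reflection:
  assumes "norm n = 1"
  shows "det (vector [reflection n p, reflection n a, reflection n c] :: real^3^3) =
    - det (vector [p, a, c] :: real^3^3)"
proof -
  let ?d = "\<lambda>p a c. det (vector [p, a, c] :: real^3^3)"
  have expand: "?d (p - x *\<^sub>R n) (a - y *\<^sub>R n) (c - z *\<^sub>R n) =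
      ?d p a c - (x * ?d n a c + y * ?d p n c + z * ?d p a n)" for x y z
    by (simp add: det_3 algebra_simps)
  have cramer: "(p \<bullet> n) * ?d n a c + (a \<bullet> n) * ?d p n c + (c \<bullet> n) * ?d p a n = (n \<bullet> n) * ?d p a c"
    by (simp add: det_3 inner_vec_def sum_3 algebra_simps)
  have "n \<bullet> n = 1" using assms by (simp add: dot_square_norm)
  moreover have "2 * (p \<bullet> n) * ?d n a c + 2 * (a \<bullet> n) * ?d p n c + 2 * (c \<bullet> n) * ?d p a n =
      2 * ((p \<bullet> n) * ?d n a c + (a \<bullet> n) * ?d p n c + (c \<bullet> n) * ?d p a n)"
    by (simp only: distrib_left mult.assoc)
  ultimately have "2 * (p \<bullet> n) * ?d n a c + 2 * (a \<bullet> n) * ?d p n c + 2 * (c \<bullet> n) * ?d p a n =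
      2 * ?d p a c"
    by (simp only: cramer mult_1)
  then show ?thesis unfolding reflection_def expand by simp
qed

lemma det_scale_rows:
  "det (vector [p, r *\<^sub>R a, t *\<^sub>R c] :: real^3^3) = r * t * det (vector [p, a, c] :: real^3^3)"
  by (simp add: det_3 algebra_simps)

lemma det_swap_rows: "det (vector [p, c, a] :: real^3^3) = - det (vector [p, a, c] :: real^3^3)"
  by (simp add: det_3 algebra_simps)

lemma interval_minus_finite:
  assumes "finite T"
  shows "\<exists>\<C>. finite \<C> \<and> (\<forall>C\<in>\<C>. connected C) \<and> \<Union>\<C> = {a..b} - (T :: real set)"
  using assms
proof (induction T)
  case empty
  show ?case by (rule exI[of _ "{{a..b}}"]) auto
next
  case (insert t T)
  then obtain \<C> where \<C>: "finite \<C>" "\<forall>C\<in>\<C>. connected C" "\<Union>\<C> = {a..b} - T" by blast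
  let ?D = "(\<lambda>C. C \<inter> {..<t}) ` \<C> \<union> (\<lambda>C. C \<inter> {t<..}) ` \<C>"
  have "connected (C \<inter> {..<t})" "connected (C \<inter> {t<..})" if "C \<in> \<C>" for C
    using \<C>(2) that by (simp_all add: connected_convex_1 convex_Int)
  then have "\<forall>D\<in>?D. connected D" by blast
  moreover have "\<Union>?D = \<Union>\<C> - {t}" by (auto simp: neq_iff)
  then have "\<Union>?D = {a..b} - insert t T" using Diff_insert[of "{a..b}" t T] \<C>(3) by metis
  ultimately show ?case using \<C>(1) by (intro exI[of _ ?D]) simp
qed

lemma finite_components_cover:
  assumes "finite \<D>" "\<And>D. D \<in> \<D> \<Longrightarrow> connected D" "\<Union>\<D> = U"
  shows "finite (components U)"
proof (rule finite_subset)
  show "components U \<subseteq> (\<lambda>D. connected_component_set U (SOME x. x \<in> D)) ` \<D>"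
  proof
    fix A assume "A \<in> components U"
    then obtain x where x: "x \<in> U" "A = connected_component_set U x" by (auto simp: components_def)
    then obtain D where D: "D \<in> \<D>" "x \<in> D" using assms(3) by auto
    then have "(SOME x. x \<in> D) \<in> D" by (metis someI)
    then have "connected_component U x (SOME x. x \<in> D)"
      using assms D by (auto simp: connected_component_def)
    then have "A = connected_component_set U (SOME x. x \<in> D)"
      using x(2) connected_component_eq by fastforce
    then show "A \<in> (\<lambda>D. connected_component_set U (SOME x. x \<in> D)) ` \<D>" using D(1) by blast
  qed
qed (use assms(1) in simp)

text \<open>
  A homeomorphism of \<open>U\<close> permutes the maximal connected subsets of \<open>U\<close>.
\<close>

lemma components_involution_image:
  fixes R :: "'a::topological_space \<Rightarrow> 'a"
  assumes A: "A \<in> components U" and R: "continuous_on UNIV R" "\<And>x. R (R x) = x" "R ` U \<subseteq> U"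
  shows "R ` A \<in> components U"
proof -
  have RR: "R ` R ` C = C" for C using R(2) by (simp add: image_image)
  have conn: "connected (R ` C)" if "connected C" for C
    using that R(1) by (metis connected_continuous_image continuous_on_subset subset_UNIV)
  note maximal = A[unfolded in_components_maximal]
  have A': "A \<noteq> {}" "A \<subseteq> U" "connected A" using maximal by simp_all
  have "C = R ` A" if C: "R ` A \<subseteq> C" "C \<subseteq> U" "connected C" for C
  proof -
    have "A \<subseteq> R ` C" using image_mono[OF C(1), of R] by (simp only: RR)
    moreover have "R ` C \<subseteq> U" using C(2) R(3) by blast
    moreover have "R ` C \<noteq> {}" using C(1) A'(1) by blast
    ultimately have "R ` C = A" using maximal conn[OF C(3)] by simp
    then show ?thesis using RR[of C] by simp
  qed
  moreover have "R ` A \<subseteq> U" using A'(2) R(3) by blast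
  ultimately show ?thesis
    unfolding in_components_maximal using A'(1) conn[OF A'(3)] by simp
qed

section \<open>Arcs and circles of a generic link\<close>

text \<open>
  The direction \<open>e\<close> is 1 or -1, so that incoming and outgoing ends of a strand can be treated together:
  the involution may exchange them.
\<close>

definition leads_to :: "curve \<Rightarrow> real \<Rightarrow> real \<Rightarrow> arc \<Rightarrow> bool" where
  "leads_to \<gamma> t e A \<longleftrightarrow> (\<exists>\<epsilon>>0. \<forall>u. 0 < u \<and> u < \<epsilon> \<longrightarrow> fst (\<gamma> (t + e * u)) \<in> A)"

definition end_arc :: "curve set \<Rightarrow> point \<Rightarrow> real \<Rightarrow> arc" where
  "end_arc \<Gamma> x e = (THE A. A \<in> arcs \<Gamma> \<and> (\<exists>\<gamma>\<in>\<Gamma>. \<exists>t. \<gamma> t = x \<and> leads_to \<gamma> t e A))"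

lemma eventually_at_left_iff:
  fixes t :: real
  shows "(\<forall>\<^sub>F s in at_left t. P s) \<longleftrightarrow> (\<exists>\<epsilon>>0. \<forall>u. 0 < u \<and> u < \<epsilon> \<longrightarrow> P (t - u))"
proof
  assume "\<forall>\<^sub>F s in at_left t. P s"
  then obtain b where "b < t" "\<forall>y>b. y < t \<longrightarrow> P y"
    using eventually_at_left[of "t - 1" t P] by auto
  then show "\<exists>\<epsilon>>0. \<forall>u. 0 < u \<and> u < \<epsilon> \<longrightarrow> P (t - u)" by (intro exI[of _ "t - b"]) auto
next
  assume "\<exists>\<epsilon>>0. \<forall>u. 0 < u \<and> u < \<epsilon> \<longrightarrow> P (t - u)"
  then obtain \<epsilon> where \<epsilon>: "\<epsilon> > 0" "\<And>u. 0 < u \<Longrightarrow> u < \<epsilon> \<Longrightarrow> P (t - u)" by blast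
  have "P y" if "t - \<epsilon> < y" "y < t" for y using \<epsilon>(2)[of "t - y"] that by simp
  then show "\<forall>\<^sub>F s in at_left t. P s"
    using \<epsilon>(1) by (intro iffD2[OF eventually_at_left[of "t - 1"]]) (auto intro!: exI[of _ "t - \<epsilon>"])
qed

lemma eventually_at_right_iff:
  fixes t :: real
  shows "(\<forall>\<^sub>F s in at_right t. P s) \<longleftrightarrow> (\<exists>\<epsilon>>0. \<forall>u. 0 < u \<and> u < \<epsilon> \<longrightarrow> P (t + u))"
proof
  assume "\<forall>\<^sub>F s in at_right t. P s"
  then obtain b where "b > t" "\<forall>y>t. y < b \<longrightarrow> P y"
    using eventually_at_right[of t "t + 1" P] by auto
  then show "\<exists>\<epsilon>>0. \<forall>u. 0 < u \<and> u < \<epsilon> \<longrightarrow> P (t + u)" by (intro exI[of _ "b - t"]) auto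
next
  assume "\<exists>\<epsilon>>0. \<forall>u. 0 < u \<and> u < \<epsilon> \<longrightarrow> P (t + u)"
  then obtain \<epsilon> where \<epsilon>: "\<epsilon> > 0" "\<And>u. 0 < u \<Longrightarrow> u < \<epsilon> \<Longrightarrow> P (t + u)" by blast
  have "P y" if "y < t + \<epsilon>" "t < y" for y using \<epsilon>(2)[of "y - t"] that by simp
  then show "\<forall>\<^sub>F s in at_right t. P s"
    using \<epsilon>(1) by (intro iffD2[OF eventually_at_right[of t "t + 1"]]) (auto intro!: exI[of _ "t + \<epsilon>"])
qed

lemma arc_in_eq: "arc_in \<Gamma> x = end_arc \<Gamma> x (-1)"
  by (simp add: arc_in_def end_arc_def leads_to_def eventually_at_left_iff)

lemma arc_out_eq: "arc_out \<Gamma> x = end_arc \<Gamma> x 1"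
  by (simp add: arc_out_def end_arc_def leads_to_def eventually_at_right_iff)

locale generic_link =
  fixes \<Gamma> :: "curve set"
  assumes link: "oriented_link \<Gamma>" and generic: "generic_projection \<Gamma>"
begin

lemma closed: "\<gamma> \<in> \<Gamma> \<Longrightarrow> closed_curve \<gamma>"
  using link by (simp add: oriented_link_def)

lemma curve_eq_iff: "\<gamma> \<in> \<Gamma> \<Longrightarrow> \<gamma> s = \<gamma> t \<longleftrightarrow> s - t \<in> \<int>"
  using closed by (simp add: closed_curve_def)

lemma curves_meet: "\<gamma> \<in> \<Gamma> \<Longrightarrow> \<delta> \<in> \<Gamma> \<Longrightarrow> \<gamma> s = \<delta> t \<Longrightarrow> \<gamma> = \<delta>"
  using link unfolding oriented_link_def by blast

lemma curve_periodic: "\<gamma> \<in> \<Gamma> \<Longrightarrow> k \<in> \<int> \<Longrightarrow> \<gamma> (t + k) = \<gamma> t"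
  by (simp add: curve_eq_iff)

lemma curve_has_derivative:
  "\<gamma> \<in> \<Gamma> \<Longrightarrow> (\<gamma> has_vector_derivative vector_derivative \<gamma> (at t)) (at t)"
  using closed[of \<gamma>]
  by (simp add: closed_curve_def C1_differentiable_on_eq vector_derivative_works)

lemma curve_derivative_nonzero: "\<gamma> \<in> \<Gamma> \<Longrightarrow> vector_derivative \<gamma> (at t) \<noteq> 0"
  using closed by (simp add: closed_curve_def)

lemma curve_continuous: "\<gamma> \<in> \<Gamma> \<Longrightarrow> continuous_on S \<gamma>"
  by (intro continuous_at_imp_continuous_on ballI has_vector_derivative_continuous[OF curve_has_derivative])

lemma link_setE:
  assumes "x \<in> link_set \<Gamma>"
  obtains \<gamma> t where "\<gamma> \<in> \<Gamma>" "x = \<gamma> t"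
  using assms by (auto simp: link_set_def)

lemma link_setI: "\<gamma> \<in> \<Gamma> \<Longrightarrow> \<gamma> t \<in> link_set \<Gamma>"
  by (auto simp: link_set_def)

text \<open>
  Curves have period 1, so every point of a curve has a parameter in any given interval of length 1.
\<close>

lemma curve_in_window:
  assumes "\<gamma> \<in> \<Gamma>"
  obtains h where "a \<le> h" "h \<le> a + 1" "\<gamma> h = \<gamma> t"
proof
  show "\<gamma> (t - of_int \<lfloor>t - a\<rfloor>) = \<gamma> t" using assms by (simp add: curve_eq_iff)
qed linarith+

lemma tangent_eq:
  assumes "\<gamma> \<in> \<Gamma>"
  shows "tangent \<Gamma> (\<gamma> t) = vector_derivative \<gamma> (at t)"
  unfolding tangent_def
proof (rule the_equality)
  fix v assume "\<exists>\<delta>\<in>\<Gamma>. \<exists>s. \<delta> s = \<gamma> t \<and> v = vector_derivative \<delta> (at s)"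
  then obtain \<delta> s where \<delta>: "\<delta> \<in> \<Gamma>" "\<delta> s = \<gamma> t" "v = vector_derivative \<delta> (at s)" by blast
  then have [simp]: "\<delta> = \<gamma>" using curves_meet assms by blast
  have st: "s - t \<in> \<int>" using \<delta> curve_eq_iff[OF assms] by simp
  have "(\<gamma> \<circ> (\<lambda>u. u + (s - t)) has_vector_derivative 1 *\<^sub>R vector_derivative \<gamma> (at s)) (at t)"
    by (rule vector_diff_chain_at)
      (use curve_has_derivative[OF assms, of s] in \<open>auto intro!: derivative_eq_intros\<close>)
  moreover have "\<gamma> \<circ> (\<lambda>u. u + (s - t)) = \<gamma>"
    using curve_periodic[OF assms st] by (auto simp: fun_eq_iff)
  ultimately show "v = vector_derivative \<gamma> (at t)"
    using \<delta>(3) by (simp add: vector_derivative_at)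
qed (use assms in blast)

text \<open>
  There are two points of the link above each crossing, and the parameters of a point differ by integers.
\<close>

lemma finite_crossing_times:
  assumes "\<gamma> \<in> \<Gamma>"
  shows "finite {t \<in> {a..b}. fst (\<gamma> t) \<in> crossings \<Gamma>}"
proof -
  let ?L = "\<lambda>p. {x \<in> link_set \<Gamma>. fst x = p}"
  have fin: "finite {t \<in> {a..b}. \<gamma> t = x}" for x
  proof (cases "\<exists>t0. \<gamma> t0 = x")
    case True
    then obtain t0 where t0: "\<gamma> t0 = x" by blast
    have "{t \<in> {a..b}. \<gamma> t = x} \<subseteq> (\<lambda>k. k + t0) ` {k \<in> \<int>. a - t0 \<le> k \<and> k \<le> b - t0}"
    proof
      fix t assume "t \<in> {t \<in> {a..b}. \<gamma> t = x}"
      then have "t - t0 \<in> {k \<in> \<int>. a - t0 \<le> k \<and> k \<le> b - t0}"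
        using t0 curve_eq_iff[OF assms, of t t0] by auto
      then show "t \<in> (\<lambda>k. k + t0) ` {k \<in> \<int>. a - t0 \<le> k \<and> k \<le> b - t0}"
        by (intro image_eqI[of _ _ "t - t0"]) simp_all
    qed
    then show ?thesis by (rule finite_subset) (intro finite_imageI finite_int_segment)
  qed simp
  have "finite (?L p)" if "p \<in> crossings \<Gamma>" for p
    using generic that by (intro card_ge_0_finite) (simp add: generic_projection_def)
  moreover have "finite (crossings \<Gamma>)" using generic by (simp add: generic_projection_def)
  ultimately have "finite (\<Union>p\<in>crossings \<Gamma>. \<Union>x\<in>?L p. {t \<in> {a..b}. \<gamma> t = x})"
    using fin by (intro finite_UN_I)
  moreover have "{t \<in> {a..b}. fst (\<gamma> t) \<in> crossings \<Gamma>} \<subseteq>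
      (\<Union>p\<in>crossings \<Gamma>. \<Union>x\<in>?L p. {t \<in> {a..b}. \<gamma> t = x})"
    using link_setI[OF assms] by auto
  ultimately show ?thesis by (rule finite_subset[rotated])
qed

lemma connected_strand: "\<gamma> \<in> \<Gamma> \<Longrightarrow> connected C \<Longrightarrow> connected ((\<lambda>t. fst (\<gamma> t)) ` C)"
  by (intro connected_continuous_image continuous_on_fst curve_continuous)

text \<open>
  Removing the finitely many crossing parameters from \<open>{0..1}\<close> leaves finitely many intervals.  Their
  images are connected and cover the shadow without the crossings.
\<close>

lemma finite_arcs: "finite (arcs \<Gamma>)"
proof -
  have "\<forall>\<gamma>\<in>\<Gamma>. \<exists>\<C>. finite \<C> \<and> (\<forall>C\<in>\<C>. connected C) \<and>
      \<Union>\<C> = {0..1} - {t \<in> {0..1}. fst (\<gamma> t) \<in> crossings \<Gamma>}"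
    using interval_minus_finite[OF finite_crossing_times] by simp
  from bchoice[OF this] obtain \<C> where
    "\<forall>\<gamma>\<in>\<Gamma>. finite (\<C> \<gamma>) \<and> (\<forall>C\<in>\<C> \<gamma>. connected C) \<and>
      \<Union>(\<C> \<gamma>) = {0..1} - {t \<in> {0..1}. fst (\<gamma> t) \<in> crossings \<Gamma>}" by (rule exE)
  then have \<C>: "\<And>\<gamma>. \<gamma> \<in> \<Gamma> \<Longrightarrow> finite (\<C> \<gamma>)"
    "\<And>\<gamma> C. \<gamma> \<in> \<Gamma> \<Longrightarrow> C \<in> \<C> \<gamma> \<Longrightarrow> connected C"
    "\<And>\<gamma>. \<gamma> \<in> \<Gamma> \<Longrightarrow> \<Union>(\<C> \<gamma>) = {0..1} - {t \<in> {0..1}. fst (\<gamma> t) \<in> crossings \<Gamma>}"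
    by simp_all
  define \<D> where "\<D> = (\<Union>\<gamma>\<in>\<Gamma>. (\<lambda>C. (\<lambda>t. fst (\<gamma> t)) ` C) ` \<C> \<gamma>)"
  have "finite \<Gamma>" using link by (simp add: oriented_link_def)
  then have "finite \<D>" unfolding \<D>_def using \<C>(1) by blast
  moreover have "connected D" if "D \<in> \<D>" for D
    using that \<C>(2) connected_strand by (auto simp: \<D>_def)
  moreover have "\<Union>\<D> = shadow \<Gamma> - crossings \<Gamma>"
  proof (intro equalityI subsetI)
    fix p assume "p \<in> \<Union>\<D>"
    then obtain \<gamma> t where "\<gamma> \<in> \<Gamma>" "t \<in> \<Union>(\<C> \<gamma>)" "p = fst (\<gamma> t)" by (auto simp: \<D>_def)
    then show "p \<in> shadow \<Gamma> - crossings \<Gamma>"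
      using \<C>(3) link_setI by (auto simp: shadow_def)
  next
    fix p assume p: "p \<in> shadow \<Gamma> - crossings \<Gamma>"
    then obtain \<gamma> t where \<gamma>: "\<gamma> \<in> \<Gamma>" "p = fst (\<gamma> t)" by (auto simp: shadow_def elim: link_setE)
    then obtain h where "0 \<le> h" "h \<le> 0 + 1" "\<gamma> h = \<gamma> t" using curve_in_window by blast
    then have "p = fst (\<gamma> h)" "h \<in> \<Union>(\<C> \<gamma>)" using p \<gamma> \<C>(3) by auto
    then show "p \<in> \<Union>\<D>" using \<gamma>(1) unfolding \<D>_def by blast
  qed
  ultimately show ?thesis unfolding arcs_def by (rule finite_components_cover)
qed

lemma arcs_meet: "A \<in> arcs \<Gamma> \<Longrightarrow> A' \<in> arcs \<Gamma> \<Longrightarrow> p \<in> A \<Longrightarrow> p \<in> A' \<Longrightarrow> A = A'"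
  unfolding arcs_def using components_nonoverlap by blast

lemma arc_through:
  assumes "x \<in> link_set \<Gamma>" "fst x \<notin> crossings \<Gamma>"
  obtains A where "A \<in> arcs \<Gamma>" "fst x \<in> A"
proof -
  have "fst x \<in> shadow \<Gamma> - crossings \<Gamma>" using assms by (auto simp: shadow_def)
  then show ?thesis using that unfolding arcs_def by (metis Union_components UnionE)
qed

text \<open>
  Crossing parameters are isolated, so a short piece of the strand on one side of \<open>t\<close> avoids the
  crossings, and being connected it stays in one arc.
\<close>

lemma leads_to_arc:
  assumes \<gamma>: "\<gamma> \<in> \<Gamma>" and e: "e = 1 \<or> e = -1"
  shows "\<exists>A\<in>arcs \<Gamma>. leads_to \<gamma> t e A"
proof -
  define T where "T = {s \<in> {t - 1..t + 1}. fst (\<gamma> s) \<in> crossings \<Gamma>} - {t}"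
  have "finite T" unfolding T_def using finite_crossing_times[OF \<gamma>] by blast
  moreover have "t \<notin> T" by (simp add: T_def)
  ultimately obtain \<epsilon> where \<epsilon>: "\<epsilon> > 0" "\<And>s. s \<in> T \<Longrightarrow> \<epsilon> \<le> dist t s"
    using finite_set_avoid[of T t] by metis
  define r where "r = min \<epsilon> 1"
  have r: "r > 0" "r \<le> \<epsilon>" "r \<le> 1" using \<epsilon>(1) by (auto simp: r_def)
  define C where "C = (\<lambda>u. fst (\<gamma> (t + e * u))) ` {0<..<r}"
  have "C = (\<lambda>s. fst (\<gamma> s)) ` (\<lambda>u. t + e * u) ` {0<..<r}" by (simp add: C_def image_image)
  moreover have "connected ((\<lambda>u. t + e * u) ` {0<..<r})"
    by (intro connected_continuous_image continuous_intros connected_Ioo)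
  ultimately have "connected C" using connected_strand[OF \<gamma>] by simp
  moreover have "C \<subseteq> shadow \<Gamma> - crossings \<Gamma>"
  proof
    fix p assume "p \<in> C"
    then obtain u where u: "0 < u" "u < r" "p = fst (\<gamma> (t + e * u))" by (auto simp: C_def)
    have d: "dist t (t + e * u) = u" using e u by (auto simp: dist_real_def)
    have "t + e * u \<notin> T" using \<epsilon>(2) d u r by force
    moreover have "t + e * u \<in> {t - 1..t + 1}" "t + e * u \<noteq> t" using e u r by auto
    ultimately have "p \<notin> crossings \<Gamma>" using u by (simp add: T_def)
    moreover have "p \<in> shadow \<Gamma>" using u link_setI[OF \<gamma>] by (auto simp: shadow_def)
    ultimately show "p \<in> shadow \<Gamma> - crossings \<Gamma>" by simp
  qed
  moreover have "C \<noteq> {}" using r by (simp add: C_def)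
  ultimately obtain A where A: "A \<in> arcs \<Gamma>" "C \<subseteq> A"
    unfolding arcs_def by (metis exists_component_superset Diff_empty subset_empty)
  have "fst (\<gamma> (t + e * u)) \<in> A" if "0 < u" "u < r" for u
    using A(2) that by (auto simp: C_def)
  then show ?thesis using A(1) r(1) unfolding leads_to_def by blast
qed

lemma leads_to_unique:
  assumes "\<gamma> \<in> \<Gamma>" "\<delta> \<in> \<Gamma>" "\<gamma> t = \<delta> s" "leads_to \<gamma> t e A" "leads_to \<delta> s e A'"
    "A \<in> arcs \<Gamma>" "A' \<in> arcs \<Gamma>"
  shows "A = A'"
proof -
  have [simp]: "\<delta> = \<gamma>" using assms curves_meet by metis
  have "s - t \<in> \<int>" using assms(1,3) curve_eq_iff[of \<gamma> s t] by simp
  obtain \<epsilon> where \<epsilon>: "\<epsilon> > 0" "\<And>u. 0 < u \<Longrightarrow> u < \<epsilon> \<Longrightarrow> fst (\<gamma> (t + e * u)) \<in> A"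
    using assms(4) by (auto simp: leads_to_def)
  obtain \<epsilon>' where \<epsilon>': "\<epsilon>' > 0" "\<And>u. 0 < u \<Longrightarrow> u < \<epsilon>' \<Longrightarrow> fst (\<gamma> (s + e * u)) \<in> A'"
    using assms(5) by (auto simp: leads_to_def)
  define u where "u = min \<epsilon> \<epsilon>' / 2"
  have u: "0 < u" "u < \<epsilon>" "u < \<epsilon>'" using \<epsilon>(1) \<epsilon>'(1) by (auto simp: u_def)
  have "\<gamma> (s + e * u) = \<gamma> (t + e * u)"
    using \<open>s - t \<in> \<int>\<close> assms(1) by (simp add: curve_eq_iff)
  then show ?thesis using \<epsilon>(2) \<epsilon>'(2) u arcs_meet assms(6,7) by metis
qed

lemma end_arc_eq:
  assumes "\<gamma> \<in> \<Gamma>" "A \<in> arcs \<Gamma>" "leads_to \<gamma> t e A"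
  shows "end_arc \<Gamma> (\<gamma> t) e = A"
  unfolding end_arc_def
proof (rule the_equality)
  fix A' assume "A' \<in> arcs \<Gamma> \<and> (\<exists>\<delta>\<in>\<Gamma>. \<exists>s. \<delta> s = \<gamma> t \<and> leads_to \<delta> s e A')"
  then show "A' = A" using leads_to_unique assms by metis
qed (use assms in blast)

lemma end_arc_mem:
  assumes "x \<in> link_set \<Gamma>" "e = 1 \<or> e = -1"
  shows "end_arc \<Gamma> x e \<in> arcs \<Gamma>"
proof -
  obtain \<gamma> t where "\<gamma> \<in> \<Gamma>" "x = \<gamma> t" using assms(1) by (rule link_setE)
  then show ?thesis using leads_to_arc[of \<gamma> e t] end_arc_eq assms(2) by metis
qed

lemma crossing_points:
  assumes "p \<in> crossings \<Gamma>"
  obtains a c where "a < c" "{q. (p, q) \<in> link_set \<Gamma>} = {a, c}"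
    "upper_point \<Gamma> p = (p, c)" "lower_point \<Gamma> p = (p, a)"
proof -
  have "card {x \<in> link_set \<Gamma>. fst x = p} = 2"
    using generic assms by (simp add: generic_projection_def)
  moreover have "{x \<in> link_set \<Gamma>. fst x = p} = Pair p ` {q. (p, q) \<in> link_set \<Gamma>}" by force
  ultimately have "card {q. (p, q) \<in> link_set \<Gamma>} = 2" by (simp add: card_image inj_on_def)
  then obtain x y where "{q. (p, q) \<in> link_set \<Gamma>} = {x, y}" "x \<noteq> y" by (meson card_2_iff)
  then obtain a c where ac: "{q. (p, q) \<in> link_set \<Gamma>} = {a, c}" "a < c"
    by (metis insert_commute neq_iff)
  then have "upper_point \<Gamma> p = (p, c)" "lower_point \<Gamma> p = (p, a)"
    by (simp_all add: upper_point_def lower_point_def)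
  with ac show thesis using that by blast
qed

lemma upper_mem: "p \<in> crossings \<Gamma> \<Longrightarrow> upper_point \<Gamma> p \<in> link_set \<Gamma>"
  by (erule crossing_points) auto

lemma lower_mem: "p \<in> crossings \<Gamma> \<Longrightarrow> lower_point \<Gamma> p \<in> link_set \<Gamma>"
  by (erule crossing_points) auto

definition joined :: "smoothing \<Rightarrow> (arc \<times> arc) set" where
  "joined s = (\<Union>p\<in>crossings \<Gamma>. joins \<Gamma> s p \<union> (joins \<Gamma> s p)\<inverse>)"

lemma circles_eq: "circles \<Gamma> s = (\<lambda>A. (joined s)\<^sup>* `` {A}) ` arcs \<Gamma>"
  by (auto simp: circles_def joined_def quotient_def)

lemma finite_circles: "finite (circles \<Gamma> s)"
  by (simp add: circles_eq finite_arcs)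

lemma sym_joined: "sym ((joined s)\<^sup>*)"
  by (intro sym_rtrancl) (auto simp: joined_def sym_def)

lemma joined_arcs: "joined s \<subseteq> arcs \<Gamma> \<times> arcs \<Gamma>"
  using upper_mem lower_mem
  by (auto simp: joined_def joins_def Let_def arc_in_eq arc_out_eq intro!: end_arc_mem split: if_splits)

lemma joined_rtrancl_arcs:
  assumes "A \<in> arcs \<Gamma>" "(A, A') \<in> (joined s)\<^sup>*"
  shows "A' \<in> arcs \<Gamma>"
  using assms(2,1) joined_arcs by (induction rule: rtrancl_induct) auto

text \<open>
  The arcs of a circle are equivalent under the joins, and \<open>A\<close> is the only arc that contains \<open>p\<close>.
\<close>

lemma circle_through:
  assumes A: "A \<in> arcs \<Gamma>" "p \<in> A" and C: "C \<in> circles \<Gamma> s"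
  shows "p \<in> \<Union>C \<longleftrightarrow> C = (joined s)\<^sup>* `` {A}"
proof
  assume "p \<in> \<Union>C"
  obtain A0 where A0: "A0 \<in> arcs \<Gamma>" "C = (joined s)\<^sup>* `` {A0}" using C by (auto simp: circles_eq)
  then obtain A' where "p \<in> A'" "(A0, A') \<in> (joined s)\<^sup>*" using \<open>p \<in> \<Union>C\<close> by auto
  moreover from this have "A' = A" using arcs_meet joined_rtrancl_arcs A0 A by blast
  ultimately have "(A0, A) \<in> (joined s)\<^sup>*" by simp
  moreover from this have "(A, A0) \<in> (joined s)\<^sup>*" using sym_joined by (rule symD[rotated])
  ultimately show "C = (joined s)\<^sup>* `` {A}" unfolding A0(2) by (auto intro: rtrancl_trans)
qed (use A in auto)

end

section \<open>The involution on arcs and circles\<close>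

locale generic_involutive_link = generic_link +
  fixes n :: "real^3"
  assumes norm_n: "norm n = 1" and involutive: "tau n ` link_set \<Gamma> = link_set \<Gamma>"
begin

lemma tau_mem: "x \<in> link_set \<Gamma> \<Longrightarrow> tau n x \<in> link_set \<Gamma>"
  using involutive by blast

lemma tau_continuous: "isCont (tau n) x"
  using tau_linear by (simp add: linear_continuous_at linear_conv_bounded_linear)

lemma tau_inj: "tau n x = tau n y \<Longrightarrow> x = y"
  using tau_tau[OF norm_n] by metis

lemma eventually_avoids:
  assumes "\<gamma> \<in> \<Gamma>" "compact C" "tau n (\<gamma> t) \<notin> C"
  shows "\<forall>\<^sub>F s in at t. tau n (\<gamma> s) \<notin> C"
proof -
  have "isCont \<gamma> t"
    using curve_continuous[OF assms(1), of UNIV] by (simp add: continuous_on_eq_continuous_at)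
  then have "isCont (\<lambda>s. tau n (\<gamma> s)) t" by (rule isCont_o2) (rule tau_continuous)
  then have "((\<lambda>s. tau n (\<gamma> s)) \<longlongrightarrow> tau n (\<gamma> t)) (at t)" by (simp add: isCont_def)
  moreover have "open (- C)" using assms(2) by (simp add: compact_imp_closed open_Compl)
  ultimately show ?thesis using topological_tendstoD[of _ "tau n (\<gamma> t)" "at t" "- C"] assms(3) by simp
qed

text \<open>
  Near \<open>\<delta> u\<close> the link consists of a short piece of \<open>\<delta>\<close> around the parameter \<open>u\<close>: the other components and
  the rest of \<open>\<delta>\<close> are compact and miss \<open>\<delta> u\<close>.  So \<open>tau n \<circ> \<gamma>\<close> can be lifted to the parameters
  of \<open>\<delta>\<close>.  The limit \<open>at u\<close> includes that the lift takes the value \<open>u\<close> near \<open>t\<close> only at \<open>t\<close>, so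
  that difference quotients can be formed.
\<close>

lemma tau_strand:
  assumes \<gamma>: "\<gamma> \<in> \<Gamma>" and \<delta>: "\<delta> \<in> \<Gamma>" and meet: "tau n (\<gamma> t) = \<delta> u"
  obtains h where "\<forall>\<^sub>F s in at t. \<delta> (h s) = tau n (\<gamma> s)" "filterlim h (at u) (at t)"
proof -
  define P where "P s h \<longleftrightarrow> \<bar>h - u\<bar> \<le> 1/2 \<and> \<delta> h = tau n (\<gamma> s)" for s h
  define h where "h s = (SOME h. P s h)" for s
  let ?C = "\<Union>\<gamma>'\<in>\<Gamma> - {\<delta>}. \<gamma>' ` {0..1}"
  have "\<forall>\<^sub>F s in at t. tau n (\<gamma> s) \<notin> ?C"
  proof (rule eventually_avoids[OF \<gamma>])
    show "compact ?C"
      using link by (intro compact_UN compact_continuous_image curve_continuous)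
        (auto simp: oriented_link_def)
    show "tau n (\<gamma> t) \<notin> ?C" using \<delta> meet curves_meet by fastforce
  qed
  then have P: "\<forall>\<^sub>F s in at t. P s (h s)"
  proof (rule eventually_mono)
    fix s assume s: "tau n (\<gamma> s) \<notin> ?C"
    obtain \<gamma>' v where \<gamma>': "\<gamma>' \<in> \<Gamma>" "tau n (\<gamma> s) = \<gamma>' v"
      using tau_mem[OF link_setI[OF \<gamma>]] by (rule link_setE)
    obtain w where w: "0 \<le> w" "w \<le> 0 + 1" "\<gamma>' w = \<gamma>' v" using \<gamma>'(1) by (rule curve_in_window)
    have "\<gamma>' = \<delta>"
    proof (rule ccontr)
      assume "\<gamma>' \<noteq> \<delta>"
      then have "\<gamma>' w \<in> ?C" using \<gamma>'(1) w by (intro UN_I[of \<gamma>'] imageI) auto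
      then show False using s w \<gamma>' by simp
    qed
    obtain x where "u - 1/2 \<le> x" "x \<le> u - 1/2 + 1" "\<gamma>' x = \<gamma>' v" using \<gamma>'(1) by (rule curve_in_window)
    then have "\<bar>x - u\<bar> \<le> 1/2" "\<delta> x = tau n (\<gamma> s)" using \<gamma>' \<open>\<gamma>' = \<delta>\<close> by (auto simp: abs_if)
    then have "P s x" by (simp add: P_def)
    then show "P s (h s)" unfolding h_def by (rule someI)
  qed
  have ne: "h s \<noteq> u" if "P s (h s)" "s \<noteq> t" "dist s t < 1" for s
  proof
    assume "h s = u"
    then have "\<gamma> s = \<gamma> t" using that meet tau_inj by (simp add: P_def)
    then have "s - t \<in> \<int>" using curve_eq_iff[OF \<gamma>] by simp
    then show False using that Ints_nonzero_abs_less1[of "s - t"] by (simp add: dist_real_def)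
  qed
  have "\<forall>\<^sub>F s in at t. s \<noteq> t \<and> dist s t < 1"
    by (auto simp: eventually_at intro: exI[of _ 1])
  with P have "\<forall>\<^sub>F s in at t. h s \<noteq> u"
    by (rule eventually_elim2) (use ne in blast)
  moreover have "(h \<longlongrightarrow> u) (at t)"
  proof (rule tendstoI)
    fix \<epsilon> :: real assume "0 < \<epsilon>"
    let ?C = "\<delta> ` ({u - 1/2..u + 1/2} - {u - \<epsilon><..<u + \<epsilon>})"
    have "\<forall>\<^sub>F s in at t. tau n (\<gamma> s) \<notin> ?C"
    proof (rule eventually_avoids[OF \<gamma>])
      show "compact ?C"
        by (intro compact_continuous_image curve_continuous[OF \<delta>] compact_diff) auto
      show "tau n (\<gamma> t) \<notin> ?C"
      proof
        assume "tau n (\<gamma> t) \<in> ?C"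
        then obtain v where v: "\<delta> u = \<delta> v" "v \<in> {u - 1/2..u + 1/2}" "\<not> (u - \<epsilon> < v \<and> v < u + \<epsilon>)"
          using meet by auto
        then have "u - v \<in> \<int>" using curve_eq_iff[OF \<delta>] by simp
        then have "u - v = 0" using v(2) by (intro Ints_nonzero_abs_less1) (auto simp: abs_if)
        then show False using v(3) \<open>0 < \<epsilon>\<close> by simp
      qed
    qed
    with P show "\<forall>\<^sub>F s in at t. dist (h s) u < \<epsilon>"
    proof (rule eventually_elim2)
      fix s assume s: "P s (h s)" "tau n (\<gamma> s) \<notin> ?C"
      then have "h s \<notin> {u - 1/2..u + 1/2} - {u - \<epsilon><..<u + \<epsilon>}"
        using imageI[of "h s" _ \<delta>] unfolding P_def by metis
      moreover have "\<bar>h s - u\<bar> \<le> 1/2" using s(1) by (simp add: P_def)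
      ultimately show "dist (h s) u < \<epsilon>" by (auto simp: dist_real_def abs_if split: if_splits)
    qed
  qed
  ultimately have "filterlim h (at u) (at t)" by (simp add: filterlim_at)
  moreover have "\<forall>\<^sub>F s in at t. \<delta> (h s) = tau n (\<gamma> s)"
    using P by (rule eventually_mono) (simp add: P_def)
  ultimately show thesis using that by blast
qed

lemma inner_difference_quotient:
  assumes "(f has_vector_derivative D) (at t)"
  shows "((\<lambda>s. (f s \<bullet> z - f t \<bullet> z) / (s - t)) \<longlongrightarrow> D \<bullet> z) (at t)"
proof -
  have "((\<lambda>s. f s \<bullet> z) has_vector_derivative D \<bullet> z) (at t)"
    using assms by (rule bounded_linear.has_vector_derivative[OF bounded_linear_inner_left])
  then show ?thesis
    by (simp add: has_field_derivative_iff flip: has_real_derivative_iff_has_vector_derivative)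
qed

text \<open>
  The number \<open>r\<close> is the derivative at \<open>t\<close> of the lift \<open>h\<close> of \<open>tau n \<circ> \<gamma>\<close> to the parameters of \<open>\<delta>\<close>.  Its
  existence is not clear beforehand; it is the quotient of the derivatives of \<open>tau n \<circ> \<gamma>\<close> and \<open>\<delta>\<close>
  in the direction of the tangent \<open>w\<close> of \<open>\<delta>\<close>.  The last conclusion says that \<open>h\<close> increases at \<open>t\<close>
  if \<open>r > 0\<close> and decreases if \<open>r < 0\<close>.
\<close>

lemma tau_tangent:
  assumes \<gamma>: "\<gamma> \<in> \<Gamma>" and \<delta>: "\<delta> \<in> \<Gamma>" and meet: "tau n (\<gamma> t) = \<delta> u"
  obtains r where "r \<noteq> 0" "tau n (vector_derivative \<gamma> (at t)) = r *\<^sub>R vector_derivative \<delta> (at u)"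
    "\<And>e \<epsilon>. e = 1 \<or> e = -1 \<Longrightarrow> 0 < \<epsilon> \<Longrightarrow>
       \<exists>\<eta>>0. \<forall>v. 0 < v \<and> v < \<eta> \<longrightarrow>
         (\<exists>w. 0 < w \<and> w < \<epsilon> \<and> tau n (\<gamma> (t + e * v)) = \<delta> (u + sgn r * e * w))"
proof -
  obtain h where h: "\<forall>\<^sub>F s in at t. \<delta> (h s) = tau n (\<gamma> s)" "filterlim h (at u) (at t)"
    using tau_strand[OF \<gamma> \<delta> meet] .
  define v where "v = tau n (vector_derivative \<gamma> (at t))"
  define w where "w = vector_derivative \<delta> (at u)"
  define q where "q s = (h s - u) / (s - t)" for s
  have w: "w \<noteq> 0" unfolding w_def by (rule curve_derivative_nonzero[OF \<delta>])
  have v: "v \<noteq> 0"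
    using curve_derivative_nonzero[OF \<gamma>, of t] tau_inj[of _ 0] linear_0[OF tau_linear]
    unfolding v_def by metis
  let ?F = "\<lambda>z s. (tau n (\<gamma> s) \<bullet> z - tau n (\<gamma> t) \<bullet> z) / (s - t)"
  let ?G = "\<lambda>z s. (\<delta> (h s) \<bullet> z - \<delta> u \<bullet> z) / (h s - u)"
  have "bounded_linear (tau n)" using tau_linear by (simp add: linear_conv_bounded_linear)
  then have "((\<lambda>s. tau n (\<gamma> s)) has_vector_derivative v) (at t)"
    unfolding v_def by (rule bounded_linear.has_vector_derivative) (rule curve_has_derivative[OF \<gamma>])
  then have F: "(?F z \<longlongrightarrow> v \<bullet> z) (at t)" for z by (rule inner_difference_quotient)
  have G: "(?G z \<longlongrightarrow> w \<bullet> z) (at t)" for z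
    using filterlim_compose[OF inner_difference_quotient[OF curve_has_derivative[OF \<delta>]] h(2)]
    by (simp add: w_def)
  have hu: "\<forall>\<^sub>F s in at t. h s \<noteq> u" using h(2) by (simp add: filterlim_at)
  have FG: "\<forall>\<^sub>F s in at t. ?F z s = q s * ?G z s" for z
    using h(1) hu by (rule eventually_elim2) (simp add: q_def meet)
  define r where "r = (v \<bullet> w) / (w \<bullet> w)"
  have "((\<lambda>s. ?F w s / ?G w s) \<longlongrightarrow> r) (at t)"
    unfolding r_def using w by (intro tendsto_divide F G) simp
  moreover have "\<forall>\<^sub>F s in at t. ?F w s / ?G w s = q s"
  proof -
    have "\<forall>\<^sub>F s in at t. ?G w s \<noteq> 0"
      using w by (intro tendsto_imp_eventually_ne[OF G]) simp
    with FG[of w] show ?thesis by (rule eventually_elim2) simp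
  qed
  ultimately have q: "(q \<longlongrightarrow> r) (at t)" by (rule Lim_transform_eventually)
  have "v \<bullet> z = r *\<^sub>R w \<bullet> z" for z
  proof -
    have "((\<lambda>s. q s * ?G z s) \<longlongrightarrow> r * (w \<bullet> z)) (at t)" by (intro tendsto_mult q G)
    moreover have "((\<lambda>s. q s * ?G z s) \<longlongrightarrow> v \<bullet> z) (at t)"
      using F FG by (rule Lim_transform_eventually)
    ultimately show ?thesis using tendsto_unique[OF trivial_limit_at] by fastforce
  qed
  then have vr: "v = r *\<^sub>R w" using vector_eq_rdot by blast
  then have r: "r \<noteq> 0" using v by auto
  have "((\<lambda>s. q s * r) \<longlongrightarrow> r * r) (at t)" by (intro tendsto_mult q tendsto_const)
  moreover have "r * r > 0" using r by (simp add: zero_less_mult_iff neq_iff) linarith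
  ultimately have sgn: "\<forall>\<^sub>F s in at t. q s * r > 0" by (rule order_tendstoD(1))
  show thesis
  proof (rule that[OF r])
    show "tau n (vector_derivative \<gamma> (at t)) = r *\<^sub>R vector_derivative \<delta> (at u)"
      using vr by (simp add: v_def w_def)
    fix e \<epsilon> :: real assume e: "e = 1 \<or> e = -1" and \<epsilon>: "0 < \<epsilon>"
    have "(h \<longlongrightarrow> u) (at t)" using h(2) by (simp add: filterlim_at)
    then have "\<forall>\<^sub>F s in at t. dist (h s) u < \<epsilon>" using \<epsilon> by (rule tendstoD)
    with h(1) sgn have "\<forall>\<^sub>F s in at t. \<delta> (h s) = tau n (\<gamma> s) \<and> q s * r > 0 \<and> dist (h s) u < \<epsilon>"
      by eventually_elim simp
    then obtain \<eta> where \<eta>: "\<eta> > 0" "\<And>s. s \<noteq> t \<Longrightarrow> dist s t < \<eta> \<Longrightarrow>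
        \<delta> (h s) = tau n (\<gamma> s) \<and> q s * r > 0 \<and> dist (h s) u < \<epsilon>"
      unfolding eventually_at by blast
    have "\<exists>x. 0 < x \<and> x < \<epsilon> \<and> tau n (\<gamma> (t + e * y)) = \<delta> (u + sgn r * e * x)"
      if y: "0 < y" "y < \<eta>" for y
    proof -
      let ?s = "t + e * y"
      have s: "\<delta> (h ?s) = tau n (\<gamma> ?s)" "q ?s * r > 0" "dist (h ?s) u < \<epsilon>"
        using \<eta>(2)[of ?s] e y by (auto simp: dist_real_def)
      have "(h ?s - u) * (sgn r * e) = \<bar>h ?s - u\<bar>" "h ?s - u \<noteq> 0"
        using s(2) e y by (auto simp: q_def zero_less_mult_iff zero_less_divide_iff
            mult_less_0_iff divide_less_0_iff sgn_if abs_if)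
      moreover have "(sgn r * e) * (sgn r * e) = 1" using e r by (auto simp: sgn_if)
      ultimately have "h ?s = u + sgn r * e * \<bar>h ?s - u\<bar>"
        by (metis add.commute diff_add_cancel mult.commute mult.left_commute mult.right_neutral)
      then show ?thesis
        using s \<open>h ?s - u \<noteq> 0\<close> by (intro exI[of _ "\<bar>h ?s - u\<bar>"]) (simp add: dist_real_def)
    qed
    then show "\<exists>\<eta>>0. \<forall>v. 0 < v \<and> v < \<eta> \<longrightarrow>
         (\<exists>w. 0 < w \<and> w < \<epsilon> \<and> tau n (\<gamma> (t + e * v)) = \<delta> (u + sgn r * e * w))"
      using \<eta>(1) by blast
  qed
qed

lemma reflection_shadow:
  assumes "p \<in> shadow \<Gamma>"
  shows "reflection n p \<in> shadow \<Gamma>"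
proof -
  obtain x where "x \<in> link_set \<Gamma>" "p = fst x" using assms by (auto simp: shadow_def)
  then show ?thesis using imageI[OF tau_mem, of x fst] by (simp add: shadow_def fst_tau)
qed

lemma reflection_crossings: "p \<in> crossings \<Gamma> \<Longrightarrow> reflection n p \<in> crossings \<Gamma>"
proof -
  assume "p \<in> crossings \<Gamma>"
  then obtain x y where "x \<in> link_set \<Gamma>" "y \<in> link_set \<Gamma>" "x \<noteq> y" "fst x = p" "fst y = p"
    by (auto simp: crossings_def)
  moreover from this have "tau n x \<noteq> tau n y" using tau_inj by blast
  ultimately show ?thesis
    unfolding crossings_def using tau_mem
    by (intro CollectI bexI[of _ "tau n x"] bexI[of _ "tau n y"]) (simp_all add: fst_tau)
qed

lemma reflection_arcs:
  assumes "A \<in> arcs \<Gamma>"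
  shows "reflection n ` A \<in> arcs \<Gamma>"
  unfolding arcs_def
proof (rule components_involution_image)
  show "continuous_on UNIV (reflection n)"
    by (intro linear_continuous_on) (simp add: reflection_linear flip: linear_conv_bounded_linear)
  show "reflection n ` (shadow \<Gamma> - crossings \<Gamma>) \<subseteq> shadow \<Gamma> - crossings \<Gamma>"
    using reflection_shadow reflection_crossings reflection_reflection[OF norm_n]
    by (metis Diff_iff image_subsetI)
qed (use assms reflection_reflection[OF norm_n] in \<open>auto simp: arcs_def\<close>)

lemma tau_ends:
  assumes x: "x \<in> link_set \<Gamma>"
  obtains r where "r \<noteq> 0" "tau n (tangent \<Gamma> x) = r *\<^sub>R tangent \<Gamma> (tau n x)"
    "\<And>e. e = 1 \<or> e = -1 \<Longrightarrow> end_arc \<Gamma> (tau n x) (sgn r * e) = reflection n ` end_arc \<Gamma> x e"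
proof -
  obtain \<gamma> t where \<gamma>: "\<gamma> \<in> \<Gamma>" "x = \<gamma> t" using x by (rule link_setE)
  obtain \<delta> u where \<delta>: "\<delta> \<in> \<Gamma>" "tau n x = \<delta> u" using tau_mem[OF x] by (rule link_setE)
  obtain r where r: "r \<noteq> 0" "tau n (vector_derivative \<gamma> (at t)) = r *\<^sub>R vector_derivative \<delta> (at u)"
    "\<And>e \<epsilon>. e = 1 \<or> e = -1 \<Longrightarrow> 0 < \<epsilon> \<Longrightarrow>
       \<exists>\<eta>>0. \<forall>v. 0 < v \<and> v < \<eta> \<longrightarrow>
         (\<exists>w. 0 < w \<and> w < \<epsilon> \<and> tau n (\<gamma> (t + e * v)) = \<delta> (u + sgn r * e * w))"
    using tau_tangent[OF \<gamma>(1) \<delta>(1)] \<gamma>(2) \<delta>(2) by metis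
  show thesis
  proof (rule that[OF r(1)])
    show "tau n (tangent \<Gamma> x) = r *\<^sub>R tangent \<Gamma> (tau n x)"
      using r(2) \<gamma>(1) \<delta>(1) unfolding \<gamma>(2) \<delta>(2)[unfolded \<gamma>(2)] by (simp add: tangent_eq)
    fix e :: real assume e: "e = 1 \<or> e = -1"
    then have e': "sgn r * e = 1 \<or> sgn r * e = -1" using r(1) by (auto simp: sgn_if)
    obtain A where A: "A \<in> arcs \<Gamma>" "leads_to \<gamma> t e A" using leads_to_arc[OF \<gamma>(1) e] by blast
    obtain A' where A': "A' \<in> arcs \<Gamma>" "leads_to \<delta> u (sgn r * e) A'"
      using leads_to_arc[OF \<delta>(1) e'] by blast
    obtain \<epsilon> where \<epsilon>: "\<epsilon> > 0" "\<And>v. 0 < v \<Longrightarrow> v < \<epsilon> \<Longrightarrow> fst (\<gamma> (t + e * v)) \<in> A"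
      using A(2) by (auto simp: leads_to_def)
    obtain \<epsilon>' where \<epsilon>': "\<epsilon>' > 0" "\<And>w. 0 < w \<Longrightarrow> w < \<epsilon>' \<Longrightarrow> fst (\<delta> (u + sgn r * e * w)) \<in> A'"
      using A'(2) by (auto simp: leads_to_def)
    obtain \<eta> where \<eta>: "\<eta> > 0" "\<And>v. 0 < v \<Longrightarrow> v < \<eta> \<Longrightarrow>
        \<exists>w. 0 < w \<and> w < \<epsilon>' \<and> tau n (\<gamma> (t + e * v)) = \<delta> (u + sgn r * e * w)"
      using r(3)[OF e \<epsilon>'(1)] by blast
    define v where "v = min \<epsilon> \<eta> / 2"
    have v: "0 < v" "v < \<epsilon>" "v < \<eta>" using \<epsilon>(1) \<eta>(1) by (auto simp: v_def)
    obtain w where w: "0 < w" "w < \<epsilon>'" "tau n (\<gamma> (t + e * v)) = \<delta> (u + sgn r * e * w)"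
      using \<eta>(2)[OF v(1,3)] by blast
    have "reflection n (fst (\<gamma> (t + e * v))) \<in> A'" using \<epsilon>'(2)[OF w(1,2)] w(3) by (metis fst_tau)
    moreover have "reflection n (fst (\<gamma> (t + e * v))) \<in> reflection n ` A"
      using \<epsilon>(2)[OF v(1,2)] by (rule imageI)
    ultimately have "A' = reflection n ` A" by (intro arcs_meet A'(1) reflection_arcs A(1))
    moreover have "end_arc \<Gamma> x e = A" unfolding \<gamma>(2) using \<gamma>(1) A by (rule end_arc_eq)
    moreover have "end_arc \<Gamma> (tau n x) (sgn r * e) = A'" unfolding \<delta>(2) using \<delta>(1) A' by (rule end_arc_eq)
    ultimately show "end_arc \<Gamma> (tau n x) (sgn r * e) = reflection n ` end_arc \<Gamma> x e" by simp
  qed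
qed

text \<open>
  The involution changes the sign of the height.
\<close>

lemma upper_lower_reflection:
  assumes p: "p \<in> crossings \<Gamma>"
  shows "upper_point \<Gamma> (reflection n p) = tau n (lower_point \<Gamma> p)"
    and "lower_point \<Gamma> (reflection n p) = tau n (upper_point \<Gamma> p)"
proof -
  obtain a c where ac: "a < c" "{q. (p, q) \<in> link_set \<Gamma>} = {a, c}"
    "upper_point \<Gamma> p = (p, c)" "lower_point \<Gamma> p = (p, a)" using p by (rule crossing_points)
  have iff: "(reflection n p, q) \<in> link_set \<Gamma> \<longleftrightarrow> (p, - q) \<in> link_set \<Gamma>" for q
    using tau_mem[of "(reflection n p, q)"] tau_mem[of "(p, - q)"]
    by (auto simp: tau_def reflection_reflection[OF norm_n])
  have "{q. (reflection n p, q) \<in> link_set \<Gamma>} = {q. - q \<in> {a, c}}"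
    unfolding iff using ac(2) by blast
  also have "\<dots> = {- c, - a}" by auto
  finally show "upper_point \<Gamma> (reflection n p) = tau n (lower_point \<Gamma> p)"
    and "lower_point \<Gamma> (reflection n p) = tau n (upper_point \<Gamma> p)"
    using ac by (simp_all add: upper_point_def lower_point_def tau_def max_def min_def)
qed

text \<open>
  With \<open>\<alpha>\<close> and \<open>\<beta>\<close> the factors by which the tangents of the two strands are multiplied, the crossing
  determinant is multiplied by a number of the sign of \<open>\<alpha> * \<beta>\<close>: the reflection of the sphere and the
  exchange of the strands each contribute a factor -1.  If both strands keep or both change their
  direction, then the oriented smoothing goes to the oriented smoothing and the crossing sign is
  kept.  If exactly one strand changes its direction, then the oriented smoothing goes to the other
  one, but the crossing sign changes too.  The converse relation is included because the joins are
  stored as ordered pairs.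
\<close>

lemma joins_reflection:
  assumes p: "p \<in> crossings \<Gamma>"
  defines "r \<equiv> map_prod (image (reflection n)) (image (reflection n))"
  shows "r ` (joins \<Gamma> s p \<union> (joins \<Gamma> s p)\<inverse>) \<subseteq>
    joins \<Gamma> (reflection n ` s) (reflection n p) \<union> (joins \<Gamma> (reflection n ` s) (reflection n p))\<inverse>"
proof -
  define x where "x = upper_point \<Gamma> p"
  define y where "y = lower_point \<Gamma> p"
  obtain \<alpha> where \<alpha>: "\<alpha> \<noteq> 0" "tau n (tangent \<Gamma> x) = \<alpha> *\<^sub>R tangent \<Gamma> (tau n x)"
    "\<And>e. e = 1 \<or> e = -1 \<Longrightarrow> end_arc \<Gamma> (tau n x) (sgn \<alpha> * e) = reflection n ` end_arc \<Gamma> x e"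
    using tau_ends upper_mem[OF p] unfolding x_def by blast
  obtain \<beta> where \<beta>: "\<beta> \<noteq> 0" "tau n (tangent \<Gamma> y) = \<beta> *\<^sub>R tangent \<Gamma> (tau n y)"
    "\<And>e. e = 1 \<or> e = -1 \<Longrightarrow> end_arc \<Gamma> (tau n y) (sgn \<beta> * e) = reflection n ` end_arc \<Gamma> y e"
    using tau_ends lower_mem[OF p] unfolding y_def by blast
  have upper: "upper_point \<Gamma> (reflection n p) = tau n y"
    and lower: "lower_point \<Gamma> (reflection n p) = tau n x"
    using upper_lower_reflection[OF p] by (simp_all add: x_def y_def)
  let ?d = "\<lambda>p a c. det (vector [p, a, c] :: real^3^3)"
  have "- crossing_det \<Gamma> p =
      ?d (reflection n p) (reflection n (fst (tangent \<Gamma> x))) (reflection n (fst (tangent \<Gamma> y)))"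
    by (simp add: det_reflection[OF norm_n] crossing_det_def x_def y_def)
  also have "\<dots> = ?d (reflection n p) (\<alpha> *\<^sub>R fst (tangent \<Gamma> (tau n x))) (\<beta> *\<^sub>R fst (tangent \<Gamma> (tau n y)))"
    using \<alpha>(2) \<beta>(2) by (metis fst_scaleR fst_tau)
  also have "\<dots> = - (\<alpha> * \<beta> * crossing_det \<Gamma> (reflection n p))"
    by (simp add: det_scale_rows crossing_det_def upper lower det_swap_rows[of _ "fst (tangent \<Gamma> (tau n y))"])
  finally have det: "crossing_det \<Gamma> p = \<alpha> * \<beta> * crossing_det \<Gamma> (reflection n p)" by simp
  have "crossing_det \<Gamma> p \<noteq> 0" using generic p by (simp add: generic_projection_def)
  then have positive: "positive_crossing \<Gamma> (reflection n p) \<longleftrightarrow> (positive_crossing \<Gamma> p \<longleftrightarrow> \<alpha> * \<beta> > 0)"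
    using \<alpha>(1) \<beta>(1) by (auto simp: det positive_crossing_def zero_less_mult_iff mult_less_0_iff)
  have "reflection n p \<in> reflection n ` s \<longleftrightarrow> p \<in> s"
    using reflection_reflection[OF norm_n] by (metis imageE imageI)
  then have oriented: "oriented_at \<Gamma> (reflection n ` s) (reflection n p) \<longleftrightarrow>
      (oriented_at \<Gamma> s p \<longleftrightarrow> \<alpha> * \<beta> > 0)"
    using positive by (auto simp: oriented_at_def)
  note ends = \<alpha>(3)[of 1] \<alpha>(3)[of "-1"] \<beta>(3)[of 1] \<beta>(3)[of "-1"]
  show ?thesis
    unfolding joins_def Let_def upper lower oriented arc_in_eq arc_out_eq
      x_def[symmetric] y_def[symmetric] r_def
    using ends \<alpha>(1) \<beta>(1)
    by (cases "\<alpha> > 0"; cases "\<beta> > 0"; cases "oriented_at \<Gamma> s p")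
      (auto simp: sgn_if zero_less_mult_iff)
qed

lemma joined_reflection:
  assumes "(A, A') \<in> joined s"
  shows "(reflection n ` A, reflection n ` A') \<in> joined (reflection n ` s)"
proof -
  obtain p where p: "p \<in> crossings \<Gamma>" "(A, A') \<in> joins \<Gamma> s p \<union> (joins \<Gamma> s p)\<inverse>"
    using assms unfolding joined_def by blast
  have "(reflection n ` A, reflection n ` A') \<in>
    joins \<Gamma> (reflection n ` s) (reflection n p) \<union> (joins \<Gamma> (reflection n ` s) (reflection n p))\<inverse>"
    using subsetD[OF joins_reflection[OF p(1), of s] imageI[OF p(2)]] by simp
  then show ?thesis using reflection_crossings[OF p(1)] unfolding joined_def by blast
qed

lemma joined_rtrancl_reflection:
  assumes "(A, A') \<in> (joined s)\<^sup>*"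
  shows "(reflection n ` A, reflection n ` A') \<in> (joined (reflection n ` s))\<^sup>*"
  using assms by (induction rule: rtrancl_induct) (auto dest: joined_reflection intro: rtrancl_into_rtrancl)

lemma image_reflection_twice: "reflection n ` reflection n ` A = A"
  by (simp add: image_image reflection_reflection[OF norm_n])

lemma circles_reflection:
  assumes "C \<in> circles \<Gamma> s"
  shows "(\<lambda>A. reflection n ` A) ` C \<in> circles \<Gamma> (reflection n ` s)"
proof -
  obtain A where A: "A \<in> arcs \<Gamma>" "C = (joined s)\<^sup>* `` {A}" using assms by (auto simp: circles_eq)
  have "(\<lambda>A. reflection n ` A) ` C = (joined (reflection n ` s))\<^sup>* `` {reflection n ` A}"
  proof (intro equalityI subsetI)
    fix A' assume "A' \<in> (joined (reflection n ` s))\<^sup>* `` {reflection n ` A}"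
    then have "(A, reflection n ` A') \<in> (joined s)\<^sup>*"
      using joined_rtrancl_reflection[of "reflection n ` A" A' "reflection n ` s"]
      by (simp add: image_reflection_twice)
    then have "reflection n ` reflection n ` A' \<in> (\<lambda>A. reflection n ` A) ` C" unfolding A(2) by blast
    then show "A' \<in> (\<lambda>A. reflection n ` A) ` C" by (simp only: image_reflection_twice)
  qed (use joined_rtrancl_reflection A(2) in auto)
  then show ?thesis using reflection_arcs[OF A(1)] by (simp add: circles_eq)
qed

text \<open>
  The heights of the points of the link above a point of the axis form a set that is symmetric about 0.
  Above a crossing it has exactly two elements, so it does not contain 0.
\<close>

lemma axis_point_not_crossing:
  assumes "b \<in> link_set \<Gamma>" "b \<in> fixed_axis n"
  shows "fst b \<notin> crossings \<Gamma>"
proof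
  assume "fst b \<in> crossings \<Gamma>"
  then obtain a c where ac: "a < c" "{q. (fst b, q) \<in> link_set \<Gamma>} = {a, c}" by (rule crossing_points)
  have b: "b = (fst b, 0)" "reflection n (fst b) = fst b"
    using assms(2) by (auto simp: fixed_axis_def great_circle_def reflection_fixed)
  have neg: "- q \<in> {a, c}" if "q \<in> {a, c}" for q
  proof -
    have "(fst b, q) \<in> link_set \<Gamma>" using that ac(2) by blast
    from tau_mem[OF this] have "(fst b, - q) \<in> link_set \<Gamma>" by (simp add: tau_def b(2))
    then show ?thesis using ac(2) by blast
  qed
  have "(fst b, 0) \<in> link_set \<Gamma>" using assms(1) b(1) by simp
  then have "0 \<in> {a, c}" using ac(2) by blast
  then show False using neg[of a] neg[of c] ac(1) by auto
qed

text \<open>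
  The arc \<open>A\<close> through the basepoint determines the basepointed circle of each smoothing as its class
  under the joins.
\<close>

lemma splitting:
  assumes b: "b \<in> link_set \<Gamma>" "b \<in> fixed_axis n"
  shows "linear_iso (Kh_tau n \<Gamma> i j k)
    (direct_sum (reduced_Kh_tau n \<Gamma> b i (j + 1) k) (reduced_Kh_tau n \<Gamma> b i (j - 1) k))"
proof -
  obtain A where A: "A \<in> arcs \<Gamma>" "fst b \<in> A"
    using b(1) axis_point_not_crossing[OF b] by (rule arc_through)
  interpret based_symmetric_cube n \<Gamma> b "\<lambda>s. (joined s)\<^sup>* `` {A}"
  proof
    show "finite (crossings \<Gamma>)" using generic by (simp add: generic_projection_def)
    show "reflection n (fst b) = fst b"
      using b(2) by (auto simp: fixed_axis_def great_circle_def reflection_fixed)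
    show "tau_decorated n (tau_decorated n x) = x" for x
      by (cases x) (simp add: tau_decorated_def image_image reflection_reflection[OF norm_n])
    show "tau_decorated n x \<in> decorated_smoothings \<Gamma>" if "x \<in> decorated_smoothings \<Gamma>" for x
      using that circles_reflection reflection_crossings
      by (cases x) (auto simp: tau_decorated_def decorated_smoothings_def)
  qed (use A circle_through[OF A] in \<open>auto simp: finite_circles circles_eq[symmetric]\<close>, simp add: circles_eq)
  show ?thesis by (rule linear_iso_Kh_tau)
qed

end

section \<open>Strongly invertible links meet the axis\<close>

lemma decreasing_fixed_point:
  fixes h :: "real \<Rightarrow> real"
  assumes "continuous_on UNIV h" "\<And>s t. s < t \<Longrightarrow> h t < h s"
  shows "\<exists>t. h t = t"
proof -
  define lo hi where "lo = min 0 (h 0)" and "hi = max 0 (h 0)"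
  have "h hi \<le> hi" "lo \<le> h lo"
    using assms(2)[of 0 "h 0"] assms(2)[of "h 0" 0]
    by (cases "h 0" "0 :: real" rule: linorder_cases; simp add: lo_def hi_def)+
  moreover have "lo \<le> hi" by (simp add: lo_def hi_def)
  moreover have "continuous_on {lo..hi} (\<lambda>t. h t - t)"
    using assms(1) by (intro continuous_intros) (auto intro: continuous_on_subset)
  ultimately obtain t where "h t - t = 0" using IVT2'[of "\<lambda>t. h t - t" hi 0 lo] by auto
  then show ?thesis by (intro exI[of _ t]) simp
qed

lemma no_increasing_integer_function:
  fixes \<phi> :: "real \<Rightarrow> real"
  assumes "continuous_on UNIV \<phi>" "\<phi> 0 < \<phi> 1" "\<And>t. \<phi> t \<in> \<int>"
  shows False
proof -
  have "\<phi> 1 - \<phi> 0 \<ge> 1"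
    using Ints_nonzero_abs_less1[of "\<phi> 1 - \<phi> 0"] assms(2,3) by fastforce
  moreover have "continuous_on {0..1} \<phi>" using assms(1) by (rule continuous_on_subset) simp
  ultimately obtain t where "\<phi> t = \<phi> 0 + 1/2" using IVT'[of \<phi> 0 "\<phi> 0 + 1/2" 1] by auto
  then have "1/2 \<in> (\<int> :: real set)" using Ints_diff[OF assms(3)[of t] assms(3)[of 0]] by simp
  then show False using Ints_nonzero_abs_less1[of "1/2 :: real"] by simp
qed

lemma range_reverse: "range (\<lambda>t. \<gamma> (- t)) = range \<gamma>" for \<gamma> :: curve
proof (intro equalityI subsetI)
  fix x assume "x \<in> range \<gamma>"
  then obtain t where "x = \<gamma> (- (- t))" by auto
  then show "x \<in> range (\<lambda>t. \<gamma> (- t))" by (rule range_eqI)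
qed auto

lemma closed_curve_reverse:
  assumes "closed_curve \<gamma>"
  shows "closed_curve (\<lambda>t. \<gamma> (- t))"
proof -
  have C1: "\<And>t. \<gamma> differentiable at t" "continuous_on UNIV (\<lambda>t. vector_derivative \<gamma> (at t))"
    using assms by (simp_all add: closed_curve_def C1_differentiable_on_eq)
  have D: "((\<lambda>t. \<gamma> (- t)) has_vector_derivative - vector_derivative \<gamma> (at (- t))) (at t)" for t
  proof -
    have "(\<gamma> \<circ> uminus has_vector_derivative (- 1) *\<^sub>R vector_derivative \<gamma> (at (- t))) (at t)"
      by (rule vector_diff_chain_at)
        (use C1(1) in \<open>auto intro!: derivative_eq_intros simp: vector_derivative_works[symmetric]\<close>)
    then show ?thesis by (simp add: o_def)
  qed
  have "continuous_on UNIV (\<lambda>t. - vector_derivative \<gamma> (at (- t)))"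
    by (intro continuous_on_minus continuous_on_compose2[OF C1(2)] continuous_intros) simp
  moreover have "- s - - t \<in> \<int> \<longleftrightarrow> s - t \<in> \<int>" for s t :: real
    using minus_in_Ints_iff[of "s - t"] by simp
  ultimately show ?thesis
    using assms
    by (simp add: closed_curve_def C1_differentiable_on_eq vector_derivative_at[OF D]
        differentiableI_vector[OF D] range_reverse del: minus_diff_minus)
qed

lemma (in generic_involutive_link) fixed_point_on_axis:
  assumes "x \<in> link_set \<Gamma>" "tau n x = x"
  shows "x \<in> fixed_axis n"
proof -
  have "fst x \<in> sphere 0 1"
    using assms(1) closed by (force simp: link_set_def closed_curve_def)
  moreover have "reflection n (fst x) = fst x" "- snd x = snd x"
    using assms(2) by (metis fst_conv tau_def, metis snd_conv tau_def)
  moreover from this have "fst x \<bullet> n = 0" using norm_n by (auto simp: reflection_def)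
  ultimately show ?thesis by (cases x) (simp add: fixed_axis_def great_circle_def)
qed

text \<open>
  If \<open>\<gamma>\<close> is carried to itself, then in its parameter the involution is a decreasing function, which has a
  fixed point.  If \<open>\<gamma>\<close> were carried to another component \<open>\<delta>\<close>, compare the given orientation with the
  one where only \<open>\<gamma>\<close> is reversed: both would lift the same map to decreasing functions \<open>h\<close> and
  \<open>h'\<close>, so that \<open>h (- t)\<close> and \<open>h' t\<close> would differ by integers although one increases and the
  other decreases.
\<close>

lemma (in generic_involutive_link) strongly_invertible_meets_axis:
  assumes si: "strongly_invertible n \<Gamma>" and "\<Gamma> \<noteq> {}"
  shows "link_set \<Gamma> \<inter> fixed_axis n \<noteq> {}"
proof -
  obtain \<gamma> where \<gamma>: "\<gamma> \<in> \<Gamma>" using assms(2) by blast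
  have reverses: "tau_reverses n \<Gamma>'" if "oriented_link \<Gamma>'" "link_set \<Gamma>' = link_set \<Gamma>" for \<Gamma>'
    using si that by (simp add: strongly_invertible_def)
  obtain \<delta> h where \<delta>: "\<delta> \<in> \<Gamma>" and h: "continuous_on UNIV h" "\<And>s t. s < t \<Longrightarrow> h t < h s"
    "\<And>t. tau n (\<gamma> t) = \<delta> (h t)"
    using reverses[OF link refl] \<gamma> unfolding tau_reverses_def by metis
  have "\<delta> = \<gamma>"
  proof (rule ccontr)
    assume "\<delta> \<noteq> \<gamma>"
    define \<gamma>r where "\<gamma>r t = \<gamma> (- t)" for t
    define \<Gamma>' where "\<Gamma>' = insert \<gamma>r (\<Gamma> - {\<gamma>})"
    have range: "range \<gamma>r = range \<gamma>" unfolding \<gamma>r_def by (rule range_reverse)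
    have "closed_curve \<gamma>r" unfolding \<gamma>r_def by (rule closed_curve_reverse[OF closed[OF \<gamma>]])
    moreover have "range \<gamma> \<inter> range \<gamma>' = {}" if "\<gamma>' \<in> \<Gamma> - {\<gamma>}" for \<gamma>'
      using link \<gamma> that unfolding oriented_link_def by blast
    ultimately have "oriented_link \<Gamma>'"
      using link unfolding oriented_link_def \<Gamma>'_def by (auto simp: range)
    moreover have "link_set \<Gamma>' = link_set \<Gamma>"
      using \<gamma> unfolding link_set_def \<Gamma>'_def by (auto simp: range)
    ultimately have "tau_reverses n \<Gamma>'" by (rule reverses)
    moreover have "\<gamma>r \<in> \<Gamma>'" by (simp add: \<Gamma>'_def)
    ultimately obtain \<delta>' h' where \<delta>': "\<delta>' \<in> \<Gamma>'"
      and h': "continuous_on UNIV h'" "\<And>s t. s < t \<Longrightarrow> h' t < h' s" "\<And>t. tau n (\<gamma>r t) = \<delta>' (h' t)"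
      unfolding tau_reverses_def by metis
    have eq: "\<delta> (h (- t)) = \<delta>' (h' t)" for t using h(3)[of "- t"] h'(3)[of t] by (simp add: \<gamma>r_def)
    have "\<delta>' \<noteq> \<gamma>r"
      using eq[of 0] curves_meet[OF \<delta> \<gamma>] \<open>\<delta> \<noteq> \<gamma>\<close> unfolding \<gamma>r_def by blast
    then have "\<delta>' = \<delta>" using \<delta>' curves_meet[of \<delta> \<delta>' "h (- 0)" "h' 0"] \<delta> eq[of 0] unfolding \<Gamma>'_def by blast
    show False
    proof (rule no_increasing_integer_function)
      show "continuous_on UNIV (\<lambda>t. h (- t) - h' t)"
        by (intro continuous_intros continuous_on_compose2[OF h(1)] h'(1)) simp
      show "h (- 0) - h' 0 < h (- 1) - h' 1" using h(2)[of "-1" 0] h'(2)[of 0 1] by simp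
      show "h (- t) - h' t \<in> \<int>" for t
        using eq[of t] curve_eq_iff[OF \<delta>] unfolding \<open>\<delta>' = \<delta>\<close> by blast
    qed
  qed
  obtain t where "h t = t" using decreasing_fixed_point[OF h(1,2)] by blast
  then have "tau n (\<gamma> t) = \<gamma> t" using h(3)[of t] \<open>\<delta> = \<gamma>\<close> by simp
  then show ?thesis using fixed_point_on_axis link_setI[OF \<gamma>] by blast
qed

section \<open>The splitting\<close>

theorem proposition1p5:
  fixes n :: "real^3" and \<Gamma> :: "curve set"
  assumes "norm n = 1"
    and "involutive_link n \<Gamma>"
    and "generic_projection \<Gamma>"
  shows "((\<exists>\<gamma>\<in>\<Gamma>. range \<gamma> \<inter> fixed_axis n \<noteq> {}) \<longrightarrow>
           (\<forall>b \<in> link_set \<Gamma> \<inter> fixed_axis n. \<forall>(i::int) (j::int) (k::rat). 2 * k \<in> \<int> \<longrightarrow>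
              linear_iso (Kh_tau n \<Gamma> i j k)
                (direct_sum (reduced_Kh_tau n \<Gamma> b i (j + 1) k)
                            (reduced_Kh_tau n \<Gamma> b i (j - 1) k)))) \<and>
         (strongly_invertible n \<Gamma> \<and> \<Gamma> \<noteq> {} \<longrightarrow>
           link_set \<Gamma> \<inter> fixed_axis n \<noteq> {} \<and>
           (\<forall>b \<in> link_set \<Gamma> \<inter> fixed_axis n. \<forall>(i::int) (j::int) (k::rat). 2 * k \<in> \<int> \<longrightarrow>
              linear_iso (Kh_tau n \<Gamma> i j k)
                (direct_sum (reduced_Kh_tau n \<Gamma> b i (j + 1) k)
                            (reduced_Kh_tau n \<Gamma> b i (j - 1) k))))"
proof -
  interpret generic_involutive_link \<Gamma> n
    using assms by unfold_locales (auto simp: involutive_link_def)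
  show ?thesis using splitting strongly_invertible_meets_axis by blast
qed

end
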